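(* Let $X_1,\dots,X_k$ be smooth vector fields on $\mathbb{R}^n$ spanning a distribution $V$ of $k$-planes, and assume that there are vector fields $X_{k+1},\dots,X_n$, which are commutators of degree $2$ of elements of $\{X_1,\dots,X_k\}$, such that $X_1(x),\dots,X_n(x)$ are linearly independent for every $x\in\mathbb{R}^n$. Set $W(x):=\mathrm{span}\{X_{k+1}(x),\dots,X_n(x)\}$. Then the Carnot-Carathéodory metric $d_V$ associated to $V$ is $2$-squeezed on $V$. In particular, the metrics $d_V$ and $d_{V,2}$ are locally equivalent: for every $x\in\mathbb{R}^n$ there are an open neighbourhood $U$ of $x$ and a constant $C>1$ such that $C^{-1}d_V(y,z)\le d_{V,2}(y,z)\le C\,d_V(y,z)$ for all $y,z\in U$.
   Context: A commutator of degree $2$ of elements of $\{X_1,\dots,X_k\}$ is a Lie bracket $[X_i,X_j]$ with $i,j\in\{1,\dots,k\}$. $\Pi^V_x$ denotes the projection onto $V(x)$ along $W(x)$ and $\Pi^W_x:=\mathrm{id}-\Pi^V_x$. Carnot-Carathéodory metric: an absolutely continuous curve $\gamma:[0,1]\to\mathbb{R}^n$ is horizontal if $\gamma'(t)\in V(\gamma(t))$ for a.e. $t$; $d_V(x,y)$ is the infimum of the Euclidean lengths of horizontal curves joining $x$ to $y$. For $\eta\in[1,2]$, a metric $d$ on $\mathbb{R}^n$ is $\eta$-squeezed on $V$ if for every compact $K\subset\mathbb{R}^n$ there are constants $C=C(d,K)>1$ and $r=r(d,K)>0$ such that $$C^{-1}\big(|\Pi^V_x[y-x]|+|\Pi^W_x[y-x]|^{1/\eta}\big)\le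 d(x,y)\le C\big(|\Pi^V_x[y-x]|+|\Pi^W_x[y-x]|^{1/\eta}\big)$$ for every $x\in K$ and every $y\in B_d(x,r)$ (closed $d$-ball). The metric $d_{V,\eta}$: for a Lipschitz curve $\gamma:[0,1]\to\mathbb{R}^n$ and $t\in[0,1]$ the derived set is $$\mathcal{D}\gamma(t):=\bigcap_{r>0}\overline{\Big\{\tfrac{\gamma(a)-\gamma(b)}{a-b}:\ a<b,\ a,b\in[0,1],\ |a-t|+|b-t|\le r\Big\}},$$ $\ell_\eta(\gamma):=\sup_{t\in[0,1]}\max_{v\in\mathcal{D}\gamma(t)}\big(|\Pi^V_{\gamma(t)}[v]|+|\Pi^W_{\gamma(t)}[v]|^{1/\eta}\big)$, and $$d_{V,\eta}(x,y):=\inf\{\ell_\eta(\gamma):\gamma\in\mathrm{Lip}([0,1],\mathbb{R}^n),\ \gamma(0)=x,\ \gamma(1)=y\}.$$ *)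

theory Defs
  imports "HOL-Analysis.Analysis"
begin

primrec C_times :: "nat \<Rightarrow> ('a::euclidean_space \<Rightarrow> 'b::real_normed_vector) \<Rightarrow> bool" where
  "C_times 0 f \<longleftrightarrow> continuous_on UNIV f"
| "C_times (Suc m) f \<longleftrightarrow> (\<forall>x. f differentiable (at x)) \<and>
     (\<forall>v. C_times m (\<lambda>x. frechet_derivative f (at x) v))"

definition smooth :: "('a::euclidean_space \<Rightarrow> 'b::real_normed_vector) \<Rightarrow> bool" where
  "smooth f \<longleftrightarrow> (\<forall>m. C_times m f)"

definition lie_bracket ::
  "('a::euclidean_space \<Rightarrow> 'a) \<Rightarrow> ('a \<Rightarrow> 'a) \<Rightarrow> 'a \<Rightarrow> 'a" where
  "lie_bracket X Y x =
     frechet_derivative Y (at x) (X x) - frechet_derivative X (at x) (Y x)"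

definition span_field :: "(nat \<Rightarrow> 'a \<Rightarrow> 'a) \<Rightarrow> nat set \<Rightarrow> 'a::euclidean_space \<Rightarrow> 'a set" where
  "span_field X I x = span ((\<lambda>i. X i x) ` I)"

text \<open>The projection onto \<open>P\<close> along \<open>Q\<close>; meaningful only if the whole space is the direct sum
  of \<open>P\<close> and \<open>Q\<close>.\<close>

definition proj_along :: "'a set \<Rightarrow> 'a set \<Rightarrow> 'a \<Rightarrow> 'a::euclidean_space" where
  "proj_along P Q v = (THE u. u \<in> P \<and> v - u \<in> Q)"

text \<open>The quantity $|\Pi^V_x[v]| + |\Pi^W_x[v]|^{1/\eta}$, which occurs both in the notion of a
  squeezed metric and in the functional $\ell_\eta$.\<close>

definition gauge_VW ::
  "real \<Rightarrow> ('a \<Rightarrow> 'a set) \<Rightarrow> ('a \<Rightarrow> 'a set) \<Rightarrow> 'a \<Rightarrow> 'a::euclidean_space \<Rightarrow> real" where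
  "gauge_VW \<eta> V W x v =
     norm (proj_along (V x) (W x) v) + norm (v - proj_along (V x) (W x) v) powr (1 / \<eta>)"

definition abs_continuous_on01 :: "(real \<Rightarrow> 'a::euclidean_space) \<Rightarrow> bool" where
  "abs_continuous_on01 \<gamma> \<longleftrightarrow>
     (\<forall>\<epsilon>>0. \<exists>\<delta>>0. \<forall>(n::nat) a b.
        (\<forall>i<n. 0 \<le> a i \<and> a i \<le> b i \<and> b i \<le> 1) \<and>
        disjoint_family_on (\<lambda>i. {a i<..<b i}) {..<n} \<and>
        (\<Sum>i<n. b i - a i) < \<delta> \<longrightarrow>
        (\<Sum>i<n. norm (\<gamma> (b i) - \<gamma> (a i))) < \<epsilon>)"

definition horizontal :: "('a \<Rightarrow> 'a set) \<Rightarrow> (real \<Rightarrow> 'a::euclidean_space) \<Rightarrow> bool" where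
  "horizontal V \<gamma> \<longleftrightarrow> abs_continuous_on01 \<gamma> \<and>
     (AE t in lebesgue_on {0..1}.
        \<exists>v \<in> V (\<gamma> t). (\<gamma> has_vector_derivative v) (at t within {0..1}))"

text \<open>The Euclidean length of an absolutely continuous curve is the integral of its speed.\<close>

definition curve_length :: "(real \<Rightarrow> 'a::euclidean_space) \<Rightarrow> ennreal" where
  "curve_length \<gamma> =
     (\<integral>\<^sup>+t. ennreal (norm (vector_derivative \<gamma> (at t within {0..1}))) \<partial>lebesgue_on {0..1})"

text \<open>Distances defined as infima of lengths take values in the extended nonnegative reals, so that
  the infimum is \<open>\<infinity>\<close> if there are no admissible curves.\<close>

definition cc_dist :: "('a \<Rightarrow> 'a set) \<Rightarrow> 'a \<Rightarrow> 'a::euclidean_space \<Rightarrow> ennreal" where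
  "cc_dist V x y = (INF \<gamma> \<in> {\<gamma>. horizontal V \<gamma> \<and> \<gamma> 0 = x \<and> \<gamma> 1 = y}. curve_length \<gamma>)"

definition is_metric :: "('a \<Rightarrow> 'a \<Rightarrow> ennreal) \<Rightarrow> bool" where
  "is_metric d \<longleftrightarrow> (\<forall>x y. d x y < \<infinity>) \<and> Metric_space UNIV (\<lambda>x y. enn2real (d x y))"

definition squeezed ::
  "real \<Rightarrow> ('a \<Rightarrow> 'a set) \<Rightarrow> ('a \<Rightarrow> 'a set) \<Rightarrow> ('a \<Rightarrow> 'a::euclidean_space \<Rightarrow> ennreal) \<Rightarrow> bool" where
  "squeezed \<eta> V W d \<longleftrightarrow> is_metric d \<and>
     (\<forall>K. compact K \<longrightarrow> (\<exists>C>1. \<exists>r>0. \<forall>x\<in>K. \<forall>y. enn2real (d x y) \<le> r \<longrightarrow>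
        gauge_VW \<eta> V W x (y - x) / C \<le> enn2real (d x y) \<and>
        enn2real (d x y) \<le> C * gauge_VW \<eta> V W x (y - x)))"

definition derived_set :: "(real \<Rightarrow> 'a::euclidean_space) \<Rightarrow> real \<Rightarrow> 'a set" where
  "derived_set \<gamma> t = (\<Inter>r\<in>{0<..}. closure
     {(\<gamma> a - \<gamma> b) /\<^sub>R (a - b) | a b.
        a < b \<and> a \<in> {0..1} \<and> b \<in> {0..1} \<and> \<bar>a - t\<bar> + \<bar>b - t\<bar> \<le> r})"

text \<open>For Lipschitz \<open>\<gamma>\<close> the derived sets are nonempty and compact, so if the gauge is continuous
  in its last argument, then the inner supremum is a maximum.\<close>

definition ell ::
  "real \<Rightarrow> ('a \<Rightarrow> 'a set) \<Rightarrow> ('a \<Rightarrow> 'a set) \<Rightarrow> (real \<Rightarrow> 'a::euclidean_space) \<Rightarrow> ennreal" where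
  "ell \<eta> V W \<gamma> =
     (SUP t\<in>{0..1}. SUP v\<in>derived_set \<gamma> t. ennreal (gauge_VW \<eta> V W (\<gamma> t) v))"

definition dist_V_eta ::
  "real \<Rightarrow> ('a \<Rightarrow> 'a set) \<Rightarrow> ('a \<Rightarrow> 'a set) \<Rightarrow> 'a \<Rightarrow> 'a::euclidean_space \<Rightarrow> ennreal" where
  "dist_V_eta \<eta> V W x y =
     (INF \<gamma> \<in> {\<gamma>. (\<exists>L. L-lipschitz_on {0..1} \<gamma>) \<and> \<gamma> 0 = x \<and> \<gamma> 1 = y}. ell \<eta> V W \<gamma>)"

end

theory Submission
  imports Defs
begin

text \<open>
  Let \<open>g\<close> be the gauge of \<open>y - x\<close> at \<open>x\<close>, that is, the norm of its \<open>V\<close>-component plus the square root of the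
  norm of its \<open>W\<close>-component. That the Carnot-Caratheodory distance is comparable with \<open>g\<close> for nearby
  points is the ball-box theorem in step two.

  The lower bound is an integration. The velocity of a horizontal curve lies in \<open>V\<close> at the moving
  point; the projections depend on the point in a Lipschitz way (\<open>frame_bound_exists\<close>), so along a
  curve of length \<open>l\<close> from \<open>x\<close> the velocity has a \<open>W\<close>-component with respect to \<open>x\<close> of size \<open>O(l)\<close> times
  the speed, and the increment one of size \<open>O(l\<^sup>2)\<close> (\<open>cc_dist_less_imp_in_box\<close>). This uses the fundamental
  theorem of calculus for absolutely continuous curves (\<open>abs_continuous_on01_has_integral\<close>).

  For the upper bound one has to construct horizontal curves. Displacements in \<open>V\<close> are realized by
  flows, and displacements by \<open>s\<^sup>2 [X a, X b]\<close> by loops of four flows of time \<open>s\<close>, up to an error \<open>O(s\<^sup>3)\<close>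
  (\<open>commutator_reach\<close>). A move along \<open>V\<close> followed by a move along \<open>W\<close> misses the target \<open>y\<close>, but
  from the new point \<open>y\<close> is seen in a box of half the size (\<open>halve_gauge\<close>). Iterating gives infinitely many
  curves with geometrically decreasing lengths, and their concatenation (\<open>reach_infinite\<close>) ends at \<open>y\<close>
  and has length \<open>O(g)\<close> (\<open>ball_box\<close>). Finiteness of the distance for all pairs of points follows by
  connectedness.

  For the local equivalence with \<open>dist_V_eta\<close>, the gauge of \<open>z - y\<close> changes little along the segment from
  \<open>y\<close> to \<open>z\<close>, so this segment shows that \<open>dist_V_eta\<close> is at most a constant times the
  Carnot-Caratheodory distance. Conversely, for a Lipschitz curve with \<open>ell \<le> e \<le> 1\<close> the argument of
  the lower bound works again, with derived sets in place of velocities, and bounds the gauge of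
  \<open>z - y\<close> by \<open>O(e)\<close> (\<open>derived_set_linear_bound\<close>, \<open>ell_imp_in_box\<close>); the ball-box estimate
  then bounds the Carnot-Caratheodory distance.
\<close>

section \<open>Absolutely continuous curves and their lengths\<close>

definition small_intervals :: "'i set \<Rightarrow> ('i \<Rightarrow> real) \<Rightarrow> ('i \<Rightarrow> real) \<Rightarrow> real \<Rightarrow> bool" where
  "small_intervals S a b \<delta> \<longleftrightarrow> finite S \<and> (\<forall>i\<in>S. 0 \<le> a i \<and> a i \<le> b i \<and> b i \<le> 1) \<and>
     disjoint_family_on (\<lambda>i. {a i<..<b i}) S \<and> (\<Sum>i\<in>S. b i - a i) < \<delta>"

lemma abs_continuous_on01_iff:
  "abs_continuous_on01 \<gamma> \<longleftrightarrow> (\<forall>\<epsilon>>0. \<exists>\<delta>>0. \<forall>(n::nat) a b. small_intervals {..<n} a b \<delta> \<longrightarrow>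
     (\<Sum>i<n. norm (\<gamma> (b i) - \<gamma> (a i))) < \<epsilon>)"
  unfolding abs_continuous_on01_def small_intervals_def by (simp add: Ball_def)

lemma abs_continuous_on01E:
  assumes "abs_continuous_on01 \<gamma>" "\<epsilon> > 0"
  shows "\<exists>\<delta>>0. \<forall>(n::nat) a b. small_intervals {..<n} a b \<delta> \<longrightarrow>
     (\<Sum>i<n. norm (\<gamma> (b i) - \<gamma> (a i))) < \<epsilon>"
  using assms unfolding abs_continuous_on01_iff by (elim allE impE)

text \<open>The definition of absolute continuity speaks of intervals numbered by naturals; tagged
  divisions are finite sets of pairs, so arbitrary finite index sets are needed.\<close>

lemma abs_continuous_on01_finite_family:
  assumes "abs_continuous_on01 \<gamma>" "\<epsilon> > 0"
  shows "\<exists>\<delta>>0. \<forall>(S::'i set) a b. small_intervals S a b \<delta> \<longrightarrow>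
      (\<Sum>i\<in>S. norm (\<gamma> (b i) - \<gamma> (a i))) < \<epsilon>"
proof -
  obtain \<delta> where \<delta>: "\<delta> > 0" and main: "\<forall>(n::nat) a b. small_intervals {..<n} a b \<delta> \<longrightarrow>
        (\<Sum>i<n. norm (\<gamma> (b i) - \<gamma> (a i))) < \<epsilon>"
    using abs_continuous_on01E[OF assms] by (elim exE conjE) (rule that)
  show ?thesis
  proof (intro exI[of _ \<delta>] conjI allI impI)
    show "\<delta> > 0" by (fact \<delta>)
    fix S :: "'i set" and a b :: "'i \<Rightarrow> real"
    assume "small_intervals S a b \<delta>"
    then have S: "finite S" and ab: "\<And>i. i \<in> S \<Longrightarrow> 0 \<le> a i \<and> a i \<le> b i \<and> b i \<le> 1"
      and disj: "disjoint_family_on (\<lambda>i. {a i<..<b i}) S" and small: "(\<Sum>i\<in>S. b i - a i) < \<delta>"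
      by (auto simp: small_intervals_def)
    obtain h where h: "bij_betw h {0..<card S} S"
      using ex_bij_betw_nat_finite[OF S] by blast
    then have h': "bij_betw h {..<card S} S"
      by (simp add: lessThan_atLeast0)
    have inS: "h i \<in> S" if "i < card S" for i
      using h' that by (auto simp: bij_betw_def)
    have "(\<Sum>i<card S. norm (\<gamma> ((b \<circ> h) i) - \<gamma> ((a \<circ> h) i))) < \<epsilon>"
    proof (rule main[rule_format], unfold small_intervals_def, intro conjI)
      show "finite {..<card S}" by simp
      show "\<forall>i\<in>{..<card S}. 0 \<le> (a \<circ> h) i \<and> (a \<circ> h) i \<le> (b \<circ> h) i \<and> (b \<circ> h) i \<le> 1"
        using ab inS by simp
      show "disjoint_family_on (\<lambda>i. {(a \<circ> h) i<..<(b \<circ> h) i}) {..<card S}"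
        unfolding disjoint_family_on_def
      proof (intro ballI impI)
        fix i j assume "i \<in> {..<card S}" "j \<in> {..<card S}" "i \<noteq> j"
        then have "h i \<in> S" "h j \<in> S" "h i \<noteq> h j"
          using h' by (auto simp: bij_betw_def inj_on_def)
        then have "{a (h i)<..<b (h i)} \<inter> {a (h j)<..<b (h j)} = {}"
          using disj unfolding disjoint_family_on_def by blast
        then show "{(a \<circ> h) i<..<(b \<circ> h) i} \<inter> {(a \<circ> h) j<..<(b \<circ> h) j} = {}"
          unfolding comp_def .
      qed
      show "(\<Sum>i<card S. (b \<circ> h) i - (a \<circ> h) i) < \<delta>"
        using small sum.reindex_bij_betw[OF h', of "\<lambda>i. b i - a i"] by simp
    qed
    then show "(\<Sum>i\<in>S. norm (\<gamma> (b i) - \<gamma> (a i))) < \<epsilon>"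
      using sum.reindex_bij_betw[OF h', of "\<lambda>i. norm (\<gamma> (b i) - \<gamma> (a i))"] by simp
  qed
qed

text \<open>The fundamental theorem of calculus for absolutely continuous curves, straight from the
  definition of the gauge integral. Choose the gauge so that intervals tagged off the null set \<open>N\<close>
  see a good linear approximation, and intervals tagged in \<open>N\<close> stay inside an open set \<open>U\<close> that covers
  \<open>N\<close> and has tiny measure. The first kind contributes a small error by differentiability; over the
  second kind the increments of \<open>\<gamma>\<close> are small in total by absolute continuity. In particular the
  velocity is measurable and integrable without further work.\<close>

lemma abs_continuous_on01_has_integral:
  fixes \<gamma> :: "real \<Rightarrow> 'a::euclidean_space"
  assumes ac: "abs_continuous_on01 \<gamma>" and N: "negligible N"
    and der: "\<And>t. t \<in> {0..1} - N \<Longrightarrow> (\<gamma> has_vector_derivative g t) (at t within {0..1})"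
    and ab: "0 \<le> a" "a \<le> b" "b \<le> 1"
  shows "(g has_integral \<gamma> b - \<gamma> a) {a..b}"
proof -
  \<comment> \<open>Points of \<open>N\<close> may occur as tags, so the integrand has to vanish there.\<close>
  define g0 where "g0 t = (if t \<in> N then 0 else g t)" for t
  have int0: "(g0 has_integral \<gamma> b - \<gamma> a) {a..b}"
    unfolding has_integral_real
  proof (intro allI impI)
    fix e :: real assume e: "e > 0"
    obtain \<delta> where \<delta>: "\<delta> > 0" and fam:
      "\<forall>(S::(real \<times> real set) set) u v. small_intervals S u v \<delta> \<longrightarrow>
        (\<Sum>i\<in>S. norm (\<gamma> (v i) - \<gamma> (u i))) < e / 2"
      using abs_continuous_on01_finite_family[OF ac half_gt_zero[OF e]]
      by (elim exE conjE) (rule that)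
    have Nnull: "N \<in> null_sets lebesgue"
      using N negligible_iff_null_sets by blast
    obtain U where U: "open U" "N \<subseteq> U" "emeasure lebesgue (U - N) < ennreal \<delta>"
      using sets_lebesgue_outer_open[of N \<delta>] Nnull \<delta> by (metis null_setsD2)
    have Usmall: "emeasure lebesgue U < ennreal \<delta>"
      using emeasure_Diff_null_set[OF Nnull, of U] U by (simp add: borel_open lborelD)
    have "\<exists>d>0. \<forall>s\<in>{0..1}. \<bar>s - t\<bar> < d \<longrightarrow> norm (\<gamma> s - \<gamma> t - (s - t) *\<^sub>R g t) \<le> e / 4 * \<bar>s - t\<bar>"
      if "t \<in> {0..1} - N" for t
    proof -
      have "(\<gamma> has_derivative (\<lambda>h. h *\<^sub>R g t)) (at t within {0..1})"
        using der[OF that] by (simp add: has_vector_derivative_def)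
      then have "\<forall>\<epsilon>>0. \<exists>d>0. \<forall>s\<in>{0..1}. norm (s - t) < d \<longrightarrow>
          norm (\<gamma> s - \<gamma> t - (s - t) *\<^sub>R g t) \<le> \<epsilon> * norm (s - t)"
        unfolding has_derivative_within_alt by blast
      from this[rule_format, of "e / 4"] show ?thesis using e by simp
    qed
    then obtain d where d: "\<And>t. t \<in> {0..1} - N \<Longrightarrow> d t > 0"
      "\<And>t s. \<lbrakk>t \<in> {0..1} - N; s \<in> {0..1}; \<bar>s - t\<bar> < d t\<rbrakk> \<Longrightarrow>
         norm (\<gamma> s - \<gamma> t - (s - t) *\<^sub>R g t) \<le> e / 4 * \<bar>s - t\<bar>"
      by metis
    define G where "G t = (if t \<in> N then U else ball t (if t \<in> {0..1} then d t else 1))" for t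
    have "gauge G"
      using U d(1) by (auto simp: gauge_def G_def)
    have riemann: "norm ((\<Sum>(x,k)\<in>p. measure lborel k *\<^sub>R g0 x) - (\<gamma> b - \<gamma> a)) < e"
      if p: "p tagged_division_of {a..b}" and fine: "G fine p" for p
    proof -
      define err where "err = (\<lambda>(x,k). measure lborel k *\<^sub>R g0 x - (\<gamma> (Sup k) - \<gamma> (Inf k)))"
      have fin: "finite p" using p by auto
      define u v where "u i = Inf (snd i)" and "v i = Sup (snd i)" for i :: "real \<times> real set"
      have mem: "snd i = {u i..v i}" "a \<le> u i" "u i \<le> fst i" "fst i \<le> v i" "v i \<le> b"
          "measure lborel (snd i) = v i - u i" "snd i \<subseteq> G (fst i)" if "i \<in> p" for i
      proof -
        obtain x k where i: "i = (x,k)" by fastforce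
        have k: "x \<in> k" "k \<subseteq> {a..b}" "\<exists>c d. k = {c..d}"
          using tagged_division_ofD(2-4)[OF p] that i by (auto simp flip: box_real)
        then obtain c d where cd: "k = {c..d}" "c \<le> d" by fastforce
        have "k \<subseteq> G x" using fine that i by (auto simp: fine_def)
        then show "snd i = {u i..v i}" "a \<le> u i" "u i \<le> fst i" "fst i \<le> v i" "v i \<le> b"
          "measure lborel (snd i) = v i - u i" "snd i \<subseteq> G (fst i)"
          using k i cd by (auto simp: u_def v_def)
      qed
      have sum_eq: "(\<Sum>(x,k)\<in>p. measure lborel k *\<^sub>R g0 x) - (\<gamma> b - \<gamma> a) = sum err p"
        using additive_tagged_division_1[OF ab(2) p, of \<gamma>]
        by (simp add: err_def case_prod_beta sum_subtractf)
      \<comment> \<open>The intervals tagged in the null set; their union lies in \<open>U\<close>.\<close>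
      define q where "q = {i\<in>p. fst i \<in> N}"
      have q: "q \<subseteq> p" "finite q" using fin by (auto simp: q_def)
      have disj: "disjoint_family_on (\<lambda>i. {u i<..<v i}) q"
        unfolding disjoint_family_on_def
      proof (intro ballI impI)
        fix i j assume ij: "i \<in> q" "j \<in> q" "i \<noteq> j"
        have "interior (snd i) \<inter> interior (snd j) = {}"
          using tagged_division_ofD(5)[OF p, of "fst i" "snd i" "fst j" "snd j"] ij q by auto
        moreover have "interior (snd i) = {u i<..<v i}" if "i \<in> p" for i
          using mem(1)[OF that] interior_atLeastAtMost_real by simp
        ultimately show "{u i<..<v i} \<inter> {u j<..<v j} = {}"
          using ij q by (metis subsetD)
      qed
      have "(\<Sum>i\<in>q. norm (\<gamma> (v i) - \<gamma> (u i))) < e / 2"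
      proof (rule fam[rule_format], unfold small_intervals_def, intro conjI ballI)
        show "finite q" by (fact q)
        show "0 \<le> u i" "u i \<le> v i" "v i \<le> 1" if "i \<in> q" for i
          using mem[of i] that q ab by auto
        show "disjoint_family_on (\<lambda>i. {u i<..<v i}) q" by (fact disj)
        have nonneg: "v i - u i \<ge> 0" if "i \<in> q" for i
          using mem[of i] that q by auto
        have "ennreal (\<Sum>i\<in>q. v i - u i) = (\<Sum>i\<in>q. ennreal (v i - u i))"
          using nonneg by simp
        also have "\<dots> = (\<Sum>i\<in>q. emeasure lebesgue {u i<..<v i})"
          using nonneg by (intro sum.cong) auto
        also have "\<dots> = emeasure lebesgue (\<Union>i\<in>q. {u i<..<v i})"
          by (rule sum_emeasure[OF _ disj q(2)]) auto
        also have "\<dots> \<le> emeasure lebesgue U"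
        proof (rule emeasure_mono)
          show "(\<Union>i\<in>q. {u i<..<v i}) \<subseteq> U"
          proof
            fix s assume "s \<in> (\<Union>i\<in>q. {u i<..<v i})"
            then obtain i where i: "i \<in> q" "s \<in> {u i<..<v i}" by auto
            then have "i \<in> p" "fst i \<in> N" "s \<in> snd i" using mem(1)[of i] q by (auto simp: q_def)
            then show "s \<in> U" using mem(7)[of i] by (auto simp: G_def)
          qed
        qed (use U in \<open>simp add: borel_open\<close>)
        also have "\<dots> < ennreal \<delta>" by (fact Usmall)
        finally show "(\<Sum>i\<in>q. v i - u i) < \<delta>"
          using ennreal_less_iff sum_nonneg[of q, OF nonneg] by fastforce
      qed
      moreover have "norm (err i) = norm (\<gamma> (v i) - \<gamma> (u i))" if "i \<in> q" for i
        using that by (simp add: err_def q_def case_prod_beta g0_def u_def v_def norm_minus_commute)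
      ultimately have 1: "(\<Sum>i\<in>q. norm (err i)) < e / 2" by simp
      have "(\<Sum>i\<in>p - q. norm (err i)) \<le> (\<Sum>i\<in>p - q. e / 4 * measure lborel (snd i))"
      proof (rule sum_mono)
        fix i assume i: "i \<in> p - q"
        define t where "t = fst i"
        have m: "u i \<le> t" "t \<le> v i" "a \<le> u i" "v i \<le> b" "measure lborel (snd i) = v i - u i"
          "{u i..v i} \<subseteq> G t" "t \<notin> N"
          using mem[of i] i by (auto simp: t_def q_def)
        then have tt: "t \<in> {0..1} - N" using ab by auto
        have "{u i..v i} \<subseteq> ball t (d t)" using m tt by (auto simp: G_def)
        then have uv: "\<bar>u i - t\<bar> < d t" "\<bar>v i - t\<bar> < d t"
          using m subsetD[of "{u i..v i}" "ball t (d t)" "u i"] subsetD[of "{u i..v i}" "ball t (d t)" "v i"]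
          by (auto simp: dist_real_def)
        have "norm (\<gamma> (u i) - \<gamma> t - (u i - t) *\<^sub>R g t) \<le> e / 4 * (t - u i)"
          using d(2)[OF tt _ uv(1)] m ab by auto
        moreover have "norm (\<gamma> (v i) - \<gamma> t - (v i - t) *\<^sub>R g t) \<le> e / 4 * (v i - t)"
          using d(2)[OF tt _ uv(2)] m ab by auto
        moreover have "err i = (\<gamma> (u i) - \<gamma> t - (u i - t) *\<^sub>R g t) - (\<gamma> (v i) - \<gamma> t - (v i - t) *\<^sub>R g t)"
        proof -
          have "err i = (v i - u i) *\<^sub>R g t - (\<gamma> (v i) - \<gamma> (u i))"
            using m(5,7) by (simp add: err_def case_prod_beta g0_def flip: u_def v_def t_def)
          then show ?thesis by (simp add: algebra_simps)
        qed
        ultimately have "norm (err i) \<le> e / 4 * (t - u i) + e / 4 * (v i - t)"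
          using norm_triangle_ineq4[of "\<gamma> (u i) - \<gamma> t - (u i - t) *\<^sub>R g t" "\<gamma> (v i) - \<gamma> t - (v i - t) *\<^sub>R g t"]
          by simp
        then show "norm (err i) \<le> e / 4 * measure lborel (snd i)"
          unfolding m(5) by (simp add: field_simps)
      qed
      also have "\<dots> \<le> (\<Sum>i\<in>p. e / 4 * measure lborel (snd i))"
        by (rule sum_mono2) (use e fin in auto)
      also have "\<dots> = e / 4 * (\<Sum>(x,k)\<in>p. measure lborel k)"
        by (simp add: sum_distrib_left case_prod_beta)
      also have "\<dots> = e / 4 * (b - a)"
        using additive_content_tagged_division[of p a b] p ab by simp
      also have "\<dots> \<le> e / 4 * 1"
        using ab e by (intro mult_left_mono) auto
      finally have 2: "(\<Sum>i\<in>p - q. norm (err i)) \<le> e / 4" by simp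
      have "norm (sum err p) \<le> (\<Sum>i\<in>p. norm (err i))" by (rule norm_sum)
      also have "\<dots> = (\<Sum>i\<in>p - q. norm (err i)) + (\<Sum>i\<in>q. norm (err i))"
        using sum.subset_diff[OF q(1) fin] by blast
      also have "\<dots> < e" using 1 2 e by linarith
      finally show ?thesis using sum_eq by simp
    qed
    show "\<exists>G. gauge G \<and> (\<forall>p. p tagged_division_of {a..b} \<and> G fine p \<longrightarrow>
        norm ((\<Sum>(x,k)\<in>p. measure lborel k *\<^sub>R g0 x) - (\<gamma> b - \<gamma> a)) < e)"
      using \<open>gauge G\<close> riemann by (intro exI[of _ G] conjI allI impI) simp_all
  qed
  have eq: "g t = g0 t" if "t \<in> {a..b} - N" for t using that by (simp add: g0_def)
  show ?thesis by (rule has_integral_spike[OF N eq int0])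
qed

lemma AE_lebesgue_on_iff_negligible:
  assumes "S \<in> sets lebesgue"
  shows "(AE t in lebesgue_on S. P t) \<longleftrightarrow> (\<exists>N. negligible N \<and> (\<forall>t\<in>S - N. P t))"
proof -
  have "(AE t in lebesgue_on S. P t) \<longleftrightarrow> (AE t in lebesgue. t \<in> S \<longrightarrow> P t)"
    using assms by (simp add: AE_restrict_space_iff)
  also have "\<dots> \<longleftrightarrow> (\<exists>N. negligible N \<and> (\<forall>t\<in>S - N. P t))"
  proof
    assume "AE t in lebesgue. t \<in> S \<longrightarrow> P t"
    then obtain N where "N \<in> null_sets lebesgue" "{t \<in> space lebesgue. \<not> (t \<in> S \<longrightarrow> P t)} \<subseteq> N"
      unfolding eventually_ae_filter by blast
    then show "\<exists>N. negligible N \<and> (\<forall>t\<in>S - N. P t)"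
      unfolding negligible_iff_null_sets by auto
  next
    assume "\<exists>N. negligible N \<and> (\<forall>t\<in>S - N. P t)"
    then show "AE t in lebesgue. t \<in> S \<longrightarrow> P t"
      unfolding negligible_iff_null_sets eventually_ae_filter by auto
  qed
  finally show ?thesis .
qed

lemma horizontal_iff_negligible:
  "horizontal V \<gamma> \<longleftrightarrow> abs_continuous_on01 \<gamma> \<and> (\<exists>N. negligible N \<and>
     (\<forall>t\<in>{0..1} - N. \<exists>v\<in>V (\<gamma> t). (\<gamma> has_vector_derivative v) (at t within {0..1})))"
  unfolding horizontal_def by (simp add: AE_lebesgue_on_iff_negligible)

lemma curve_length_eqI:
  fixes \<gamma> :: "real \<Rightarrow> 'a::euclidean_space"
  assumes h: "(h has_integral l) {0..1}" "\<And>t. t \<in> {0..1} \<Longrightarrow> 0 \<le> h t" and N: "negligible N"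
    and eq: "\<And>t. t \<in> {0..1} - N \<Longrightarrow> norm (vector_derivative \<gamma> (at t within {0..1})) = h t"
  shows "curve_length \<gamma> = ennreal l"
proof -
  have "curve_length \<gamma> = (\<integral>\<^sup>+t. ennreal (h t) \<partial>lebesgue_on {0..1})"
    unfolding curve_length_def
  proof (rule nn_integral_cong_AE)
    show "AE t in lebesgue_on {0..1}. ennreal (norm (vector_derivative \<gamma> (at t within {0..1}))) = ennreal (h t)"
      using N eq by (subst AE_lebesgue_on_iff_negligible) auto
  qed
  also have "\<dots> = (\<integral>\<^sup>+t. ennreal (h t) * indicator {0..1} t \<partial>lebesgue)"
    by (rule nn_integral_restrict_space) simp
  also have "\<dots> = ennreal l"
    unfolding nn_integral_completion using h by (intro nn_integral_has_integral_lebesgue') auto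
  finally show ?thesis .
qed

text \<open>A velocity field \<open>g\<close> along a curve, defined off a null set \<open>N\<close>, together with the facts that make
  a horizontal curve of finite length usable: the length is an ordinary (gauge) integral of the
  speed, and increments are integrals of the velocity. Affine substitutions, splittings of the
  domain and linear maps under the integral sign are then available.\<close>

definition has_velocity ::
  "('a \<Rightarrow> 'a set) \<Rightarrow> (real \<Rightarrow> 'a::euclidean_space) \<Rightarrow> real set \<Rightarrow> (real \<Rightarrow> 'a) \<Rightarrow> real \<Rightarrow> bool" where
  "has_velocity V \<gamma> N g l \<longleftrightarrow> negligible N \<and> 0 \<le> l \<and> curve_length \<gamma> = ennreal l \<and>
     (\<forall>t\<in>{0..1} - N. g t \<in> V (\<gamma> t) \<and> (\<gamma> has_vector_derivative g t) (at t within {0..1})) \<and>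
     ((\<lambda>t. norm (g t)) has_integral l) {0..1} \<and>
     (\<forall>a b. 0 \<le> a \<and> a \<le> b \<and> b \<le> 1 \<longrightarrow> (g has_integral \<gamma> b - \<gamma> a) {a..b})"

lemma has_velocityD:
  assumes "has_velocity V \<gamma> N g l"
  shows "negligible N" "0 \<le> l" "curve_length \<gamma> = ennreal l"
    "\<And>t. t \<in> {0..1} - N \<Longrightarrow> g t \<in> V (\<gamma> t)"
    "\<And>t. t \<in> {0..1} - N \<Longrightarrow> (\<gamma> has_vector_derivative g t) (at t within {0..1})"
    "((\<lambda>t. norm (g t)) has_integral l) {0..1}"
    "\<And>a b. \<lbrakk>0 \<le> a; a \<le> b; b \<le> 1\<rbrakk> \<Longrightarrow> (g has_integral \<gamma> b - \<gamma> a) {a..b}"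
  using assms unfolding has_velocity_def by simp_all

text \<open>Finite length turns the gauge integrability of the velocity, which comes from the fundamental
  theorem, into absolute integrability.\<close>

lemma horizontal_has_velocity:
  fixes \<gamma> :: "real \<Rightarrow> 'a::euclidean_space"
  assumes hor: "horizontal V \<gamma>" and fin: "curve_length \<gamma> < \<infinity>"
  shows "\<exists>N g l. has_velocity V \<gamma> N g l"
proof -
  define g where "g t = vector_derivative \<gamma> (at t within {0..1})" for t
  obtain N where ac: "abs_continuous_on01 \<gamma>" and N: "negligible N"
    and "\<forall>t\<in>{0..1} - N. \<exists>v\<in>V (\<gamma> t). (\<gamma> has_vector_derivative v) (at t within {0..1})"
    using hor unfolding horizontal_iff_negligible by blast
  then have der: "g t \<in> V (\<gamma> t) \<and> (\<gamma> has_vector_derivative g t) (at t within {0..1})"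
    if "t \<in> {0..1} - N" for t
    using that vector_derivative_within_closed_interval[of 0 1 t \<gamma>] unfolding g_def
    by (metis DiffD1 zero_less_one)
  have int: "(g has_integral \<gamma> b - \<gamma> a) {a..b}" if "0 \<le> a" "a \<le> b" "b \<le> 1" for a b
    using abs_continuous_on01_has_integral[OF ac N _ that] der by blast
  have meas: "g \<in> borel_measurable (lebesgue_on {0..1})"
    using int[of 0 1] by (intro integrable_imp_measurable) (auto simp: has_integral_iff)
  have "(\<integral>\<^sup>+t. ennreal (norm (g t)) \<partial>lebesgue_on {0..1}) < \<infinity>"
    using fin by (simp add: curve_length_def g_def)
  then have "integrable (lebesgue_on {0..1}) g"
    using meas by (intro integrableI_bounded) auto
  then have "integrable (lebesgue_on {0..1}) (\<lambda>t. norm (g t))" by simp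
  then have "(\<lambda>t. norm (g t)) integrable_on {0..1}"
    by (rule integrable_on_lebesgue_on) simp
  then obtain l where l: "((\<lambda>t. norm (g t)) has_integral l) {0..1}" by blast
  have "0 \<le> l" using has_integral_nonneg[OF l] by simp
  moreover have "curve_length \<gamma> = ennreal l"
    by (rule curve_length_eqI[OF l _ N]) (auto simp: g_def)
  ultimately have "has_velocity V \<gamma> N g l"
    unfolding has_velocity_def using N der l int by (intro conjI ballI allI impI) auto
  then show ?thesis by blast
qed

lemma abs_continuous_on01_add:
  assumes "abs_continuous_on01 \<gamma>\<^sub>1" "abs_continuous_on01 \<gamma>\<^sub>2"
  shows "abs_continuous_on01 (\<lambda>t. \<gamma>\<^sub>1 t + \<gamma>\<^sub>2 t)"
  unfolding abs_continuous_on01_iff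
proof (intro allI impI)
  fix e :: real assume "e > 0"
  then have e: "e / 2 > 0" by simp
  obtain d\<^sub>1 where 1: "d\<^sub>1 > 0" "\<forall>(n::nat) a b. small_intervals {..<n} a b d\<^sub>1 \<longrightarrow>
      (\<Sum>i<n. norm (\<gamma>\<^sub>1 (b i) - \<gamma>\<^sub>1 (a i))) < e / 2"
    using abs_continuous_on01E[OF assms(1) e] by (elim exE conjE) (rule that)
  obtain d\<^sub>2 where 2: "d\<^sub>2 > 0" "\<forall>(n::nat) a b. small_intervals {..<n} a b d\<^sub>2 \<longrightarrow>
      (\<Sum>i<n. norm (\<gamma>\<^sub>2 (b i) - \<gamma>\<^sub>2 (a i))) < e / 2"
    using abs_continuous_on01E[OF assms(2) e] by (elim exE conjE) (rule that)
  have "(\<Sum>i<n. norm (\<gamma>\<^sub>1 (b i) + \<gamma>\<^sub>2 (b i) - (\<gamma>\<^sub>1 (a i) + \<gamma>\<^sub>2 (a i)))) < e"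
    if s: "small_intervals {..<n} a b (min d\<^sub>1 d\<^sub>2)" for n :: nat and a b
  proof -
    have s12: "small_intervals {..<n} a b d\<^sub>1" "small_intervals {..<n} a b d\<^sub>2"
      using s by (auto simp: small_intervals_def)
    have "(\<Sum>i<n. norm (\<gamma>\<^sub>1 (b i) + \<gamma>\<^sub>2 (b i) - (\<gamma>\<^sub>1 (a i) + \<gamma>\<^sub>2 (a i))))
        \<le> (\<Sum>i<n. norm (\<gamma>\<^sub>1 (b i) - \<gamma>\<^sub>1 (a i)) + norm (\<gamma>\<^sub>2 (b i) - \<gamma>\<^sub>2 (a i)))"
      by (intro sum_mono) (metis add_diff_add norm_triangle_ineq)
    also have "\<dots> < e / 2 + e / 2"
      unfolding sum.distrib using 1(2) 2(2) s12 by (intro add_strict_mono) auto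
    finally show ?thesis by simp
  qed
  then show "\<exists>d>0. \<forall>(n::nat) a b. small_intervals {..<n} a b d \<longrightarrow>
      (\<Sum>i<n. norm (\<gamma>\<^sub>1 (b i) + \<gamma>\<^sub>2 (b i) - (\<gamma>\<^sub>1 (a i) + \<gamma>\<^sub>2 (a i)))) < e"
    using 1(1) 2(1) by (intro exI[of _ "min d\<^sub>1 d\<^sub>2"]) auto
qed

text \<open>Only monotone substitutions keep the images of disjoint intervals disjoint.\<close>

lemma small_intervals_image:
  fixes \<phi> :: "real \<Rightarrow> real"
  assumes s: "small_intervals S a b (d / (L + 1))"
    and \<phi>: "L-lipschitz_on {0..1} \<phi>" "mono_on {0..1} \<phi>" and im: "\<phi> ` {0..1} \<subseteq> {0..1}"
  shows "small_intervals S (\<lambda>i. \<phi> (a i)) (\<lambda>i. \<phi> (b i)) d"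
  unfolding small_intervals_def
proof (intro conjI ballI)
  have L: "L \<ge> 0" using \<phi> lipschitz_on_nonneg by blast
  have ab: "a i \<in> {0..1}" "b i \<in> {0..1}" "a i \<le> b i" if "i \<in> S" for i
    using s that unfolding small_intervals_def by fastforce+
  show "finite S" using s by (simp add: small_intervals_def)
  show "0 \<le> \<phi> (a i)" "\<phi> (a i) \<le> \<phi> (b i)" "\<phi> (b i) \<le> 1" if "i \<in> S" for i
    using ab[OF that] im mono_onD[OF \<phi>(2)] by (auto simp: image_subset_iff)
  show "disjoint_family_on (\<lambda>i. {\<phi> (a i)<..<\<phi> (b i)}) S"
    unfolding disjoint_family_on_def
  proof (intro ballI impI)
    fix i j assume ij: "i \<in> S" "j \<in> S" "i \<noteq> j"
    have disj: "{a i<..<b i} \<inter> {a j<..<b j} = {}"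
      using s ij by (simp add: small_intervals_def disjoint_family_on_def)
    consider "a i = b i" | "a j = b j" | "b i \<le> a j" | "b j \<le> a i"
    proof (cases "a i = b i \<or> a j = b j")
      case False
      show thesis
      proof (cases "max (a i) (a j) < min (b i) (b j)")
        case True
        then obtain s where "max (a i) (a j) < s" "s < min (b i) (b j)" using dense by blast
        then show thesis using disj by auto
      qed (use ab[OF ij(1)] ab[OF ij(2)] that False in linarith)
    qed (use that in auto)
    then show "{\<phi> (a i)<..<\<phi> (b i)} \<inter> {\<phi> (a j)<..<\<phi> (b j)} = {}"
    proof cases
      case 3
      then have "\<phi> (b i) \<le> \<phi> (a j)" using mono_onD[OF \<phi>(2)] ab ij by blast
      then show ?thesis by auto
    next
      case 4
      then have "\<phi> (b j) \<le> \<phi> (a i)" using mono_onD[OF \<phi>(2)] ab ij by blast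
      then show ?thesis by auto
    qed auto
  qed
  have "(\<Sum>i\<in>S. \<phi> (b i) - \<phi> (a i)) \<le> (\<Sum>i\<in>S. L * (b i - a i))"
  proof (rule sum_mono)
    fix i assume "i \<in> S"
    then show "\<phi> (b i) - \<phi> (a i) \<le> L * (b i - a i)"
      using lipschitz_on_normD[OF \<phi>(1) ab(2,1)] ab(3)[of i] by fastforce
  qed
  also have "\<dots> \<le> (L + 1) * (\<Sum>i\<in>S. b i - a i)"
    unfolding sum_distrib_left using ab by (intro sum_mono mult_right_mono) auto
  also have "\<dots> < d" using s L by (auto simp: small_intervals_def field_simps)
  finally show "(\<Sum>i\<in>S. \<phi> (b i) - \<phi> (a i)) < d" .
qed

lemma abs_continuous_on01_compose_mono:
  fixes \<phi> :: "real \<Rightarrow> real"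
  assumes ac: "abs_continuous_on01 \<gamma>" and \<phi>: "L-lipschitz_on {0..1} \<phi>" "mono_on {0..1} \<phi>"
    and im: "\<phi> ` {0..1} \<subseteq> {0..1}"
  shows "abs_continuous_on01 (\<lambda>t. \<gamma> (\<phi> t))"
  unfolding abs_continuous_on01_iff
proof (intro allI impI)
  fix e :: real assume e: "e > 0"
  have L: "L \<ge> 0" using \<phi> lipschitz_on_nonneg by blast
  obtain d where d: "d > 0" "\<forall>(n::nat) a b. small_intervals {..<n} a b d \<longrightarrow>
      (\<Sum>i<n. norm (\<gamma> (b i) - \<gamma> (a i))) < e"
    using abs_continuous_on01E[OF ac e] by (elim exE conjE) (rule that)
  show "\<exists>d>0. \<forall>(n::nat) a b. small_intervals {..<n} a b d \<longrightarrow>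
      (\<Sum>i<n. norm (\<gamma> (\<phi> (b i)) - \<gamma> (\<phi> (a i)))) < e"
  proof (intro exI[of _ "d / (L + 1)"] conjI allI impI)
    show "0 < d / (L + 1)" using d(1) L by simp
    show "(\<Sum>i<n. norm (\<gamma> (\<phi> (b i)) - \<gamma> (\<phi> (a i)))) < e"
      if "small_intervals {..<n} a b (d / (L + 1))" for n :: nat and a b
      by (rule d(2)[rule_format, OF small_intervals_image[OF that \<phi> im]])
  qed
qed

lemma abs_continuous_on01_lipschitz:
  assumes lip: "L-lipschitz_on {0..1} \<gamma>"
  shows "abs_continuous_on01 \<gamma>"
  unfolding abs_continuous_on01_iff
proof (intro allI impI)
  fix e :: real assume e: "e > 0"
  have L: "L \<ge> 0" using lip lipschitz_on_nonneg by blast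
  show "\<exists>d>0. \<forall>(n::nat) a b. small_intervals {..<n} a b d \<longrightarrow>
      (\<Sum>i<n. norm (\<gamma> (b i) - \<gamma> (a i))) < e"
  proof (intro exI[of _ "e / (L + 1)"] conjI allI impI)
    show "0 < e / (L + 1)" using e L by simp
    fix n :: nat and a b assume s: "small_intervals {..<n} a b (e / (L + 1))"
    have "0 \<le> a i \<and> a i \<le> b i \<and> b i \<le> 1" if "i < n" for i
      using s that by (simp add: small_intervals_def)
    then have ab: "a i \<in> {0..1}" "b i \<in> {0..1}" "a i \<le> b i" if "i < n" for i
      using that by (meson atLeastAtMost_iff order_trans)+
    have "(\<Sum>i<n. norm (\<gamma> (b i) - \<gamma> (a i))) \<le> (\<Sum>i<n. (L + 1) * (b i - a i))"
    proof (rule sum_mono)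
      fix i assume "i \<in> {..<n}"
      then have i: "i < n" by simp
      have "norm (\<gamma> (b i) - \<gamma> (a i)) \<le> L * (b i - a i)"
        using lipschitz_on_normD[OF lip ab(2,1)[OF i]] ab(3)[OF i] by simp
      also have "\<dots> \<le> (L + 1) * (b i - a i)" using ab(3)[OF i] by (intro mult_right_mono) auto
      finally show "norm (\<gamma> (b i) - \<gamma> (a i)) \<le> (L + 1) * (b i - a i)" .
    qed
    also have "\<dots> = (L + 1) * (\<Sum>i<n. b i - a i)" by (simp add: sum_distrib_left)
    also have "\<dots> < e" using s L by (auto simp: small_intervals_def field_simps)
    finally show "(\<Sum>i<n. norm (\<gamma> (b i) - \<gamma> (a i))) < e" .
  qed
qed

lemma abs_continuous_on01_reverse:
  assumes ac: "abs_continuous_on01 \<gamma>"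
  shows "abs_continuous_on01 (\<lambda>t. \<gamma> (1 - t))"
  unfolding abs_continuous_on01_iff
proof (intro allI impI)
  fix e :: real assume e: "e > 0"
  obtain d where d: "d > 0" "\<forall>(n::nat) a b. small_intervals {..<n} a b d \<longrightarrow>
      (\<Sum>i<n. norm (\<gamma> (b i) - \<gamma> (a i))) < e"
    using abs_continuous_on01E[OF ac e] by (elim exE conjE) (rule that)
  have rev: "small_intervals S (\<lambda>i. 1 - b i) (\<lambda>i. 1 - a i) d" if s: "small_intervals S a b d"
    for S :: "nat set" and a b
    unfolding small_intervals_def
  proof (intro conjI)
    show "disjoint_family_on (\<lambda>i. {1 - b i<..<1 - a i}) S"
      unfolding disjoint_family_on_def
    proof (intro ballI impI)
      fix i j assume "i \<in> S" "j \<in> S" "i \<noteq> j"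
      then have disj: "{a i<..<b i} \<inter> {a j<..<b j} = {}"
        using s by (simp add: small_intervals_def disjoint_family_on_def)
      show "{1 - b i<..<1 - a i} \<inter> {1 - b j<..<1 - a j} = {}"
      proof (rule equals0I)
        fix u assume "u \<in> {1 - b i<..<1 - a i} \<inter> {1 - b j<..<1 - a j}"
        then have "1 - u \<in> {a i<..<b i} \<inter> {a j<..<b j}" by auto
        then show False unfolding disj by (rule emptyE)
      qed
    qed
  qed (use s in \<open>auto simp: small_intervals_def\<close>)
  show "\<exists>d>0. \<forall>(n::nat) a b. small_intervals {..<n} a b d \<longrightarrow>
      (\<Sum>i<n. norm (\<gamma> (1 - b i) - \<gamma> (1 - a i))) < e"
  proof (intro exI[of _ d] conjI allI impI)
    show "0 < d" by (fact d(1))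
    show "(\<Sum>i<n. norm (\<gamma> (1 - b i) - \<gamma> (1 - a i))) < e" if "small_intervals {..<n} a b d" for n :: nat and a b
      using d(2)[rule_format, OF rev[OF that]] by (simp add: norm_minus_commute)
  qed
qed

section \<open>Joining points by horizontal curves of speed at most one\<close>

text \<open>\<open>x\<close> can be joined to \<open>y\<close> by a horizontal curve of speed at most one in time \<open>L\<close>. The curve lives on
  the whole real line and rests at \<open>x\<close> before time \<open>0\<close> and at \<open>y\<close> after time \<open>L\<close>: resting is horizontal
  because \<open>0 \<in> V p\<close>, and it makes concatenation a matter of adding curves. Curves that are built by
  hand are all of this Lipschitz kind, which spares any discussion of absolute continuity until
  they are compared with general horizontal curves.\<close>

definition reach :: "('a \<Rightarrow> 'a set) \<Rightarrow> 'a \<Rightarrow> 'a::euclidean_space \<Rightarrow> real \<Rightarrow> bool" where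
  "reach V x y L \<longleftrightarrow> (\<exists>\<gamma> N. 1-lipschitz_on UNIV \<gamma> \<and> (\<forall>t\<le>0. \<gamma> t = x) \<and> (\<forall>t\<ge>L. \<gamma> t = y) \<and>
     negligible N \<and> (\<forall>t. t \<notin> N \<longrightarrow> (\<exists>v\<in>V (\<gamma> t). (\<gamma> has_vector_derivative v) (at t))))"

lemma reach_dist:
  assumes "reach V x y L" "0 \<le> L" shows "dist x y \<le> L"
proof -
  obtain \<gamma> where "1-lipschitz_on UNIV \<gamma>" "\<gamma> 0 = x" "\<gamma> L = y"
    using assms unfolding reach_def by auto
  then have "dist (\<gamma> 0) (\<gamma> L) \<le> 1 * dist 0 L" by (metis UNIV_I lipschitz_onD)
  then show ?thesis using \<open>\<gamma> 0 = x\<close> \<open>\<gamma> L = y\<close> assms by simp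
qed

lemma reach_mono: "reach V x y L \<Longrightarrow> L \<le> L' \<Longrightarrow> reach V x y L'"
  unfolding reach_def by (meson order_trans)

lemma reach_refl:
  assumes "0 \<in> V x" shows "reach V x x L"
  unfolding reach_def
  by (intro exI[of _ "\<lambda>_. x"] exI[of _ "{}"])
     (auto intro!: bexI[of _ 0] assms lipschitz_on_mono[OF lipschitz_on_constant])

text \<open>Two curves that are constant outside of \<open>[0, L]\<close> and \<open>[0, M]\<close> are concatenated by adding
  them up: near any time other than \<open>L\<close>, at least one of the two summands is constant.\<close>

lemma concat_unit_speed:
  fixes \<gamma>\<^sub>1 \<gamma>\<^sub>2 :: "real \<Rightarrow> 'a::euclidean_space"
  assumes 1: "1-lipschitz_on UNIV \<gamma>\<^sub>1" "\<forall>t\<ge>L. \<gamma>\<^sub>1 t = y" "negligible N\<^sub>1"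
      "\<forall>t. t \<notin> N\<^sub>1 \<longrightarrow> (\<exists>v\<in>V (\<gamma>\<^sub>1 t). (\<gamma>\<^sub>1 has_vector_derivative v) (at t))"
    and 2: "1-lipschitz_on UNIV \<gamma>\<^sub>2" "\<forall>t\<le>0. \<gamma>\<^sub>2 t = y" "negligible N\<^sub>2"
      "\<forall>t. t \<notin> N\<^sub>2 \<longrightarrow> (\<exists>v\<in>V (\<gamma>\<^sub>2 t). (\<gamma>\<^sub>2 has_vector_derivative v) (at t))"
  defines "\<gamma> \<equiv> \<lambda>t. \<gamma>\<^sub>1 t + \<gamma>\<^sub>2 (t - L) - y"
  shows "1-lipschitz_on UNIV \<gamma>" "\<And>t. t \<le> L \<Longrightarrow> \<gamma> t = \<gamma>\<^sub>1 t" "\<And>t. t \<ge> L \<Longrightarrow> \<gamma> t = \<gamma>\<^sub>2 (t - L)"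
    "\<exists>N. negligible N \<and> (\<forall>t. t \<notin> N \<longrightarrow> (\<exists>v\<in>V (\<gamma> t). (\<gamma> has_vector_derivative v) (at t)))"
proof -
  show le: "\<gamma> t = \<gamma>\<^sub>1 t" if "t \<le> L" for t using that 2 by (simp add: \<gamma>_def)
  show ge: "\<gamma> t = \<gamma>\<^sub>2 (t - L)" if "t \<ge> L" for t using that 1 by (simp add: \<gamma>_def)
  show "1-lipschitz_on UNIV \<gamma>"
  proof (rule lipschitz_on_leI)
    fix s t :: real assume st: "s \<le> t"
    have l: "dist (\<gamma> s) (\<gamma> t) \<le> t - s" if "s \<le> t" "t \<le> L" for s t
      using lipschitz_onD[OF 1(1), of s t] that by (simp add: le dist_real_def)
    have r: "dist (\<gamma> s) (\<gamma> t) \<le> t - s" if "s \<le> t" "L \<le> s" for s t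
      using lipschitz_onD[OF 2(1), of "s - L" "t - L"] that by (simp add: ge dist_real_def)
    have "dist (\<gamma> s) (\<gamma> t) \<le> t - s"
    proof (cases "s \<le> L \<and> L \<le> t")
      case True
      then have "dist (\<gamma> s) (\<gamma> L) \<le> L - s" "dist (\<gamma> L) (\<gamma> t) \<le> t - L" using l r by auto
      then show ?thesis using dist_triangle[of "\<gamma> s" "\<gamma> t" "\<gamma> L"] by linarith
    qed (use l r st in auto)
    then show "dist (\<gamma> s) (\<gamma> t) \<le> 1 * dist s t" using st by (simp add: dist_real_def)
  qed auto
  have N2: "negligible ((+) L ` N\<^sub>2)" using 2 by (simp add: negligible_translation)
  show "\<exists>N. negligible N \<and> (\<forall>t. t \<notin> N \<longrightarrow> (\<exists>v\<in>V (\<gamma> t). (\<gamma> has_vector_derivative v) (at t)))"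
  proof (intro exI[of _ "N\<^sub>1 \<union> (+) L ` N\<^sub>2 \<union> {L}"] conjI allI impI)
    show "negligible (N\<^sub>1 \<union> (+) L ` N\<^sub>2 \<union> {L})" using 1 N2 by auto
    fix t assume t: "t \<notin> N\<^sub>1 \<union> (+) L ` N\<^sub>2 \<union> {L}"
    have tN2: "t - L \<notin> N\<^sub>2" using t by (metis UnI1 UnI2 add.commute diff_add_cancel imageI)
    consider "t < L" | "t > L" using t by fastforce
    then show "\<exists>v\<in>V (\<gamma> t). (\<gamma> has_vector_derivative v) (at t)"
    proof cases
      case 1
      then obtain v where v: "v \<in> V (\<gamma>\<^sub>1 t)" "(\<gamma>\<^sub>1 has_vector_derivative v) (at t)"
        using assms(4) t by auto
      have "(\<gamma> has_vector_derivative v) (at t)"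
        by (rule has_vector_derivative_transform_within_open[OF v(2), of "{..<L}"])
           (use 1 le in auto)
      then show ?thesis using v le 1 by auto
    next
      case 2
      then obtain v where v: "v \<in> V (\<gamma>\<^sub>2 (t - L))" "(\<gamma>\<^sub>2 has_vector_derivative v) (at (t - L))"
        using assms(8) tN2 by auto
      have "((\<lambda>s. s - L) has_vector_derivative 1) (at t)"
        by (auto intro!: derivative_eq_intros simp: has_vector_derivative_def)
      from vector_diff_chain_at[OF this, of \<gamma>\<^sub>2 v]
      have "((\<lambda>s. \<gamma>\<^sub>2 (s - L)) has_vector_derivative v) (at t)"
        using v by (simp add: o_def)
      then have "(\<gamma> has_vector_derivative v) (at t)"
        by (rule has_vector_derivative_transform_within_open[of _ _ _ "{L<..}"])
           (use 2 ge in auto)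
      then show ?thesis using v ge 2 by auto
    qed
  qed
qed

lemma reach_trans:
  assumes "reach V x y L" "reach V y z M" "0 \<le> L" "0 \<le> M"
  shows "reach V x z (L + M)"
proof -
  obtain \<gamma>\<^sub>1 N\<^sub>1 where 1: "1-lipschitz_on UNIV \<gamma>\<^sub>1" "\<forall>t\<le>0. \<gamma>\<^sub>1 t = x" "\<forall>t\<ge>L. \<gamma>\<^sub>1 t = y" "negligible N\<^sub>1"
      "\<forall>t. t \<notin> N\<^sub>1 \<longrightarrow> (\<exists>v\<in>V (\<gamma>\<^sub>1 t). (\<gamma>\<^sub>1 has_vector_derivative v) (at t))"
    using assms(1) unfolding reach_def by blast
  obtain \<gamma>\<^sub>2 N\<^sub>2 where 2: "1-lipschitz_on UNIV \<gamma>\<^sub>2" "\<forall>t\<le>0. \<gamma>\<^sub>2 t = y" "\<forall>t\<ge>M. \<gamma>\<^sub>2 t = z" "negligible N\<^sub>2"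
      "\<forall>t. t \<notin> N\<^sub>2 \<longrightarrow> (\<exists>v\<in>V (\<gamma>\<^sub>2 t). (\<gamma>\<^sub>2 has_vector_derivative v) (at t))"
    using assms(2) unfolding reach_def by blast
  note c = concat_unit_speed[OF 1(1,3,4,5) 2(1,2,4,5)]
  obtain N where "negligible N" "\<forall>t. t \<notin> N \<longrightarrow> (\<exists>v\<in>V (\<gamma>\<^sub>1 t + \<gamma>\<^sub>2 (t - L) - y).
      ((\<lambda>t. \<gamma>\<^sub>1 t + \<gamma>\<^sub>2 (t - L) - y) has_vector_derivative v) (at t))"
    using c(4) by blast
  then show ?thesis unfolding reach_def
    using c(1) 1(2,3) 2(2,3) assms(3,4)
    by (intro exI[of _ "\<lambda>t. \<gamma>\<^sub>1 t + \<gamma>\<^sub>2 (t - L) - y"] exI[of _ N]) auto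
qed

text \<open>The limit of the finite concatenations is horizontal up to the end of all the pieces, and
  constant afterwards. Since it is Lipschitz, nothing can go wrong at the accumulation point.\<close>

lemma reach_infinite:
  fixes x :: "nat \<Rightarrow> 'a::euclidean_space"
  assumes step: "\<And>i. reach V (x i) (x (Suc i)) (l i)" and l: "\<And>i. 0 \<le> l i"
    and sums: "l sums T" and lim: "x \<longlonglongrightarrow> y" and zero: "\<And>p. 0 \<in> V p"
  shows "reach V (x 0) y T"
proof -
  \<comment> \<open>\<open>\<tau> i\<close> is the time at which the \<open>i\<close>-th piece starts, and \<open>P i \<gamma>\<close> says that \<open>\<gamma>\<close> joins \<open>x 0\<close> to \<open>x i\<close> in time \<open>\<tau> i\<close>.\<close>
  define \<tau> where "\<tau> i = sum l {..<i}" for i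
  define P where "P i \<gamma> \<longleftrightarrow> 1-lipschitz_on UNIV \<gamma> \<and> (\<forall>t\<le>0. \<gamma> t = x 0) \<and> (\<forall>t\<ge>\<tau> i. \<gamma> t = x i) \<and>
     (\<exists>N. negligible N \<and> (\<forall>t. t \<notin> N \<longrightarrow> (\<exists>v\<in>V (\<gamma> t). (\<gamma> has_vector_derivative v) (at t))))"
    for i and \<gamma> :: "real \<Rightarrow> 'a"
  have \<tau>0: "\<tau> i \<ge> 0" for i using l by (simp add: \<tau>_def sum_nonneg)
  have "\<exists>\<Gamma>. \<forall>i. P i (\<Gamma> i) \<and> (\<forall>t\<le>\<tau> i. \<Gamma> (Suc i) t = \<Gamma> i t)"
  proof (rule dependent_nat_choice)
    have "P 0 (\<lambda>_. x 0)" unfolding P_def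
      by (auto intro!: bexI[of _ 0] exI[of _ "{}"] zero lipschitz_on_mono[OF lipschitz_on_constant])
    then show "\<exists>\<gamma>. P 0 \<gamma>" by blast
  next
    fix \<gamma> i assume P: "P i \<gamma>"
    obtain N\<^sub>1 where 1: "1-lipschitz_on UNIV \<gamma>" "\<forall>t\<ge>\<tau> i. \<gamma> t = x i" "negligible N\<^sub>1"
      "\<forall>t. t \<notin> N\<^sub>1 \<longrightarrow> (\<exists>v\<in>V (\<gamma> t). (\<gamma> has_vector_derivative v) (at t))"
      using P unfolding P_def by blast
    obtain \<gamma>\<^sub>2 N\<^sub>2 where 2: "1-lipschitz_on UNIV \<gamma>\<^sub>2" "\<forall>t\<le>0. \<gamma>\<^sub>2 t = x i" "negligible N\<^sub>2"
      "\<forall>t. t \<notin> N\<^sub>2 \<longrightarrow> (\<exists>v\<in>V (\<gamma>\<^sub>2 t). (\<gamma>\<^sub>2 has_vector_derivative v) (at t))"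
      and end2: "\<forall>t\<ge>l i. \<gamma>\<^sub>2 t = x (Suc i)"
      using step[of i] unfolding reach_def by blast
    define \<Gamma> where "\<Gamma> t = \<gamma> t + \<gamma>\<^sub>2 (t - \<tau> i) - x i" for t
    note c = concat_unit_speed[OF 1 2, folded \<Gamma>_def]
    have "P (Suc i) \<Gamma>" unfolding P_def
    proof (intro conjI)
      show "\<forall>t\<le>0. \<Gamma> t = x 0"
        using c(2) \<tau>0[of i] P unfolding P_def by (metis order_trans)
      show "\<forall>t\<ge>\<tau> (Suc i). \<Gamma> t = x (Suc i)"
      proof (intro allI impI)
        fix t assume t: "t \<ge> \<tau> (Suc i)"
        then have "t \<ge> \<tau> i" "t - \<tau> i \<ge> l i" using l[of i] by (auto simp: \<tau>_def)
        then show "\<Gamma> t = x (Suc i)" using c(3) end2 by auto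
      qed
    qed (use c in auto)
    then show "\<exists>\<Gamma>. P (Suc i) \<Gamma> \<and> (\<forall>t\<le>\<tau> i. \<Gamma> t = \<gamma> t)" using c(2) by blast
  qed
  then obtain \<Gamma> where \<Gamma>: "\<And>i. P i (\<Gamma> i)" "\<And>i t. t \<le> \<tau> i \<Longrightarrow> \<Gamma> (Suc i) t = \<Gamma> i t" by blast
  have \<tau>_mono: "\<tau> i \<le> \<tau> j" if "i \<le> j" for i j
    unfolding \<tau>_def using that l by (intro sum_mono2) auto
  \<comment> \<open>Later concatenations no longer change the curve up to time \<open>\<tau> i\<close>, so the limit is locally one of the finite concatenations.\<close>
  have stable: "\<Gamma> j t = \<Gamma> i t" if "i \<le> j" "t \<le> \<tau> i" for i j t
    using that
  proof (induction j rule: dec_induct)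
    case (step j)
    then show ?case using \<Gamma>(2)[of t j] \<tau>_mono[of i j] by auto
  qed auto
  have \<tau>_lim: "\<tau> \<longlonglongrightarrow> T" using sums by (simp add: sums_def \<tau>_def[abs_def])
  have \<tau>_le: "\<tau> i \<le> T" for i
    using incseq_le[OF _ \<tau>_lim] \<tau>_mono by (auto simp: incseq_def)
  define \<gamma> where "\<gamma> t = lim (\<lambda>i. \<Gamma> i t)" for t
  have early: "\<exists>i. t < \<tau> i" if "t < T" for t
    using order_tendstoD(1)[OF \<tau>_lim that] by (auto simp: eventually_sequentially)
  have eventually_const: "(\<lambda>j. \<Gamma> j t) \<longlonglongrightarrow> \<Gamma> i t" if "t \<le> \<tau> i" for t i
    using stable that by (intro tendsto_eventually) (auto simp: eventually_sequentially)
  have eq: "\<gamma> t = \<Gamma> i t" if "t \<le> \<tau> i" for t i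
    using eventually_const[OF that] unfolding \<gamma>_def by (rule limI)
  have late_lim: "(\<lambda>j. \<Gamma> j t) \<longlonglongrightarrow> y" if "t \<ge> T" for t
  proof -
    have "\<Gamma> j t = x j" for j
      using \<Gamma>(1)[of j] \<tau>_le[of j] that unfolding P_def by auto
    then show ?thesis using lim by simp
  qed
  have late: "\<gamma> t = y" if "t \<ge> T" for t
    using late_lim[OF that] unfolding \<gamma>_def by (rule limI)
  have conv: "(\<lambda>j. \<Gamma> j t) \<longlonglongrightarrow> \<gamma> t" for t
  proof (cases "t < T")
    case True
    then obtain i where "t \<le> \<tau> i" using early less_imp_le by blast
    then show ?thesis using eventually_const eq by metis
  next
    case False
    then show ?thesis using late late_lim by simp
  qed
  have "\<forall>i. \<exists>N. negligible N \<and> (\<forall>t. t \<notin> N \<longrightarrow> (\<exists>v\<in>V (\<Gamma> i t). (\<Gamma> i has_vector_derivative v) (at t)))"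
    using \<Gamma>(1) unfolding P_def by blast
  then obtain N where N: "\<And>i. negligible (N i)"
    "\<And>i t. t \<notin> N i \<Longrightarrow> \<exists>v\<in>V (\<Gamma> i t). (\<Gamma> i has_vector_derivative v) (at t)"
    by metis
  show ?thesis unfolding reach_def
  proof (intro exI[of _ \<gamma>] exI[of _ "(\<Union>i. N i) \<union> {T}"] conjI allI impI)
    show "1-lipschitz_on UNIV \<gamma>"
    proof (rule lipschitz_onI)
      fix s t :: real
      have "dist (\<Gamma> i s) (\<Gamma> i t) \<le> 1 * dist s t" for i
        using \<Gamma>(1)[of i] lipschitz_onD unfolding P_def by blast
      then show "dist (\<gamma> s) (\<gamma> t) \<le> 1 * dist s t"
        using tendsto_dist[OF conv[of s] conv[of t]] LIMSEQ_le_const2 by blast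
    qed auto
    show "negligible ((\<Union>i. N i) \<union> {T})" using N by (auto intro: negligible_countable_Union)
    show "\<gamma> t = x 0" if "t \<le> 0" for t
      using eq[of t 0] \<Gamma>(1)[of 0] that unfolding P_def \<tau>_def by auto
    show "\<gamma> t = y" if "T \<le> t" for t using late that by auto
    fix t assume t: "t \<notin> (\<Union>i. N i) \<union> {T}"
    show "\<exists>v\<in>V (\<gamma> t). (\<gamma> has_vector_derivative v) (at t)"
    proof (cases "t < T")
      case True
      then obtain i where i: "t < \<tau> i" using early by blast
      obtain v where v: "v \<in> V (\<Gamma> i t)" "(\<Gamma> i has_vector_derivative v) (at t)"
        using N(2)[of t i] t by blast
      have "(\<gamma> has_vector_derivative v) (at t)"
        by (rule has_vector_derivative_transform_within_open[OF v(2), of "{..<\<tau> i}"])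
           (use i eq[OF less_imp_le] in auto)
      then show ?thesis using v eq[of t i] i by auto
    next
      case False
      have "(\<gamma> has_vector_derivative 0) (at t)"
        by (rule has_vector_derivative_transform_within_open[OF has_vector_derivative_const, of "{T<..}" _ y])
           (use False t late in auto)
      then show ?thesis using zero by auto
    qed
  qed
qed

lemma negligible_affine_vimage:
  fixes N :: "real set"
  assumes "negligible N" "m \<noteq> 0"
  shows "negligible {t. m * t + c \<in> N}"
proof -
  have "{t. m * t + c \<in> N} = (\<lambda>s. (s - c) / m) ` N"
    using assms(2) by (auto simp: image_iff field_simps intro!: bexI)
  moreover have "negligible ((\<lambda>s. (s - c) / m) ` N)"
    by (rule negligible_differentiable_image_negligible[OF _ assms(1)])
       (auto intro!: derivative_intros simp: differentiable_on_def assms(2))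
  ultimately show ?thesis by simp
qed

lemma has_vector_derivative_affine:
  fixes \<gamma> :: "real \<Rightarrow> 'a::real_normed_vector"
  assumes "(\<gamma> has_vector_derivative v) (at (m * t + c) within (\<lambda>t. m * t + c) ` S)"
  shows "((\<lambda>t. \<gamma> (m * t + c)) has_vector_derivative m *\<^sub>R v) (at t within S)"
proof -
  have "((\<lambda>t. m * t + c) has_vector_derivative m) (at t within S)"
    by (auto intro!: derivative_eq_intros simp: has_vector_derivative_def)
  from vector_diff_chain_within[OF this assms] show ?thesis by (simp add: o_def)
qed

lemma has_vector_derivative_norm_le_lipschitz:
  assumes der: "(\<gamma> has_vector_derivative v) (at t)" and lip: "L-lipschitz_on UNIV \<gamma>"
  shows "norm v \<le> L"
proof -
  have "norm v \<le> L + e" if e: "e > 0" for e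
  proof -
    have "\<forall>\<epsilon>>0. \<exists>d>0. \<forall>s. norm (s - t) < d \<longrightarrow>
        norm (\<gamma> s - \<gamma> t - (s - t) *\<^sub>R v) \<le> \<epsilon> * norm (s - t)"
      using der unfolding has_vector_derivative_def has_derivative_at_alt by blast
    then obtain d where d: "d > 0" "\<And>s. norm (s - t) < d \<Longrightarrow>
        norm (\<gamma> s - \<gamma> t - (s - t) *\<^sub>R v) \<le> e * norm (s - t)"
      using e by blast
    define h where "h = d / 2"
    have h: "0 < h" "h < d" using d by (auto simp: h_def)
    have "norm (h *\<^sub>R v) \<le> norm (\<gamma> (t + h) - \<gamma> t) + norm (\<gamma> (t + h) - \<gamma> t - h *\<^sub>R v)"
      using norm_triangle_ineq4[of "\<gamma> (t + h) - \<gamma> t" "\<gamma> (t + h) - \<gamma> t - h *\<^sub>R v"] by simp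
    also have "\<dots> \<le> L * h + e * h"
      using lipschitz_on_normD[OF lip, of "t + h" t] d(2)[of "t + h"] h by (intro add_mono) auto
    finally have "h * norm v \<le> h * (L + e)" using h by (simp add: algebra_simps)
    then show ?thesis using h by simp
  qed
  then show ?thesis by (rule field_le_epsilon)
qed

text \<open>Running the curve at constant speed \<open>L\<close> over the unit interval gives a competitor for the
  Carnot-Caratheodory distance.\<close>

lemma cc_dist_le_reach:
  assumes reach: "reach V x y L" and L: "0 < L" and sub: "\<And>p. subspace (V p)"
  shows "cc_dist V x y \<le> ennreal L"
proof -
  obtain \<gamma> N where \<gamma>: "1-lipschitz_on UNIV \<gamma>" "\<gamma> 0 = x" "\<gamma> L = y" "negligible N"
    "\<And>t. t \<notin> N \<Longrightarrow> \<exists>v\<in>V (\<gamma> t). (\<gamma> has_vector_derivative v) (at t)"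
    using reach L unfolding reach_def by auto
  define \<beta> where "\<beta> t = \<gamma> (L * t)" for t
  define N' where "N' = {t. L * t + 0 \<in> N}"
  have N': "negligible N'" using negligible_affine_vimage[OF \<gamma>(4), of L 0] L by (simp add: N'_def)
  have lip: "L-lipschitz_on {0..1} \<beta>"
    unfolding \<beta>_def
  proof (rule lipschitz_onI)
    fix s t show "dist (\<gamma> (L * s)) (\<gamma> (L * t)) \<le> L * dist s t"
      using lipschitz_onD[OF \<gamma>(1), of "L * s" "L * t"] L
      by (simp add: dist_real_def abs_mult flip: right_diff_distrib)
  qed (use L in auto)
  have der: "\<exists>v\<in>V (\<beta> t). norm v \<le> L \<and> (\<beta> has_vector_derivative v) (at t within {0..1})"
    if t: "t \<in> {0..1} - N'" for t
  proof -
    obtain v where v: "v \<in> V (\<gamma> (L * t))" "(\<gamma> has_vector_derivative v) (at (L * t))"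
      using \<gamma>(5)[of "L * t"] t by (auto simp: N'_def)
    have 1: "L *\<^sub>R v \<in> V (\<beta> t)" using v sub by (simp add: \<beta>_def subspace_scale)
    have "(\<gamma> has_derivative (\<lambda>h. h *\<^sub>R v)) (at (L * t))"
      using v(2) by (simp add: has_vector_derivative_def)
    have "norm (L *\<^sub>R v) \<le> L"
      using has_vector_derivative_norm_le_lipschitz[OF v(2) \<gamma>(1)] L by simp
    moreover have "(\<beta> has_vector_derivative L *\<^sub>R v) (at t within {0..1})"
      unfolding \<beta>_def using has_vector_derivative_affine[of \<gamma> v L t 0 "{0..1}"] v(2)
      by (simp add: has_vector_derivative_at_within)
    ultimately show ?thesis using 1 by blast
  qed
  have hor: "horizontal V \<beta>"
    unfolding horizontal_iff_negligible
    using abs_continuous_on01_lipschitz[OF lip] N' der by blast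
  have "curve_length \<beta> \<le> (\<integral>\<^sup>+t. ennreal L \<partial>lebesgue_on {0..1::real})"
    unfolding curve_length_def
  proof (rule nn_integral_mono_AE)
    have "\<forall>t\<in>{0..1} - N'. norm (vector_derivative \<beta> (at t within {0..1})) \<le> L"
      using der vector_derivative_within_closed_interval[of 0 1 _ \<beta>]
      by (metis DiffD1 zero_less_one)
    then show "AE t in lebesgue_on {0..1}.
        ennreal (norm (vector_derivative \<beta> (at t within {0..1}))) \<le> ennreal L"
      using N' L by (subst AE_lebesgue_on_iff_negligible) (auto intro!: exI[of _ N'] ennreal_leI)
  qed
  also have "\<dots> = ennreal L"
    by (simp add: emeasure_restrict_space)
  finally have "curve_length \<beta> \<le> ennreal L" .
  moreover have "\<beta> 0 = x" "\<beta> 1 = y" using \<gamma> by (simp_all add: \<beta>_def)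
  ultimately show ?thesis
    unfolding cc_dist_def using hor by (intro INF_lower2[of \<beta>]) auto
qed

section \<open>Smooth vector fields on balls\<close>

text \<open>The partial derivatives are continuous, hence bounded on the compact ball; linearity bounds the
  whole derivative, and the mean value inequality does the rest.\<close>

lemma C1_bounds_on_ball:
  fixes f :: "'a::euclidean_space \<Rightarrow> 'b::real_normed_vector"
  assumes "C_times (Suc 0) f"
  obtains L where "0 \<le> L" "L-lipschitz_on (cball 0 R) f"
    "\<And>p v. p \<in> cball 0 R \<Longrightarrow> norm (frechet_derivative f (at p) v) \<le> L * norm v"
proof -
  have der: "(f has_derivative frechet_derivative f (at p)) (at p)" for p
    using assms by (simp add: frechet_derivative_works)
  have "\<exists>M. \<forall>p\<in>cball 0 R. norm (frechet_derivative f (at p) v) \<le> M" for v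
  proof -
    have "continuous_on (cball 0 R) (\<lambda>p. frechet_derivative f (at p) v)"
      using assms continuous_on_subset[of UNIV] by auto
    then have "compact ((\<lambda>p. frechet_derivative f (at p) v) ` cball 0 R)"
      by (rule compact_continuous_image) simp
    from compact_imp_bounded[OF this] show ?thesis unfolding bounded_iff by auto
  qed
  then obtain M where M: "\<And>v p. p \<in> cball 0 R \<Longrightarrow> norm (frechet_derivative f (at p) v) \<le> M v"
    by metis
  define L where "L = (\<Sum>b\<in>Basis. max 0 (M b))"
  have L: "0 \<le> L" unfolding L_def by (intro sum_nonneg) auto
  have bound: "norm (frechet_derivative f (at p) v) \<le> L * norm v" if p: "p \<in> cball 0 R" for p v
  proof -
    have lin: "linear (frechet_derivative f (at p))" using der has_derivative_linear by blast
    have "frechet_derivative f (at p) v = frechet_derivative f (at p) (\<Sum>b\<in>Basis. (v \<bullet> b) *\<^sub>R b)"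
      by (simp add: euclidean_representation)
    also have "\<dots> = (\<Sum>b\<in>Basis. (v \<bullet> b) *\<^sub>R frechet_derivative f (at p) b)"
      using lin by (simp add: linear_sum linear_scale)
    also have "norm \<dots> \<le> (\<Sum>b\<in>Basis. norm v * max 0 (M b))"
    proof (rule sum_norm_le)
      fix b :: 'a assume b: "b \<in> Basis"
      have "norm (frechet_derivative f (at p) b) \<le> max 0 (M b)" using M[OF p, of b] by simp
      then show "norm ((v \<bullet> b) *\<^sub>R frechet_derivative f (at p) b) \<le> norm v * max 0 (M b)"
        using Basis_le_norm[OF b, of v] by (simp add: mult_mono)
    qed
    also have "\<dots> = L * norm v" by (simp add: L_def sum_distrib_left mult.commute)
    finally show ?thesis .
  qed
  have "L-lipschitz_on (cball 0 R) f"
  proof (rule bounded_derivative_imp_lipschitz)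
    show "(f has_derivative frechet_derivative f (at p)) (at p within cball 0 R)" for p
      using der has_derivative_at_withinI by blast
    show "onorm (frechet_derivative f (at p)) \<le> L" if "p \<in> cball 0 R" for p
      using bound[OF that] L by (intro onorm_le) auto
  qed (use L in auto)
  then show thesis using that L bound by blast
qed

text \<open>A single constant \<open>M\<close> that controls everything the flow estimates use about a vector field: its
  size, its Lipschitz constant, its derivative \<open>f'\<close>, the remainder of its linearization and the
  Lipschitz constant of \<open>f'\<close>. Dividing the field by \<open>M\<close> turns the constant into \<open>1\<close>, so that the
  estimates for flows can be done with absolute constants.\<close>

definition tame :: "real \<Rightarrow> 'a set \<Rightarrow> ('a \<Rightarrow> 'a) \<Rightarrow> ('a \<Rightarrow> 'a \<Rightarrow> 'a::euclidean_space) \<Rightarrow> bool" where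
  "tame M S f f' \<longleftrightarrow> (\<forall>p\<in>S. norm (f p) \<le> M) \<and> M-lipschitz_on S f \<and>
     (\<forall>p\<in>S. linear (f' p) \<and> (\<forall>v. norm (f' p v) \<le> M * norm v)) \<and>
     (\<forall>p\<in>S. \<forall>q\<in>S. norm (f q - f p - f' p (q - p)) \<le> M * (norm (q - p))\<^sup>2) \<and>
     (\<forall>p\<in>S. \<forall>q\<in>S. \<forall>v. norm (f' q v - f' p v) \<le> M * norm (q - p) * norm v)"

lemma tameD:
  assumes "tame M S f f'"
  shows "M-lipschitz_on S f" "\<And>p. p \<in> S \<Longrightarrow> norm (f p) \<le> M" "\<And>p. p \<in> S \<Longrightarrow> linear (f' p)"
    "\<And>p v. p \<in> S \<Longrightarrow> norm (f' p v) \<le> M * norm v"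
    "\<And>p q v. p \<in> S \<Longrightarrow> q \<in> S \<Longrightarrow> norm (f' q v - f' p v) \<le> M * norm (q - p) * norm v"
    "\<And>p q. p \<in> S \<Longrightarrow> q \<in> S \<Longrightarrow> norm (f q - f p - f' p (q - p)) \<le> M * (norm (q - p))\<^sup>2"
  using assms unfolding tame_def by simp_all

text \<open>The \<open>C\<^sup>1\<close> bounds are applied to the field itself and to the partial derivatives; the remainder
  estimate follows from the Lipschitz bound of the derivative on the segment.\<close>

lemma smooth_tame_on_ball:
  fixes f :: "'a::euclidean_space \<Rightarrow> 'a"
  assumes "smooth f"
  shows "\<exists>M\<ge>1. tame M (cball 0 R) f (\<lambda>p. frechet_derivative f (at p))"
proof -
  define D where "D p = frechet_derivative f (at p)" for p
  have C1: "C_times (Suc 0) f" and C2: "C_times (Suc 0) (\<lambda>p. D p v)" for v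
    using assms C_times.simps(2)[of "Suc 0" f] unfolding smooth_def D_def by blast+
  have der: "(f has_derivative D p) (at p)" for p
    using C1 by (simp add: frechet_derivative_works D_def)
  have lin: "linear (D p)" for p using der has_derivative_linear by blast
  obtain L where L: "0 \<le> L" "L-lipschitz_on (cball 0 R) f"
    "\<And>p v. p \<in> cball 0 R \<Longrightarrow> norm (D p v) \<le> L * norm v"
    using C1_bounds_on_ball[OF C1, of R] unfolding D_def by blast
  have "\<exists>L. 0 \<le> L \<and> L-lipschitz_on (cball 0 R) (\<lambda>p. D p v)" for v
    by (rule C1_bounds_on_ball[OF C2[of v], of R]) blast
  then obtain L' where L': "\<And>v. 0 \<le> L' v" "\<And>v. lipschitz_on (L' v) (cball 0 R) (\<lambda>p. D p v)"
    by metis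
  define M' where "M' = (\<Sum>b\<in>Basis. L' b)"
  have M': "0 \<le> M'" unfolding M'_def using L' by (intro sum_nonneg)
  have D_lip: "norm (D q v - D p v) \<le> M' * norm (q - p) * norm v"
    if pq: "p \<in> cball 0 R" "q \<in> cball 0 R" for p q v
  proof -
    have ex: "D p v = (\<Sum>b\<in>Basis. (v \<bullet> b) *\<^sub>R D p b)" for p
      using linear_sum[OF lin[of p], of "\<lambda>b. (v \<bullet> b) *\<^sub>R b" Basis] by (simp add: linear_scale[OF lin] euclidean_representation)
    have "D q v - D p v = (\<Sum>b\<in>Basis. (v \<bullet> b) *\<^sub>R (D q b - D p b))"
      unfolding ex by (simp add: sum_subtractf scaleR_diff_right)
    also have "norm \<dots> \<le> (\<Sum>b\<in>Basis. norm v * (L' b * norm (q - p)))"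
    proof (rule sum_norm_le)
      fix b :: 'a assume b: "b \<in> Basis"
      show "norm ((v \<bullet> b) *\<^sub>R (D q b - D p b)) \<le> norm v * (L' b * norm (q - p))"
        using Basis_le_norm[OF b, of v] lipschitz_on_normD[OF L'(2) pq(2,1), of b] by (simp add: mult_mono)
    qed
    also have "\<dots> = M' * norm (q - p) * norm v"
      by (simp add: M'_def sum_distrib_right sum_distrib_left mult_ac)
    finally show ?thesis .
  qed
  have quad: "norm (f q - f p - D p (q - p)) \<le> M' * (norm (q - p))\<^sup>2"
    if pq: "p \<in> cball 0 R" "q \<in> cball 0 R" for p q
  proof -
    have "norm (f q - f p - D p (q - p)) \<le> norm (q - p) * (M' * norm (q - p))"
    proof (rule differentiable_bound_linearization[where S="closed_segment p q" and f'=D and ?x0.0=p])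
      show "p + t *\<^sub>R (q - p) \<in> closed_segment p q" if "t \<in> {0..1}" for t
        using that by (auto simp: in_segment algebra_simps intro!: exI[of _ t])
      show "(f has_derivative D z) (at z within closed_segment p q)" for z
        using der has_derivative_at_withinI by blast
      show "onorm (D z - D p) \<le> M' * norm (q - p)" if z: "z \<in> closed_segment p q" for z
      proof (rule onorm_le)
        fix v
        have zR: "z \<in> cball 0 R"
          using closed_segment_subset[OF pq convex_cball] z by blast
        have "norm ((D z - D p) v) \<le> M' * norm (z - p) * norm v"
          using D_lip[OF pq(1) zR] by (simp add: fun_diff_def)
        also have "\<dots> \<le> M' * norm (q - p) * norm v"
          using segment_bound1[OF z] M' by (intro mult_right_mono mult_left_mono) auto
        finally show "norm ((D z - D p) v) \<le> M' * norm (q - p) * norm v" .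
      qed
    qed auto
    then show ?thesis by (simp add: power2_eq_square mult_ac)
  qed
  define M where "M = 1 + L + M' + norm (f 0) + L * \<bar>R\<bar>"
  have LR: "0 \<le> L * \<bar>R\<bar>" using L by simp
  have M: "1 \<le> M" "L \<le> M" "M' \<le> M" using L M' LR norm_ge_zero[of "f 0"] unfolding M_def by linarith+
  show ?thesis unfolding tame_def
  proof (intro exI[of _ M] conjI ballI allI)
    show "1 \<le> M" by (fact M(1))
    show "M-lipschitz_on (cball 0 R) f" using L(2) M lipschitz_on_mono by blast
    show "norm (f p) \<le> M" if p: "p \<in> cball 0 R" for p
    proof -
      have "norm p \<le> R" using p by simp
      then have "(0::'a) \<in> cball 0 R" using order_trans[OF norm_ge_zero[of p]] by simp
      then have "norm (f p - f 0) \<le> L * norm (p - 0)" using lipschitz_on_normD[OF L(2) p] by blast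
      also have "\<dots> \<le> L * \<bar>R\<bar>" using p L by (intro mult_left_mono) auto
      finally show ?thesis using norm_triangle_sub[of "f p" "f 0"] L M' unfolding M_def by linarith
    qed
    show "linear (frechet_derivative f (at p))" for p using lin by (simp add: D_def)
    show "norm (frechet_derivative f (at p) v) \<le> M * norm v" if "p \<in> cball 0 R" for p v
      using L(3)[OF that, of v] mult_right_mono[OF M(2), of "norm v"] by (simp add: D_def)
    show "norm (frechet_derivative f (at q) v - frechet_derivative f (at p) v) \<le> M * norm (q - p) * norm v"
      if "p \<in> cball 0 R" "q \<in> cball 0 R" for p q v
      using D_lip[OF that, of v] mult_right_mono[OF M(3), of "norm (q - p) * norm v"]
      by (simp add: D_def mult_ac)
    show "norm (f q - f p - frechet_derivative f (at p) (q - p)) \<le> M * (norm (q - p))\<^sup>2"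
      if "p \<in> cball 0 R" "q \<in> cball 0 R" for p q
      using quad[OF that] mult_right_mono[OF M(3), of "(norm (q - p))\<^sup>2"] by (simp add: D_def)
  qed
qed

text \<open>The bracket only involves the fields and their first derivatives, which are Lipschitz on balls.
  So the fields that span \<open>W\<close> are locally Lipschitz, and that is all the regularity the projections
  need.\<close>

lemma lie_bracket_lipschitz_on_ball:
  fixes f g :: "'a::euclidean_space \<Rightarrow> 'a"
  assumes "smooth f" "smooth g"
  shows "\<exists>L. L-lipschitz_on (cball 0 R) (lie_bracket f g)"
proof -
  have half: "\<exists>L. L-lipschitz_on (cball 0 R) (\<lambda>p. frechet_derivative g (at p) (f p))"
    if fg: "smooth f" "smooth g" for f g :: "'a \<Rightarrow> 'a"
  proof -
    obtain M where "1 \<le> M" and f: "tame M (cball 0 R) f (\<lambda>p. frechet_derivative f (at p))"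
      using smooth_tame_on_ball[OF fg(1)] by blast
    obtain N where "1 \<le> N" and g: "tame N (cball 0 R) g (\<lambda>p. frechet_derivative g (at p))"
      using smooth_tame_on_ball[OF fg(2)] by blast
    note M = \<open>1 \<le> M\<close> tameD[OF f] and N = \<open>1 \<le> N\<close> tameD[OF g]
    have "(2 * N * M)-lipschitz_on (cball 0 R) (\<lambda>p. frechet_derivative g (at p) (f p))"
    proof (rule lipschitz_onI)
      fix p q :: 'a assume pq: "p \<in> cball 0 R" "q \<in> cball 0 R"
      define D where "D p = frechet_derivative g (at p)" for p
      have "D p (f p) - D q (f q) = (D p (f p) - D q (f p)) + D q (f p - f q)"
        using linear_diff[OF N(4)[OF pq(2)]] by (simp add: D_def)
      also have "norm \<dots> \<le> N * norm (p - q) * norm (f p) + N * norm (f p - f q)"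
        unfolding D_def using N(5)[OF pq(2)] N(6)[OF pq(2,1)] by (intro norm_triangle_le add_mono)
      also have "\<dots> \<le> N * norm (p - q) * M + N * (M * norm (p - q))"
        using N(1) M(3)[OF pq(1)] lipschitz_on_normD[OF M(2) pq] by (intro add_mono mult_left_mono) auto
      finally show "dist (frechet_derivative g (at p) (f p)) (frechet_derivative g (at q) (f q))
          \<le> 2 * N * M * dist p q"
        by (simp add: dist_norm D_def mult_ac)
    qed (use M(1) N(1) in auto)
    then show ?thesis by blast
  qed
  obtain L\<^sub>1 L\<^sub>2 where "L\<^sub>1-lipschitz_on (cball 0 R) (\<lambda>p. frechet_derivative g (at p) (f p))"
    "L\<^sub>2-lipschitz_on (cball 0 R) (\<lambda>p. frechet_derivative f (at p) (g p))"
    using half[OF assms] half[OF assms(2,1)] by blast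
  from lipschitz_on_diff[OF this] show ?thesis
    by (auto simp: lie_bracket_def[abs_def])
qed

section \<open>Frames and projections\<close>

text \<open>A locally Lipschitz frame of the whole space, split into the first \<open>k\<close> fields, which span \<open>V\<close>, and
  the others, which span \<open>W\<close>.\<close>

locale lipschitz_frame =
  fixes X :: "nat \<Rightarrow> 'a::euclidean_space \<Rightarrow> 'a" and k :: nat
  assumes k_le: "k \<le> DIM('a)"
    and inj_frame: "inj_on (\<lambda>i. X i x) {1..DIM('a)}"
    and independent_frame: "independent ((\<lambda>i. X i x) ` {1..DIM('a)})"
    and lipschitz_frame: "i \<in> {1..DIM('a)} \<Longrightarrow> \<exists>L. L-lipschitz_on (cball 0 R) (X i)"
begin

abbreviation "V \<equiv> span_field X {1..k}"
abbreviation "W \<equiv> span_field X {k+1..DIM('a)}"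

text \<open>The frame is numbered by naturals while vectors have coordinates with respect to \<open>Basis\<close>; an
  arbitrary bijection identifies the two index sets. In this way the coefficients with respect to
  the frame at \<open>x\<close> form a vector \<open>coord x v\<close> of the same space, \<open>frame_map x\<close> is a linear automorphism
  of it, and the projection onto \<open>V x\<close> is the conjugate of a fixed coordinate projection \<open>cut\<close>.\<close>

definition label :: "'a \<Rightarrow> nat" where
  "label = (SOME e. bij_betw e Basis {1..DIM('a)})"

lemma label: "bij_betw label Basis {1..DIM('a)}"
proof -
  have "\<exists>e. bij_betw e (Basis :: 'a set) {1..DIM('a)}"
    by (rule finite_same_card_bij) auto
  then show ?thesis unfolding label_def by (rule someI_ex)
qed

lemma label_in: "b \<in> Basis \<Longrightarrow> label b \<in> {1..DIM('a)}"
  using label by (auto simp: bij_betw_def)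

definition frame_map :: "'a \<Rightarrow> 'a \<Rightarrow> 'a" where
  "frame_map x c = (\<Sum>b\<in>Basis. (c \<bullet> b) *\<^sub>R X (label b) x)"

lemma linear_frame_map: "linear (frame_map x)"
  unfolding frame_map_def by (intro linearI) (auto simp: inner_add_left scaleR_add_left sum.distrib scaleR_right.sum)

lemma frame_map_Basis: "b \<in> Basis \<Longrightarrow> frame_map x b = X (label b) x"
proof -
  assume b: "b \<in> Basis"
  have "frame_map x b = (\<Sum>c\<in>Basis. if c = b then X (label c) x else 0)"
    unfolding frame_map_def by (rule sum.cong) (use b in \<open>auto simp: inner_Basis\<close>)
  then show ?thesis using b by simp
qed

lemma frame_map_eq_0: "frame_map x c = 0 \<Longrightarrow> c = 0"
proof -
  assume c: "frame_map x c = 0"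
  let ?h = "\<lambda>b. X (label b) x"
  have inj: "inj_on ?h Basis"
    using comp_inj_on[of label Basis "\<lambda>i. X i x"] label inj_frame by (auto simp: bij_betw_def o_def)
  have im: "?h ` Basis = (\<lambda>i. X i x) ` {1..DIM('a)}"
    unfolding bij_betw_imp_surj_on[OF label, symmetric] by (simp add: image_image)
  have "(\<Sum>w\<in>?h ` Basis. (c \<bullet> inv_into Basis ?h w) *\<^sub>R w) = frame_map x c"
    unfolding frame_map_def sum.reindex[OF inj] by (simp add: inv_into_f_f[OF inj])
  then have "(\<Sum>w\<in>?h ` Basis. (c \<bullet> inv_into Basis ?h w) *\<^sub>R w) = 0" using c by simp
  then have "c \<bullet> inv_into Basis ?h w = 0" if "w \<in> ?h ` Basis" for w
    using independentD[OF independent_frame[of x], of "?h ` Basis" "\<lambda>w. c \<bullet> inv_into Basis ?h w" w] im that by simp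
  note zero = this
  have "c \<bullet> b = 0" if "b \<in> Basis" for b
    using zero[OF imageI[OF that]] unfolding inv_into_f_f[OF inj that] .
  then have "\<forall>b\<in>Basis. c \<bullet> b = 0" by blast
  then show "c = 0" using euclidean_all_zero_iff by blast
qed

lemma bij_frame_map: "bij (frame_map x)"
proof -
  have "inj (frame_map x)" using frame_map_eq_0 linear_frame_map linear_injective_0 by blast
  then show ?thesis using linear_frame_map linear_injective_imp_surjective by (auto simp: bij_def)
qed

definition coord :: "'a \<Rightarrow> 'a \<Rightarrow> 'a" where "coord x = inv (frame_map x)"

lemma frame_map_coord [simp]: "frame_map x (coord x v) = v"
  using bij_frame_map[of x] by (simp add: coord_def bij_is_surj surj_f_inv_f)

lemma coord_frame_map [simp]: "coord x (frame_map x c) = c"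
  using bij_frame_map[of x] by (simp add: coord_def bij_is_inj)

lemma linear_coord: "linear (coord x)"
proof (rule linearI)
  show "coord x (v + w) = coord x v + coord x w" for v w
    using coord_frame_map[of x "coord x v + coord x w"] linear_add[OF linear_frame_map] by simp
  show "coord x (r *\<^sub>R v) = r *\<^sub>R coord x v" for r v
    using coord_frame_map[of x "r *\<^sub>R coord x v"] linear_scale[OF linear_frame_map] by simp
qed

definition cut :: "'a \<Rightarrow> 'a" where
  "cut c = (\<Sum>b\<in>{b\<in>Basis. label b \<le> k}. (c \<bullet> b) *\<^sub>R b)"

lemma cut_inner: "b \<in> Basis \<Longrightarrow> cut c \<bullet> b = (if label b \<le> k then c \<bullet> b else 0)"
proof -
  assume b: "b \<in> Basis"
  have "cut c \<bullet> b = (\<Sum>a\<in>{b\<in>Basis. label b \<le> k}. if a = b then c \<bullet> a else 0)"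
    unfolding cut_def inner_sum_left by (rule sum.cong) (use b in \<open>auto simp: inner_Basis\<close>)
  then show ?thesis using b by simp
qed

lemma linear_cut: "linear cut"
  by (rule linearI; rule euclidean_eqI) (auto simp: cut_inner inner_add_left)

lemma norm_cut_le: "norm (cut c) \<le> norm c"
  by (rule norm_le_componentwise) (auto simp: cut_inner)

text \<open>Membership in \<open>V x\<close> and \<open>W x\<close> can be read off from the coordinates; this reduces all statements
  about the projection to linear algebra with the fixed map \<open>cut\<close>.\<close>

lemma V_iff: "v \<in> V x \<longleftrightarrow> cut (coord x v) = coord x v"
proof
  have "span ((\<lambda>i. X i x) ` {1..k}) \<subseteq> {v. cut (coord x v) = coord x v}"
  proof (rule span_minimal)
    show "subspace {v. cut (coord x v) = coord x v}"
      using linear_cut linear_coord[of x] by (auto simp: subspace_def linear_add linear_scale linear_0)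
    show "(\<lambda>i. X i x) ` {1..k} \<subseteq> {v. cut (coord x v) = coord x v}"
    proof
      fix v assume "v \<in> (\<lambda>i. X i x) ` {1..k}"
      then obtain i where i: "i \<in> {1..k}" "v = X i x" by blast
      have "i \<in> label ` Basis" using bij_betw_imp_surj_on[OF label] i k_le by simp
      then obtain b where b: "b \<in> Basis" "label b = i" by blast
      have "coord x v = b" using coord_frame_map[of x b] unfolding frame_map_Basis[OF b(1)] b(2) i(2) .
      moreover have "cut b = b"
      proof (rule euclidean_eqI)
        fix c :: 'a assume c: "c \<in> Basis"
        show "cut b \<bullet> c = b \<bullet> c"
          unfolding cut_inner[OF c] inner_Basis[OF b(1) c] using b(2) i(1) by auto
      qed
      ultimately show "v \<in> {v. cut (coord x v) = coord x v}" by simp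
    qed
  qed
  then show "cut (coord x v) = coord x v" if "v \<in> V x" using that by (auto simp: span_field_def)
next
  assume "cut (coord x v) = coord x v"
  then have "v = frame_map x (cut (coord x v))" by simp
  also have "\<dots> = (\<Sum>b\<in>Basis. (if label b \<le> k then coord x v \<bullet> b else 0) *\<^sub>R X (label b) x)"
    unfolding frame_map_def by (rule sum.cong) (auto simp: cut_inner)
  also have "\<dots> \<in> span ((\<lambda>i. X i x) ` {1..k})"
  proof (rule span_sum)
    fix b :: 'a assume "b \<in> Basis"
    then have "label b \<le> k \<Longrightarrow> X (label b) x \<in> span ((\<lambda>i. X i x) ` {1..k})"
      using label_in by (intro span_base) auto
    then show "(if label b \<le> k then coord x v \<bullet> b else 0) *\<^sub>R X (label b) x \<in> span ((\<lambda>i. X i x) ` {1..k})"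
      by (simp add: span_scale span_zero)
  qed
  finally show "v \<in> V x" by (simp add: span_field_def)
qed

lemma W_iff: "v \<in> W x \<longleftrightarrow> cut (coord x v) = 0"
proof
  have "span ((\<lambda>i. X i x) ` {k+1..DIM('a)}) \<subseteq> {v. cut (coord x v) = 0}"
  proof (rule span_minimal)
    show "subspace {v. cut (coord x v) = 0}"
      using linear_cut linear_coord[of x] by (auto simp: subspace_def linear_add linear_scale linear_0)
    show "(\<lambda>i. X i x) ` {k+1..DIM('a)} \<subseteq> {v. cut (coord x v) = 0}"
    proof
      fix v assume "v \<in> (\<lambda>i. X i x) ` {k+1..DIM('a)}"
      then obtain i where i: "i \<in> {k+1..DIM('a)}" "v = X i x" by blast
      then have "i \<in> label ` Basis" using label by (auto simp: bij_betw_def)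
      then obtain b where b: "b \<in> Basis" "label b = i" by blast
      have "coord x v = b" using coord_frame_map[of x b] unfolding frame_map_Basis[OF b(1)] b(2) i(2) .
      moreover have "cut b = 0"
      proof (rule euclidean_eqI)
        fix c :: 'a assume c: "c \<in> Basis"
        show "cut b \<bullet> c = 0 \<bullet> c"
          unfolding cut_inner[OF c] inner_Basis[OF b(1) c] using b(2) i(1) by auto
      qed
      ultimately show "v \<in> {v. cut (coord x v) = 0}" by simp
    qed
  qed
  then show "cut (coord x v) = 0" if "v \<in> W x" using that by (auto simp: span_field_def)
next
  assume cut: "cut (coord x v) = 0"
  have "v = frame_map x (coord x v)" by simp
  also have "\<dots> \<in> span ((\<lambda>i. X i x) ` {k+1..DIM('a)})"
    unfolding frame_map_def
  proof (rule span_sum)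
    fix b :: 'a assume b: "b \<in> Basis"
    have "label b \<le> k \<Longrightarrow> coord x v \<bullet> b = 0" using cut_inner[OF b, of "coord x v"] cut by simp
    moreover have "\<not> label b \<le> k \<Longrightarrow> X (label b) x \<in> span ((\<lambda>i. X i x) ` {k+1..DIM('a)})"
      using label_in[OF b] by (intro span_base) auto
    ultimately show "(coord x v \<bullet> b) *\<^sub>R X (label b) x \<in> span ((\<lambda>i. X i x) ` {k+1..DIM('a)})"
      by (cases "label b \<le> k") (simp_all add: span_scale span_zero)
  qed
  finally show "v \<in> W x" by (simp add: span_field_def)
qed

abbreviation "proj x \<equiv> proj_along (V x) (W x)"

lemma proj_eq: "proj x v = frame_map x (cut (coord x v))"
  unfolding proj_along_def
proof (rule the_equality)
  have cut_cut: "cut (cut c) = cut c" for c by (rule euclidean_eqI) (simp add: cut_inner)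
  show "frame_map x (cut (coord x v)) \<in> V x \<and> v - frame_map x (cut (coord x v)) \<in> W x"
    unfolding V_iff W_iff
    by (simp add: linear_diff[OF linear_coord] linear_diff[OF linear_cut] cut_cut)
next
  fix u assume u: "u \<in> V x \<and> v - u \<in> W x"
  then have "cut (coord x v) = coord x u"
    unfolding V_iff W_iff by (simp add: linear_diff[OF linear_coord] linear_diff[OF linear_cut])
  then show "u = frame_map x (cut (coord x v))" by simp
qed

lemma linear_proj: "linear (proj x)"
  unfolding proj_eq using linear_compose[OF linear_compose[OF linear_coord linear_cut] linear_frame_map]
  by (simp add: o_def)

lemma proj_in_V: "proj x v \<in> V x" and diff_proj_in_W: "v - proj x v \<in> W x"
proof -
  have cut_cut: "cut (cut c) = cut c" for c by (rule euclidean_eqI) (simp add: cut_inner)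
  show "proj x v \<in> V x" "v - proj x v \<in> W x" unfolding V_iff W_iff proj_eq
    by (simp_all add: linear_diff[OF linear_coord] linear_diff[OF linear_cut] cut_cut)
qed

lemma proj_of_V: "v \<in> V x \<Longrightarrow> proj x v = v"
  unfolding proj_eq V_iff by simp

lemma subspace_V: "subspace (V x)"
  by (simp add: span_field_def)

definition coeff :: "'a \<Rightarrow> 'a \<Rightarrow> nat \<Rightarrow> real" where
  "coeff x v i = coord x v \<bullet> inv_into Basis label i"

lemma coeff_sum: "v = (\<Sum>i\<in>{1..DIM('a)}. coeff x v i *\<^sub>R X i x)"
proof -
  have "v = frame_map x (coord x v)" by simp
  also have "\<dots> = (\<Sum>b\<in>Basis. coeff x v (label b) *\<^sub>R X (label b) x)"
    unfolding frame_map_def coeff_def using label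
    by (intro sum.cong) (auto simp: bij_betw_def inv_into_f_f)
  also have "\<dots> = (\<Sum>i\<in>{1..DIM('a)}. coeff x v i *\<^sub>R X i x)"
    by (rule sum.reindex_bij_betw[OF label])
  finally show ?thesis .
qed

lemma label_inv_into:
  "i \<in> {1..DIM('a)} \<Longrightarrow> inv_into Basis label i \<in> Basis \<and> label (inv_into Basis label i) = i"
  using bij_betw_imp_surj_on[OF label] inv_into_into[of i label Basis] f_inv_into_f[of i label Basis]
  by simp

lemma V_coeff_sum:
  assumes "v \<in> V x" shows "v = (\<Sum>i\<in>{1..k}. coeff x v i *\<^sub>R X i x)"
proof -
  have "coeff x v i = 0" if i: "i \<in> {1..DIM('a)} - {1..k}" for i
    using label_inv_into[of i] i cut_inner[of "inv_into Basis label i" "coord x v"] assms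
    unfolding V_iff coeff_def by auto
  then have "(\<Sum>i\<in>{1..k}. coeff x v i *\<^sub>R X i x) = (\<Sum>i\<in>{1..DIM('a)}. coeff x v i *\<^sub>R X i x)"
    using k_le by (intro sum.mono_neutral_left) auto
  then show ?thesis using coeff_sum[of v x] by simp
qed

lemma W_coeff_sum:
  assumes "v \<in> W x" shows "v = (\<Sum>i\<in>{k+1..DIM('a)}. coeff x v i *\<^sub>R X i x)"
proof -
  have "coeff x v i = 0" if i: "i \<in> {1..DIM('a)} - {k+1..DIM('a)}" for i
    using label_inv_into[of i] i cut_inner[of "inv_into Basis label i" "coord x v"] assms
    unfolding W_iff coeff_def by auto
  then have "(\<Sum>i\<in>{k+1..DIM('a)}. coeff x v i *\<^sub>R X i x) = (\<Sum>i\<in>{1..DIM('a)}. coeff x v i *\<^sub>R X i x)"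
    by (intro sum.mono_neutral_left) auto
  then show ?thesis using coeff_sum[of v x] by simp
qed

lemma frame_map_bounds:
  obtains L where "0 \<le> L" "\<And>x y c. x \<in> cball 0 R \<Longrightarrow> y \<in> cball 0 R \<Longrightarrow>
      norm (frame_map x c - frame_map y c) \<le> L * norm (x - y) * norm c"
    "\<And>x c. x \<in> cball 0 R \<Longrightarrow> norm (frame_map x c) \<le> L * norm c"
proof -
  obtain l where l: "\<And>i. i \<in> {1..DIM('a)} \<Longrightarrow> lipschitz_on (l i) (cball 0 R) (X i)"
    using lipschitz_frame[of _ R] by metis
  have "\<exists>M. \<forall>x\<in>cball 0 R. norm (X i x) \<le> M" if "i \<in> {1..DIM('a)}" for i
  proof -
    have "compact (X i ` cball 0 R)"
      using lipschitz_on_continuous_on[OF l[OF that]] by (intro compact_continuous_image) auto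
    from compact_imp_bounded[OF this] show ?thesis unfolding bounded_iff by auto
  qed
  then obtain M where M: "\<And>i x. i \<in> {1..DIM('a)} \<Longrightarrow> x \<in> cball 0 R \<Longrightarrow> norm (X i x) \<le> M i"
    by metis
  define L where "L = (\<Sum>b\<in>(Basis :: 'a set). max 0 (max (l (label b)) (M (label b))))"
  show thesis
  proof (rule that)
    show "0 \<le> L" unfolding L_def by (intro sum_nonneg) auto
    fix x c :: 'a assume x: "x \<in> cball 0 R"
    have "norm (frame_map x c) \<le> (\<Sum>b\<in>Basis. norm c * max 0 (max (l (label b)) (M (label b))))"
      unfolding frame_map_def
    proof (rule sum_norm_le)
      fix b :: 'a assume b: "b \<in> Basis"
      have "norm (X (label b) x) \<le> max 0 (max (l (label b)) (M (label b)))"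
        using M[OF label_in[OF b] x] by simp
      then show "norm ((c \<bullet> b) *\<^sub>R X (label b) x) \<le> norm c * max 0 (max (l (label b)) (M (label b)))"
        using Basis_le_norm[OF b, of c] by (simp only: norm_scaleR) (intro mult_mono, auto)
    qed
    also have "\<dots> = L * norm c" by (simp add: L_def sum_distrib_left mult.commute)
    finally show "norm (frame_map x c) \<le> L * norm c" .
    fix y :: 'a assume y: "y \<in> cball 0 R"
    have "frame_map x c - frame_map y c = (\<Sum>b\<in>Basis. (c \<bullet> b) *\<^sub>R (X (label b) x - X (label b) y))"
      by (simp add: frame_map_def sum_subtractf scaleR_diff_right)
    also have "norm \<dots> \<le> (\<Sum>b\<in>Basis. norm c * (max 0 (max (l (label b)) (M (label b))) * norm (x - y)))"
    proof (rule sum_norm_le)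
      fix b :: 'a assume b: "b \<in> Basis"
      have "norm (X (label b) x - X (label b) y) \<le> l (label b) * norm (x - y)"
        using lipschitz_on_normD[OF l[OF label_in[OF b]] x y] .
      also have "\<dots> \<le> max 0 (max (l (label b)) (M (label b))) * norm (x - y)"
        by (intro mult_right_mono) auto
      finally show "norm ((c \<bullet> b) *\<^sub>R (X (label b) x - X (label b) y))
          \<le> norm c * (max 0 (max (l (label b)) (M (label b))) * norm (x - y))"
        using Basis_le_norm[OF b, of c] by (simp only: norm_scaleR) (intro mult_mono, auto)
    qed
    also have "\<dots> = L * norm (x - y) * norm c"
      by (simp add: L_def sum_distrib_right sum_distrib_left mult_ac)
    finally show "norm (frame_map x c - frame_map y c) \<le> L * norm (x - y) * norm c" .
  qed
qed

text \<open>The map \<open>(x, c) \<mapsto> norm (frame_map x c)\<close> is continuous and positive on the compact product of a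
  ball with the unit sphere, so it is bounded below there by some \<open>m > 0\<close>. This is the uniform
  transversality of \<open>V\<close> and \<open>W\<close> over compact sets.\<close>

lemma coord_bound:
  obtains m where "0 < m" "\<And>x v. x \<in> cball 0 R \<Longrightarrow> m * norm (coord x v) \<le> norm v"
proof (cases "R < 0")
  case True
  then show thesis using that[of 1] by auto
next
  case False
  obtain L where L: "0 \<le> L" "\<And>x y c. x \<in> cball 0 R \<Longrightarrow> y \<in> cball 0 R \<Longrightarrow>
      norm (frame_map x c - frame_map y c) \<le> L * norm (x - y) * norm c"
    "\<And>x c. x \<in> cball 0 R \<Longrightarrow> norm (frame_map x c) \<le> L * norm c"
    using frame_map_bounds[of R] by blast
  let ?S = "cball 0 R \<times> sphere 0 (1::real) :: ('a \<times> 'a) set"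
  have cont: "continuous_on ?S (\<lambda>(x, c). norm (frame_map x c))"
  proof -
    have X: "continuous_on (cball 0 R) (X (label b))" if "b \<in> Basis" for b
      using lipschitz_frame[OF label_in[OF that], of R] lipschitz_on_continuous_on by blast
    have "continuous_on ?S (\<lambda>z. X (label b) (fst z))" if "b \<in> Basis" for b
      by (rule continuous_on_compose2[OF X[OF that]]) (auto intro!: continuous_intros)
    then show ?thesis unfolding frame_map_def case_prod_beta by (intro continuous_intros) auto
  qed
  have "?S \<noteq> {}" using False by auto
  moreover have "compact ?S" by (intro compact_Times) auto
  ultimately obtain z where z: "z \<in> ?S" "\<forall>w\<in>?S. (\<lambda>(x, c). norm (frame_map x c)) z \<le> (\<lambda>(x, c). norm (frame_map x c)) w"
    using continuous_attains_inf[OF _ _ cont] by blast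
  obtain x\<^sub>0 c\<^sub>0 where zz: "z = (x\<^sub>0, c\<^sub>0)" by (cases z)
  define m where "m = norm (frame_map x\<^sub>0 c\<^sub>0)"
  have "c\<^sub>0 \<noteq> 0" using z zz by auto
  then have m: "m > 0" using frame_map_eq_0 by (auto simp: m_def)
  show thesis
  proof (rule that[OF m])
    fix x v :: 'a assume x: "x \<in> cball 0 R"
    show "m * norm (coord x v) \<le> norm v"
    proof (cases "coord x v = 0")
      case False
      define c where "c = coord x v /\<^sub>R norm (coord x v)"
      have "(x, c) \<in> ?S" using x False by (simp add: c_def)
      then have "m \<le> norm (frame_map x c)" using z zz by (force simp: m_def)
      also have "frame_map x c = v /\<^sub>R norm (coord x v)"
        by (simp add: c_def linear_scale[OF linear_frame_map])
      finally show ?thesis using False by (simp add: field_simps)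
    qed simp
  qed
qed

text \<open>\<open>C\<close> bounds the two projections and the coefficient functions over the ball of radius \<open>R\<close>, and it
  is a Lipschitz constant for the dependence of the projection on the base point.\<close>

definition frame_bound :: "real \<Rightarrow> real \<Rightarrow> bool" where
  "frame_bound R C \<longleftrightarrow> 1 \<le> C \<and> (\<forall>x\<in>cball 0 R. \<forall>v. norm (proj x v) \<le> C * norm v \<and>
     norm (v - proj x v) \<le> C * norm v \<and>
     (\<forall>y\<in>cball 0 R. norm (proj x v - proj y v) \<le> C * norm (x - y) * norm v) \<and>
     (\<forall>i\<in>{1..DIM('a)}. \<bar>coeff x v i\<bar> \<le> C * norm v))"

lemma frame_boundD:
  assumes "frame_bound R C"
  shows "1 \<le> C" "\<And>x v. x \<in> cball 0 R \<Longrightarrow> norm (proj x v) \<le> C * norm v"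
    "\<And>x v. x \<in> cball 0 R \<Longrightarrow> norm (v - proj x v) \<le> C * norm v"
    "\<And>x y v. x \<in> cball 0 R \<Longrightarrow> y \<in> cball 0 R \<Longrightarrow> norm (proj x v - proj y v) \<le> C * norm (x - y) * norm v"
    "\<And>x v i. x \<in> cball 0 R \<Longrightarrow> i \<in> {1..DIM('a)} \<Longrightarrow> \<bar>coeff x v i\<bar> \<le> C * norm v"
  using assms unfolding frame_bound_def by blast+

text \<open>Only the Lipschitz dependence needs an argument: two coordinate vectors \<open>c\<close>, \<open>c'\<close> of the same
  vector at \<open>x\<close> and \<open>y\<close> satisfy \<open>frame_map x (c - c') = frame_map y c' - frame_map x c'\<close>, which is
  small with \<open>x - y\<close>, and \<open>frame_map x\<close> has a bounded inverse.\<close>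

lemma frame_bound_exists: "\<exists>C. frame_bound R C"
proof -
  obtain L where L: "0 \<le> L" "\<And>x y c. x \<in> cball 0 R \<Longrightarrow> y \<in> cball 0 R \<Longrightarrow>
      norm (frame_map x c - frame_map y c) \<le> L * norm (x - y) * norm c"
    "\<And>x c. x \<in> cball 0 R \<Longrightarrow> norm (frame_map x c) \<le> L * norm c"
    using frame_map_bounds[of R] by blast
  obtain m where m: "0 < m" "\<And>x v. x \<in> cball 0 R \<Longrightarrow> m * norm (coord x v) \<le> norm v"
    using coord_bound[of R] by blast
  have co: "norm (coord x v) \<le> norm v / m" if "x \<in> cball 0 R" for x v
    using m(2)[OF that, of v] m(1) by (simp add: field_simps)
  define C where "C = 1 + 1 / m + L / m + L * (L / (m * m))"
  have nn: "0 \<le> 1 / m" "0 \<le> L / m" "0 \<le> L * (L / (m * m))" using L m by auto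
  have cut_co: "norm (cut (coord x v)) \<le> norm v / m" if "x \<in> cball 0 R" for x v
    using co[OF that, of v] norm_cut_le[of "coord x v"] by linarith
  have 1: "norm (proj x v) \<le> L / m * norm v" if "x \<in> cball 0 R" for x v
  proof -
    have "norm (proj x v) \<le> L * norm (cut (coord x v))" unfolding proj_eq using L that by blast
    also have "\<dots> \<le> L * (norm v / m)" using cut_co[OF that] L by (intro mult_left_mono)
    finally show ?thesis by simp
  qed
  show ?thesis unfolding frame_bound_def
  proof (intro exI[of _ C] conjI ballI allI)
    show "1 \<le> C" using nn unfolding C_def by linarith
    fix x v :: 'a assume x: "x \<in> cball 0 R"
    have "L / m * norm v \<le> (C - 1) * norm v" using nn unfolding C_def by (intro mult_right_mono) auto
    then show "norm (proj x v) \<le> C * norm v" "norm (v - proj x v) \<le> C * norm v"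
      using 1[OF x, of v] norm_triangle_ineq4[of v "proj x v"] norm_ge_zero[of v]
      by (auto simp: algebra_simps simp del: norm_ge_zero)
    show "\<bar>coeff x v i\<bar> \<le> C * norm v" if "i \<in> {1..DIM('a)}" for i
    proof -
      have "\<bar>coeff x v i\<bar> \<le> norm (coord x v)"
        unfolding coeff_def using label_inv_into[OF that] Basis_le_norm by blast
      also have "\<dots> \<le> 1 / m * norm v" using co[OF x, of v] by simp
      also have "\<dots> \<le> C * norm v" using nn unfolding C_def by (intro mult_right_mono) auto
      finally show ?thesis .
    qed
    fix y :: 'a assume y: "y \<in> cball 0 R"
    define c c' where "c = coord x v" and "c' = coord y v"
    have "frame_map x (c - c') = frame_map y c' - frame_map x c'"
      by (simp add: linear_diff[OF linear_frame_map] c_def c'_def)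
    then have eq: "c - c' = coord x (frame_map y c' - frame_map x c')" using coord_frame_map[of x "c - c'"] by simp
    have "norm (c - c') \<le> norm (frame_map y c' - frame_map x c') / m" using co[OF x, of "frame_map y c' - frame_map x c'"] unfolding eq .
    also have "\<dots> \<le> (L * norm (y - x) * norm c') / m"
      using L(2)[OF y x] m(1) by (intro divide_right_mono) auto
    also have "\<dots> \<le> (L * norm (y - x) * (norm v / m)) / m"
      using co[OF y, of v] m(1) L(1) unfolding c'_def by (intro divide_right_mono mult_left_mono) auto
    finally have cc: "norm (c - c') \<le> L / (m * m) * norm (x - y) * norm v"
      by (simp add: norm_minus_commute)
    have "proj x v - proj y v = frame_map x (cut (c - c')) + (frame_map x (cut c') - frame_map y (cut c'))"
      unfolding proj_eq c_def c'_def by (simp add: linear_diff[OF linear_cut] linear_diff[OF linear_frame_map])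
    also have "norm \<dots> \<le> L * norm (cut (c - c')) + L * norm (x - y) * norm (cut c')"
      using L x y by (intro norm_triangle_le add_mono) auto
    also have "\<dots> \<le> L * (L / (m * m) * norm (x - y) * norm v) + L * norm (x - y) * (norm v / m)"
      using L cc norm_cut_le[of "c - c'"] cut_co[OF y, of v] unfolding c'_def
      by (intro add_mono mult_left_mono) auto
    also have "\<dots> = (L * (L / (m * m)) + L / m) * (norm (x - y) * norm v)" by (simp add: algebra_simps)
    also have "\<dots> \<le> C * (norm (x - y) * norm v)" using nn unfolding C_def by (intro mult_right_mono) auto
    finally show "norm (proj x v - proj y v) \<le> C * norm (x - y) * norm v" by (simp add: mult_ac)
  qed
qed

text \<open>The anisotropic box of size \<open>g\<close> around \<open>x\<close>: its width is \<open>g\<close> in the directions of \<open>V x\<close> and \<open>g\<^sup>2\<close> in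
  those of \<open>W x\<close>. Boxes are the sublevel sets of the gauge up to a factor \<open>2\<close>, and they avoid square
  roots.\<close>

definition in_box :: "'a \<Rightarrow> 'a \<Rightarrow> real \<Rightarrow> bool" where
  "in_box x y g \<longleftrightarrow> norm (proj x (y - x)) \<le> g \<and> norm (y - x - proj x (y - x)) \<le> g\<^sup>2"

lemma in_boxD:
  assumes "in_box x y g"
  shows "norm (proj x (y - x)) \<le> g" "norm (y - x - proj x (y - x)) \<le> g\<^sup>2" "0 \<le> g"
    "norm (y - x) \<le> g + g\<^sup>2"
proof -
  show 1: "norm (proj x (y - x)) \<le> g" and 2: "norm (y - x - proj x (y - x)) \<le> g\<^sup>2"
    using assms unfolding in_box_def by auto
  show "0 \<le> g" using order_trans[OF norm_ge_zero 1] .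
  show "norm (y - x) \<le> g + g\<^sup>2"
    using norm_triangle_ineq[of "proj x (y - x)" "y - x - proj x (y - x)"] 1 2 by simp
qed

end

section \<open>Flows and commutator loops\<close>

text \<open>Existence of an integral curve by Picard iteration. To work in the Banach space of all bounded
  continuous curves, the field is extended by \<open>closest_point\<close> to a globally Lipschitz field \<open>F\<close> and
  time is clamped to \<open>[0, T]\<close>. As \<open>T \<le> 1/2\<close>, the Picard operator is a contraction. The fixed point has
  speed at most one, so it stays in the ball, where \<open>F\<close> is the original field.\<close>

lemma picard_curve:
  fixes f :: "'a::euclidean_space \<Rightarrow> 'a"
  assumes bound: "\<And>p. p \<in> cball x 1 \<Longrightarrow> norm (f p) \<le> 1" and lip: "1-lipschitz_on (cball x 1) f"
    and T: "0 \<le> T" "T \<le> 1 / 2"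
  obtains \<gamma> where "1-lipschitz_on UNIV \<gamma>" "\<And>t. t \<le> 0 \<Longrightarrow> \<gamma> t = x" "\<And>t. T \<le> t \<Longrightarrow> \<gamma> t = \<gamma> T"
    "\<And>t. 0 < t \<Longrightarrow> t < T \<Longrightarrow> (\<gamma> has_vector_derivative f (\<gamma> t)) (at t)"
proof -
  define F where "F p = f (closest_point (cball x 1) p)" for p
  have in_ball: "closest_point (cball x 1) p \<in> cball x 1" for p
    by (rule closest_point_in_set) auto
  have F_bound: "norm (F p) \<le> 1" for p using bound[OF in_ball] by (simp add: F_def)
  have F_lip: "dist (F p) (F q) \<le> dist p q" for p q
  proof -
    have "dist (F p) (F q) \<le> 1 * dist (closest_point (cball x 1) p) (closest_point (cball x 1) q)"
      unfolding F_def using in_ball by (intro lipschitz_onD[OF lip])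
    also have "\<dots> \<le> dist p q"
      using closest_point_lipschitz[of "cball x 1" p q] by simp
    finally show ?thesis .
  qed
  have F_cont: "continuous_on UNIV F"
    using F_lip by (intro lipschitz_on_continuous_on[of 1] lipschitz_onI) auto
  have cont: "continuous_on S (\<lambda>s. F (apply_bcontfun u s))" for u :: "real \<Rightarrow>\<^sub>C 'a" and S
    by (rule continuous_on_compose2[OF F_cont]) auto
  define c where "c t = max 0 (min T t)" for t
  have c: "0 \<le> c t" "c t \<le> T" for t using T by (auto simp: c_def)
  define G where "G u r = integral {0..r} (\<lambda>s. F (apply_bcontfun u s))" for u :: "real \<Rightarrow>\<^sub>C 'a" and r
  have G_lip: "norm (G u s - G u r) \<le> s - r" if "0 \<le> r" "r \<le> s" for u r s
  proof -
    have "G u r + integral {r..s} (\<lambda>s. F (apply_bcontfun u s)) = G u s"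
      unfolding G_def using that
      by (intro Henstock_Kurzweil_Integration.integral_combine integrable_continuous_real cont) auto
    then have "norm (G u s - G u r) = norm (integral {r..s} (\<lambda>s. F (apply_bcontfun u s)))"
      by (metis add_diff_cancel_left')
    also have "\<dots> \<le> 1 * (s - r)"
      by (rule integral_bound) (use that cont F_bound in auto)
    finally show ?thesis by simp
  qed
  have curve_lip: "1-lipschitz_on UNIV (\<lambda>t. x + G u (c t))" for u
  proof (rule lipschitz_on_leI)
    fix s t :: real assume "s \<le> t"
    then have "c s \<le> c t" "c t - c s \<le> t - s" by (auto simp: c_def)
    then have "norm (G u (c t) - G u (c s)) \<le> t - s" using G_lip[of "c s" "c t" u] c by simp
    then show "dist (x + G u (c s)) (x + G u (c t)) \<le> 1 * dist s t"
      using \<open>s \<le> t\<close> by (simp add: dist_norm norm_minus_commute)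
  qed simp
  define \<Phi> where "\<Phi> u = Bcontfun (\<lambda>t. x + G u (c t))" for u
  have \<Phi>: "apply_bcontfun (\<Phi> u) t = x + G u (c t)" for u t
  proof -
    have "(\<lambda>t. x + G u (c t)) \<in> bcontfun"
    proof (rule bcontfun_normI)
      show "continuous_on UNIV (\<lambda>t. x + G u (c t))"
        using curve_lip lipschitz_on_continuous_on by blast
      fix t
      have "norm (G u (c t)) \<le> T" using G_lip[of 0 "c t" u] c[of t] by (simp add: G_def)
      then show "norm (x + G u (c t)) \<le> norm x + T"
        using norm_triangle_ineq[of x "G u (c t)"] by linarith
    qed
    then show ?thesis by (simp add: \<Phi>_def Bcontfun_inverse)
  qed
  have "\<forall>u w. dist (\<Phi> u) (\<Phi> w) \<le> 1 / 2 * dist u w"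
  proof (intro allI dist_bound)
    fix u w t
    have "dist (apply_bcontfun (\<Phi> u) t) (apply_bcontfun (\<Phi> w) t) = norm (G u (c t) - G w (c t))"
      by (simp add: \<Phi> dist_norm)
    also have "G u (c t) - G w (c t) =
        integral {0..c t} (\<lambda>s. F (apply_bcontfun u s) - F (apply_bcontfun w s))"
      unfolding G_def by (intro Henstock_Kurzweil_Integration.integral_diff[symmetric]
          integrable_continuous_real cont)
    also have "norm \<dots> \<le> dist u w * (c t - 0)"
    proof (rule integral_bound)
      show "norm (F (apply_bcontfun u s) - F (apply_bcontfun w s)) \<le> dist u w" for s
        using F_lip[of "apply_bcontfun u s" "apply_bcontfun w s"] dist_bounded[of u s w]
        by (simp add: dist_norm)
    qed (use c cont in \<open>auto intro!: continuous_intros\<close>)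
    also have "\<dots> \<le> dist u w * (1 / 2)"
      using c[of t] T by (intro mult_left_mono) auto
    finally show "dist (apply_bcontfun (\<Phi> u) t) (apply_bcontfun (\<Phi> w) t) \<le> 1 / 2 * dist u w" by simp
  qed
  then obtain u where u: "\<Phi> u = u"
    using banach_fix_type[of "1/2" \<Phi>] by auto
  define \<gamma> where "\<gamma> = apply_bcontfun u"
  have \<gamma>: "\<gamma> t = x + G u (c t)" for t using \<Phi>[of u t] u by (simp add: \<gamma>_def)
  have lip\<gamma>: "1-lipschitz_on UNIV \<gamma>" using curve_lip[of u] by (simp add: \<gamma>[abs_def])
  have start: "\<gamma> t = x" if "t \<le> 0" for t
    using that T by (simp add: \<gamma> c_def G_def)
  show thesis
  proof (rule that[OF lip\<gamma> start])
    show "\<gamma> t = \<gamma> T" if "T \<le> t" for t using that T by (simp add: \<gamma> c_def)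
    fix t assume t: "0 < t" "t < T"
    have "dist x (\<gamma> t) \<le> 1"
      using lipschitz_onD[OF lip\<gamma>, of 0 t] start[of 0] t T by (simp add: dist_real_def)
    then have f_eq: "F (\<gamma> t) = f (\<gamma> t)" by (simp add: F_def closest_point_self)
    have "(G u has_vector_derivative F (\<gamma> t)) (at t within {0..T})"
      unfolding G_def \<gamma>_def by (rule integral_has_vector_derivative) (use t cont in auto)
    then have "((\<lambda>t. x + G u t) has_vector_derivative f (\<gamma> t)) (at t within {0..T})"
      by (auto intro!: derivative_eq_intros simp: f_eq)
    then have "((\<lambda>t. x + G u t) has_vector_derivative f (\<gamma> t)) (at t)"
      using t at_within_interior[of t "{0..T}"] by simp
    then show "(\<gamma> has_vector_derivative f (\<gamma> t)) (at t)"
      by (rule has_vector_derivative_transform_within_open[of _ _ _ "{0<..<T}"])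
         (use t in \<open>auto simp: \<gamma> c_def\<close>)
  qed auto
qed

lemma norm_diff_le_of_derivative_bound:
  fixes h :: "real \<Rightarrow> 'a::euclidean_space"
  assumes "0 \<le> T" "continuous_on {0..T} h" "h 0 = 0"
    and "\<And>t. 0 < t \<Longrightarrow> t < T \<Longrightarrow> (h has_vector_derivative h' t) (at t)"
    and "\<And>t. 0 < t \<Longrightarrow> t < T \<Longrightarrow> norm (h' t) \<le> B"
  shows "norm (h T) \<le> B * T"
proof (cases "T = 0")
  case False
  have "norm (h T - h 0) \<le> B * T - B * 0"
    by (rule differentiable_bound_general[of 0 T h "\<lambda>t. B * t" h' "\<lambda>_. B"])
       (use assms False in \<open>auto intro!: continuous_intros derivative_eq_intros
          simp: has_vector_derivative_def\<close>)
  then show ?thesis using assms by simp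
qed (use assms in auto)

text \<open>Taylor expansion of the flow: the endpoint is \<open>x + T f(x)\<close> up to second order, and
  \<open>x + T f(x) + T\<^sup>2/2 f'(f(x))\<close> up to third order if \<open>f'\<close> is the derivative of \<open>f\<close> at \<open>x\<close>. The first
  part needs only Lipschitz continuity, and it is used with \<open>f' = 0\<close> for combinations of fields.\<close>

lemma flow_reach:
  fixes f :: "'a::euclidean_space \<Rightarrow> 'a"
  assumes bound: "\<And>p. p \<in> cball x 1 \<Longrightarrow> norm (f p) \<le> 1" and lip: "1-lipschitz_on (cball x 1) f"
    and T: "0 \<le> T" "T \<le> 1 / 2"
    and V: "\<And>p. p \<in> cball x 1 \<Longrightarrow> f p \<in> V p" "\<And>p. 0 \<in> V p"
    and f': "linear f'" "\<And>v. norm (f' v) \<le> norm v"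
  obtains y where "reach V x y T" "norm (y - x - T *\<^sub>R f x) \<le> T\<^sup>2"
    "(\<And>p. p \<in> cball x 1 \<Longrightarrow> norm (f p - f x - f' (p - x)) \<le> (norm (p - x))\<^sup>2) \<Longrightarrow>
      norm (y - x - T *\<^sub>R f x - (T\<^sup>2 / 2) *\<^sub>R f' (f x)) \<le> 2 * T ^ 3"
proof -
  obtain \<gamma> where \<gamma>: "1-lipschitz_on UNIV \<gamma>" "\<And>t. t \<le> 0 \<Longrightarrow> \<gamma> t = x" "\<And>t. T \<le> t \<Longrightarrow> \<gamma> t = \<gamma> T"
    "\<And>t. 0 < t \<Longrightarrow> t < T \<Longrightarrow> (\<gamma> has_vector_derivative f (\<gamma> t)) (at t)"
    using picard_curve[OF bound lip T] by blast
  have cont: "continuous_on S \<gamma>" for S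
    using lipschitz_on_continuous_on[OF \<gamma>(1)] continuous_on_subset by blast
  have near: "norm (\<gamma> t - x) \<le> t" if "0 \<le> t" for t
    using lipschitz_onD[OF \<gamma>(1), of t 0] \<gamma>(2)[of 0] that by (simp add: dist_norm)
  have in_ball: "\<gamma> t \<in> cball x 1" if "0 \<le> t" "t \<le> T" for t
    using near[of t] that T by (simp add: dist_norm norm_minus_commute)
  have slope: "norm (f (\<gamma> t) - f x) \<le> t" if "0 \<le> t" "t \<le> T" for t
    using lipschitz_onD[OF lip in_ball[OF that], of x] near[of t] that by (simp add: dist_norm)
  have first: "norm (\<gamma> s - x - s *\<^sub>R f x) \<le> s * s" if s: "0 \<le> s" "s \<le> T" for s
  proof (rule norm_diff_le_of_derivative_bound[OF s(1)])
    show "((\<lambda>s. \<gamma> s - x - s *\<^sub>R f x) has_vector_derivative f (\<gamma> t) - f x) (at t)" if "0 < t" "t < s" for t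
      using \<gamma>(4)[of t] that s by (auto intro!: derivative_eq_intros)
    show "norm (f (\<gamma> t) - f x) \<le> s" if "0 < t" "t < s" for t
      using slope[of t] that s by simp
  qed (use cont \<gamma>(2)[of 0] in \<open>auto intro!: continuous_intros\<close>)
  have f'_scale: "f' (t *\<^sub>R v) = t *\<^sub>R f' v" for t v using f' linear_scale by blast
  show thesis
  proof (rule that[of "\<gamma> T"])
    show "reach V x (\<gamma> T) T" unfolding reach_def
    proof (intro exI[of _ \<gamma>] exI[of _ "{0, T}"] conjI allI impI)
      fix t assume "t \<notin> {0, T}"
      then consider "t < 0" | "0 < t" "t < T" | "T < t" by fastforce
      then show "\<exists>v\<in>V (\<gamma> t). (\<gamma> has_vector_derivative v) (at t)"
      proof cases
        case 1
        have "(\<gamma> has_vector_derivative 0) (at t)"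
          by (rule has_vector_derivative_transform_within_open[OF has_vector_derivative_const, of "{..<0}" _ x])
             (use 1 \<gamma>(2) in auto)
        then show ?thesis using V by blast
      next
        case 2
        then show ?thesis using \<gamma>(4) V(1) in_ball by (meson less_imp_le)
      next
        case 3
        have "(\<gamma> has_vector_derivative 0) (at t)"
          by (rule has_vector_derivative_transform_within_open[OF has_vector_derivative_const, of "{T<..}" _ "\<gamma> T"])
             (use 3 \<gamma>(3)[OF less_imp_le] in auto)
        then show ?thesis using V by blast
      qed
    next
      show "1-lipschitz_on UNIV \<gamma>" by (fact \<gamma>(1))
      show "\<gamma> t = x" if "t \<le> 0" for t using \<gamma>(2) that .
      show "\<gamma> t = \<gamma> T" if "T \<le> t" for t using \<gamma>(3) that .
    qed simp
    show "norm (\<gamma> T - x - T *\<^sub>R f x) \<le> T\<^sup>2"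
      using first[of T] T by (simp add: power2_eq_square)
    assume quad: "\<And>p. p \<in> cball x 1 \<Longrightarrow> norm (f p - f x - f' (p - x)) \<le> (norm (p - x))\<^sup>2"
    define h where "h t = \<gamma> t - x - t *\<^sub>R f x - (t\<^sup>2 / 2) *\<^sub>R f' (f x)" for t
    define h' where "h' t = f (\<gamma> t) - f x - t *\<^sub>R f' (f x)" for t
    have "norm (h T) \<le> 2 * T\<^sup>2 * T"
    proof (rule norm_diff_le_of_derivative_bound[OF T(1)])
      show "continuous_on {0..T} h" unfolding h_def by (intro continuous_intros cont) auto
      show "h 0 = 0" using \<gamma>(2)[of 0] by (simp add: h_def)
      fix t assume t: "0 < t" "t < T"
      show "(h has_vector_derivative h' t) (at t)"
        unfolding h_def h'_def using \<gamma>(4)[OF t]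
        by (auto intro!: derivative_eq_intros)
      have "h' t = (f (\<gamma> t) - f x - f' (\<gamma> t - x)) + f' (\<gamma> t - x - t *\<^sub>R f x)"
        using linear_diff[OF f'(1), of "\<gamma> t - x" "t *\<^sub>R f x"] f'_scale by (simp add: h'_def)
      then have "norm (h' t) \<le> (norm (\<gamma> t - x))\<^sup>2 + norm (\<gamma> t - x - t *\<^sub>R f x)"
        using quad[OF in_ball, of t] f'(2)[of "\<gamma> t - x - t *\<^sub>R f x"] t
          norm_triangle_ineq[of "f (\<gamma> t) - f x - f' (\<gamma> t - x)" "f' (\<gamma> t - x - t *\<^sub>R f x)"]
        by simp
      also have "\<dots> \<le> t\<^sup>2 + t * t"
        using near[of t] first[of t] t by (intro add_mono power_mono) auto
      also have "\<dots> \<le> T\<^sup>2 + T\<^sup>2"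
        using t by (intro add_mono) (auto simp: power2_eq_square intro!: mult_mono)
      finally show "norm (h' t) \<le> 2 * T\<^sup>2" by simp
    qed
    then show "norm (\<gamma> T - x - T *\<^sub>R f x - (T\<^sup>2 / 2) *\<^sub>R f' (f x)) \<le> 2 * T ^ 3"
      by (simp add: h_def power3_eq_cube power2_eq_square)
  qed
qed

lemma tame_uminus: "tame M S f f' \<Longrightarrow> tame M S (\<lambda>p. - f p) (\<lambda>p v. - f' p v)"
proof -
  assume t: "tame M S f f'"
  have 1: "norm (f p - f q + f' p (q - p)) = norm (f q - f p - f' p (q - p))" for p q
  proof -
    have "f p - f q + f' p (q - p) = - (f q - f p - f' p (q - p))" by simp
    then show ?thesis by (simp only: norm_minus_cancel)
  qed
  have 2: "norm (f' p v - f' q v) = norm (f' q v - f' p v)" for p q v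
    by (rule norm_minus_commute)
  show ?thesis using t unfolding tame_def by (auto simp: 1 intro!: linear_compose_neg) (simp add: 2)
qed

text \<open>The flow from a point \<open>q\<close> near \<open>x\<close>, with all coefficients expressed at the fixed base point \<open>x\<close>. In
  a loop of four flows every step starts within \<open>3 T\<close> of \<open>x\<close>.\<close>

lemma flow_reach_expanded:
  fixes f :: "'a::euclidean_space \<Rightarrow> 'a"
  assumes tame: "tame 1 (cball x 2) f f'" and V: "\<And>p. p \<in> cball x 2 \<Longrightarrow> f p \<in> V p" "\<And>p. 0 \<in> V p"
    and T: "0 \<le> T" "T \<le> 1 / 8" and q: "norm (q - x) \<le> 3 * T"
  obtains p where "reach V q p T" 
    "norm (p - q - (T *\<^sub>R f x + T *\<^sub>R f' x (q - x) + (T\<^sup>2 / 2) *\<^sub>R f' x (f x))) \<le> 14 * T ^ 3"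
proof -
  have qx: "q \<in> cball x 2" "x \<in> cball x 2" "norm (q - x) \<le> 1"
    using q T by (auto simp: dist_norm norm_minus_commute)
  have sub: "cball q 1 \<subseteq> cball x 2"
    using qx(3) by (simp add: cball_subset_cball_iff dist_norm)
  note lip = tameD(1)[OF tame] and b = tameD(2)[OF tame] and lin = tameD(3)[OF tame]
    and b' = tameD(4)[OF tame, simplified] and lip' = tameD(5)[OF tame, simplified mult_1_left]
    and quad = tameD(6)[OF tame, simplified mult_1_left]
  obtain p where p: "reach V q p T"
    "norm (p - q - T *\<^sub>R f q - (T\<^sup>2 / 2) *\<^sub>R f' q (f q)) \<le> 2 * T ^ 3"
  proof (rule flow_reach[of q f T V "f' q"])
    show "1-lipschitz_on (cball q 1) f" using lip sub lipschitz_on_subset by blast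
  qed (use b sub T V lin b' qx quad in \<open>auto simp: subset_iff\<close>)
  \<comment> \<open>The error of the Taylor expansion at \<open>q\<close>, and the errors made by moving the first- and second-order coefficients from \<open>q\<close> to \<open>x\<close>.\<close>
  define r\<^sub>1 where "r\<^sub>1 = p - q - T *\<^sub>R f q - (T\<^sup>2 / 2) *\<^sub>R f' q (f q)"
  define r\<^sub>2 where "r\<^sub>2 = f q - f x - f' x (q - x)"
  define r\<^sub>3 where "r\<^sub>3 = (f' q (f q) - f' x (f q)) + f' x (f q - f x)"
  have r1: "norm r\<^sub>1 \<le> 2 * T ^ 3" using p by (simp add: r\<^sub>1_def)
  have "norm r\<^sub>2 \<le> (norm (q - x))\<^sup>2" using quad qx unfolding r\<^sub>2_def by blast
  also have "\<dots> \<le> (3 * T)\<^sup>2" using q by (intro power_mono) auto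
  finally have r2: "norm r\<^sub>2 \<le> 9 * T\<^sup>2" by (simp add: power_mult_distrib)
  have "norm r\<^sub>3 \<le> norm (q - x) * norm (f q) + norm (f q - f x)"
    unfolding r\<^sub>3_def using lip'[of x q "f q"] b'[of x "f q - f x"] qx
    by (intro norm_triangle_le add_mono) auto
  also have "\<dots> \<le> 3 * T * 1 + 1 * (3 * T)"
    using q b[OF qx(1)] T lipschitz_on_normD[OF lip qx(1,2)] by (intro add_mono mult_mono) auto
  finally have r3: "norm r\<^sub>3 \<le> 6 * T" by simp
  have "p - q - (T *\<^sub>R f x + T *\<^sub>R f' x (q - x) + (T\<^sup>2 / 2) *\<^sub>R f' x (f x))
      = r\<^sub>1 + T *\<^sub>R r\<^sub>2 + (T\<^sup>2 / 2) *\<^sub>R r\<^sub>3"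
    unfolding r\<^sub>1_def r\<^sub>2_def r\<^sub>3_def linear_diff[OF lin[OF qx(2)], of "f q" "f x"]
    by (simp add: algebra_simps)
  also have "norm \<dots> \<le> norm r\<^sub>1 + T * norm r\<^sub>2 + (T\<^sup>2 / 2) * norm r\<^sub>3"
    using T by (intro norm_triangle_le add_mono) auto
  also have "\<dots> \<le> 2 * T ^ 3 + T * (9 * T\<^sup>2) + (T\<^sup>2 / 2) * (6 * T)"
    using r1 r2 r3 T by (intro add_mono mult_left_mono) auto
  also have "\<dots> = 14 * T ^ 3" by (simp add: power3_eq_cube power2_eq_square)
  finally show thesis using that p(1) by blast
qed

text \<open>Follow \<open>f\<close>, \<open>g\<close>, \<open>-f\<close> and \<open>-g\<close>, each for time \<open>T\<close>. In the sum of the four expansions the first-order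
  terms cancel, the four terms of the form \<open>T\<^sup>2/2 f'(f)\<close> and \<open>T\<^sup>2/2 g'(g)\<close> cancel against the
  corrections for the moved starting points, and \<open>T\<^sup>2 (g'(f) - f'(g))\<close> remains, which is \<open>T\<^sup>2\<close> times
  the Lie bracket.\<close>

lemma commutator_reach:
  fixes f g :: "'a::euclidean_space \<Rightarrow> 'a"
  assumes f: "tame 1 (cball x 2) f f'" "\<And>p. p \<in> cball x 2 \<Longrightarrow> f p \<in> V p"
    and g: "tame 1 (cball x 2) g g'" "\<And>p. p \<in> cball x 2 \<Longrightarrow> g p \<in> V p"
    and V: "\<And>p. subspace (V p)" and T: "0 \<le> T" "T \<le> 1 / 8"
  obtains y where "reach V x y (4 * T)"
    "norm (y - x - T\<^sup>2 *\<^sub>R (g' x (f x) - f' x (g x))) \<le> 78 * T ^ 3"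
proof -
  define a b A B where "a = f x" and "b = g x" and "A = f' x" and "B = g' x"
  have ab: "norm a \<le> 1" "norm b \<le> 1" "linear A" "linear B"
    and A: "\<And>v. norm (A v) \<le> norm v" and B: "\<And>v. norm (B v) \<le> norm v"
    using f g unfolding tame_def a_def b_def A_def B_def by auto
  have zero: "0 \<in> V p" for p using V subspace_0 by blast
  have neg: "- f p \<in> V p" "- g p \<in> V p" if "p \<in> cball x 2" for p
    using f(2) g(2) V that subspace_neg by blast+
  note stepf = flow_reach_expanded[of x f f' V, OF f zero T]
  note stepg = flow_reach_expanded[of x g g' V, OF g zero T]
  note stepf' = flow_reach_expanded[OF tame_uminus[OF f(1)], of V, OF neg(1) zero T]
  note stepg' = flow_reach_expanded[OF tame_uminus[OF g(1)], of V, OF neg(2) zero T]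
  have A_diff: "A (v - w) = A v - A w" and B_diff: "B (v - w) = B v - B w" for v w
    using ab linear_diff by blast+
  have A_add: "A (v + w) = A v + A w" and B_add: "B (v + w) = B v + B w" for v w
    using ab linear_add by blast+
  have A_scale: "A (c *\<^sub>R v) = c *\<^sub>R A v" and B_scale: "B (c *\<^sub>R v) = c *\<^sub>R B v" for v c
    using ab linear_scale by blast+
  have A_minus: "A (- v) = - A v" and B_minus: "B (- v) = - B v" for v
    using ab linear_neg by blast+
  obtain p\<^sub>1 where p1: "reach V x p\<^sub>1 T"
    "norm (p\<^sub>1 - x - (T *\<^sub>R a + T *\<^sub>R A (x - x) + (T\<^sup>2 / 2) *\<^sub>R A a)) \<le> 14 * T ^ 3"
    unfolding a_def A_def using stepf[of x] T by auto
  have d1: "norm (p\<^sub>1 - x) \<le> T" using reach_dist[OF p1(1)] T by (simp add: dist_norm norm_minus_commute)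
  obtain p\<^sub>2 where p2: "reach V p\<^sub>1 p\<^sub>2 T"
    "norm (p\<^sub>2 - p\<^sub>1 - (T *\<^sub>R b + T *\<^sub>R B (p\<^sub>1 - x) + (T\<^sup>2 / 2) *\<^sub>R B b)) \<le> 14 * T ^ 3"
    unfolding b_def B_def using stepg[of p\<^sub>1] T d1 by auto
  have d2: "norm (p\<^sub>2 - x) \<le> 2 * T"
    using reach_dist[OF p2(1)] T d1 norm_triangle_ineq[of "p\<^sub>2 - p\<^sub>1" "p\<^sub>1 - x"]
    by (simp add: dist_norm norm_minus_commute)
  obtain p\<^sub>3 where p3: "reach V p\<^sub>2 p\<^sub>3 T"
    "norm (p\<^sub>3 - p\<^sub>2 - (T *\<^sub>R (- a) + T *\<^sub>R (- A (p\<^sub>2 - x)) + (T\<^sup>2 / 2) *\<^sub>R (- A (- a)))) \<le> 14 * T ^ 3"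
    unfolding a_def A_def using stepf'[of p\<^sub>2] T d2 by auto
  have d3: "norm (p\<^sub>3 - x) \<le> 3 * T"
    using reach_dist[OF p3(1)] T d2 norm_triangle_ineq[of "p\<^sub>3 - p\<^sub>2" "p\<^sub>2 - x"]
    by (simp add: dist_norm norm_minus_commute)
  obtain p\<^sub>4 where p4: "reach V p\<^sub>3 p\<^sub>4 T"
    "norm (p\<^sub>4 - p\<^sub>3 - (T *\<^sub>R (- b) + T *\<^sub>R (- B (p\<^sub>3 - x)) + (T\<^sup>2 / 2) *\<^sub>R (- B (- b)))) \<le> 14 * T ^ 3"
    unfolding b_def B_def using stepg'[of p\<^sub>3] T d3 by auto
  define e\<^sub>1 e\<^sub>2 e\<^sub>3 e\<^sub>4 where
    "e\<^sub>1 = p\<^sub>1 - x - (T *\<^sub>R a + T *\<^sub>R A (x - x) + (T\<^sup>2 / 2) *\<^sub>R A a)" and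
    "e\<^sub>2 = p\<^sub>2 - p\<^sub>1 - (T *\<^sub>R b + T *\<^sub>R B (p\<^sub>1 - x) + (T\<^sup>2 / 2) *\<^sub>R B b)" and
    "e\<^sub>3 = p\<^sub>3 - p\<^sub>2 - (T *\<^sub>R (- a) + T *\<^sub>R (- A (p\<^sub>2 - x)) + (T\<^sup>2 / 2) *\<^sub>R (- A (- a)))" and
    "e\<^sub>4 = p\<^sub>4 - p\<^sub>3 - (T *\<^sub>R (- b) + T *\<^sub>R (- B (p\<^sub>3 - x)) + (T\<^sup>2 / 2) *\<^sub>R (- B (- b)))"
  have e: "norm e\<^sub>1 \<le> 14 * T ^ 3" "norm e\<^sub>2 \<le> 14 * T ^ 3" "norm e\<^sub>3 \<le> 14 * T ^ 3" "norm e\<^sub>4 \<le> 14 * T ^ 3"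
    using p1 p2 p3 p4 by (auto simp: e\<^sub>1_def e\<^sub>2_def e\<^sub>3_def e\<^sub>4_def)
  have small: "14 * T ^ 3 \<le> 7 / 4 * T\<^sup>2"
    using T mult_right_mono[of "14 * T" "7/4" "T\<^sup>2"] by (simp add: power3_eq_cube power2_eq_square)
  \<comment> \<open>Deviations of the intermediate points from their first-order positions; they are of second order.\<close>
  define s\<^sub>1 s\<^sub>2 s\<^sub>3 where "s\<^sub>1 = p\<^sub>1 - x - T *\<^sub>R a" and "s\<^sub>2 = p\<^sub>2 - x - T *\<^sub>R (a + b)"
    and "s\<^sub>3 = p\<^sub>3 - x - T *\<^sub>R b"
  have T2: "0 \<le> T\<^sup>2" by simp
  have Aa: "norm (A a) \<le> 1" and Bb: "norm (B b) \<le> 1" using A[of a] B[of b] ab by auto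
  have half: "norm ((T\<^sup>2 / 2) *\<^sub>R A a) \<le> T\<^sup>2 / 2" "norm ((T\<^sup>2 / 2) *\<^sub>R B b) \<le> T\<^sup>2 / 2"
    using mult_left_mono[OF Aa T2] mult_left_mono[OF Bb T2] by auto
  have s1_eq: "s\<^sub>1 = (T\<^sup>2 / 2) *\<^sub>R A a + e\<^sub>1"
    using ab linear_0 by (auto simp: s\<^sub>1_def e\<^sub>1_def algebra_simps)
  have s1: "norm s\<^sub>1 \<le> 3 * T\<^sup>2"
    unfolding s1_eq using half(1) e(1) small T2 norm_triangle_ineq[of "(T\<^sup>2 / 2) *\<^sub>R A a" e\<^sub>1] by linarith
  have TB: "norm (T *\<^sub>R B (p\<^sub>1 - x)) \<le> T\<^sup>2"
    using mult_left_mono[of "norm (B (p\<^sub>1 - x))" T T] B[of "p\<^sub>1 - x"] d1 T by (simp add: power2_eq_square)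
  have TA: "norm (T *\<^sub>R A (p\<^sub>2 - x)) \<le> 2 * T\<^sup>2"
    using mult_left_mono[of "norm (A (p\<^sub>2 - x))" "2 * T" T] A[of "p\<^sub>2 - x"] d2 T by (simp add: power2_eq_square)
  have s2_eq: "s\<^sub>2 = s\<^sub>1 + T *\<^sub>R B (p\<^sub>1 - x) + (T\<^sup>2 / 2) *\<^sub>R B b + e\<^sub>2"
    by (simp add: s\<^sub>1_def s\<^sub>2_def e\<^sub>2_def algebra_simps)
  have s2: "norm s\<^sub>2 \<le> 7 * T\<^sup>2"
    unfolding s2_eq using s1 TB half(2) e(2) small T2 norm_triangle_ineq[of "s\<^sub>1 + T *\<^sub>R B (p\<^sub>1 - x) + (T\<^sup>2 / 2) *\<^sub>R B b" e\<^sub>2]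
      norm_triangle_ineq[of "s\<^sub>1 + T *\<^sub>R B (p\<^sub>1 - x)" "(T\<^sup>2 / 2) *\<^sub>R B b"]
      norm_triangle_ineq[of s\<^sub>1 "T *\<^sub>R B (p\<^sub>1 - x)"] by linarith
  have s3_eq: "s\<^sub>3 = s\<^sub>2 - T *\<^sub>R A (p\<^sub>2 - x) + (T\<^sup>2 / 2) *\<^sub>R A a + e\<^sub>3"
    by (simp add: s\<^sub>3_def s\<^sub>2_def e\<^sub>3_def A_minus algebra_simps)
  have s3: "norm s\<^sub>3 \<le> 12 * T\<^sup>2"
    unfolding s3_eq using s2 TA half(1) e(3) small T2 norm_triangle_ineq[of "s\<^sub>2 - T *\<^sub>R A (p\<^sub>2 - x) + (T\<^sup>2 / 2) *\<^sub>R A a" e\<^sub>3]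
      norm_triangle_ineq[of "s\<^sub>2 - T *\<^sub>R A (p\<^sub>2 - x)" "(T\<^sup>2 / 2) *\<^sub>R A a"]
      norm_triangle_ineq4[of s\<^sub>2 "T *\<^sub>R A (p\<^sub>2 - x)"] by linarith
  \<comment> \<open>The total error: the four single errors, and the effect of the second-order deviations \<open>s\<^sub>1\<close>, \<open>s\<^sub>2\<close>, \<open>s\<^sub>3\<close> on the terms linear in the starting point.\<close>
  define E where "E = (e\<^sub>1 + e\<^sub>2 + e\<^sub>3 + e\<^sub>4) + T *\<^sub>R (B s\<^sub>1 - A s\<^sub>2 - B s\<^sub>3)"
  have "p\<^sub>4 - x - T\<^sup>2 *\<^sub>R (B a - A b) = E"
  proof -
    have "B s\<^sub>1 = B (p\<^sub>1 - x) - T *\<^sub>R B a" "A s\<^sub>2 = A (p\<^sub>2 - x) - T *\<^sub>R A a - T *\<^sub>R A b"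
      "B s\<^sub>3 = B (p\<^sub>3 - x) - T *\<^sub>R B b"
      unfolding s\<^sub>1_def s\<^sub>2_def s\<^sub>3_def
      by (simp_all add: A_diff B_diff A_scale B_scale A_add B_add algebra_simps)
    then have "E = (e\<^sub>1 + e\<^sub>2 + e\<^sub>3 + e\<^sub>4) + T *\<^sub>R (B (p\<^sub>1 - x) - T *\<^sub>R B a - (A (p\<^sub>2 - x) - T *\<^sub>R A a - T *\<^sub>R A b)
        - (B (p\<^sub>3 - x) - T *\<^sub>R B b))" by (simp add: E_def)
    moreover have "A (x - x) = 0" using ab linear_0 by simp
    ultimately show ?thesis
      by (simp add: e\<^sub>1_def e\<^sub>2_def e\<^sub>3_def e\<^sub>4_def A_minus B_minus algebra_simps power2_eq_square
          flip: scaleR_left.add)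
  qed
  moreover have "norm E \<le> 78 * T ^ 3"
  proof -
    have "norm (B s\<^sub>1 - A s\<^sub>2 - B s\<^sub>3) \<le> 22 * T\<^sup>2"
      using norm_triangle_ineq4[of "B s\<^sub>1 - A s\<^sub>2" "B s\<^sub>3"] norm_triangle_ineq4[of "B s\<^sub>1" "A s\<^sub>2"]
        B[of s\<^sub>1] A[of s\<^sub>2] B[of s\<^sub>3] s1 s2 s3 by linarith
    then have "norm (T *\<^sub>R (B s\<^sub>1 - A s\<^sub>2 - B s\<^sub>3)) \<le> 22 * T ^ 3"
      using mult_left_mono[OF _ T(1), of "norm (B s\<^sub>1 - A s\<^sub>2 - B s\<^sub>3)" "22 * T\<^sup>2"] T
      by (simp add: power3_eq_cube power2_eq_square mult_ac)
    moreover have "norm (e\<^sub>1 + e\<^sub>2 + e\<^sub>3 + e\<^sub>4) \<le> 56 * T ^ 3"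
      using e norm_triangle_ineq[of "e\<^sub>1 + e\<^sub>2 + e\<^sub>3" e\<^sub>4] norm_triangle_ineq[of "e\<^sub>1 + e\<^sub>2" e\<^sub>3]
        norm_triangle_ineq[of e\<^sub>1 e\<^sub>2] by linarith
    ultimately show ?thesis unfolding E_def
      using norm_triangle_ineq[of "e\<^sub>1 + e\<^sub>2 + e\<^sub>3 + e\<^sub>4" "T *\<^sub>R (B s\<^sub>1 - A s\<^sub>2 - B s\<^sub>3)"] by linarith
  qed
  moreover have "reach V x p\<^sub>4 (4 * T)"
  proof -
    have "reach V x p\<^sub>4 (((T + T) + T) + T)"
      using p1(1) p2(1) p3(1) p4(1) T by (intro reach_trans[of V x]) auto
    then show ?thesis by (simp add: algebra_simps)
  qed
  ultimately show thesis using that unfolding a_def b_def A_def B_def by metis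
qed

section \<open>The Carnot-Caratheodory distance\<close>

text \<open>The mean value inequality for horizontal curves. With \<open>T\<close> the identity it says that chords are not
  longer than the curve; with \<open>T\<close> the projection onto \<open>W x\<close> it will give the quadratic gain.\<close>

lemma horizontal_linear_bound:
  fixes \<gamma> :: "real \<Rightarrow> 'a::euclidean_space" and T :: "'a \<Rightarrow> 'a"
  assumes T: "linear T" and K: "0 \<le> K" and N: "negligible N"
    and bound: "\<And>t. t \<in> {0..1} - N \<Longrightarrow> norm (T (g t)) \<le> K * norm (g t)"
    and len: "((\<lambda>t. norm (g t)) has_integral l) {0..1}"
    and int: "(g has_integral \<gamma> b - \<gamma> a) {a..b}" and ab: "0 \<le> a" "b \<le> 1"
  shows "norm (T (\<gamma> b - \<gamma> a)) \<le> K * l"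
proof -
  define g0 where "g0 t = (if t \<in> N then 0 else g t)" for t
  have g0: "g0 t = g t" if "t \<in> S - N" for t S using that by (simp add: g0_def)
  have T0: "T 0 = 0" using T linear_0 by blast
  have int0: "(g0 has_integral \<gamma> b - \<gamma> a) {a..b}" by (rule has_integral_spike[OF N g0 int])
  have len0: "((\<lambda>t. norm (g0 t)) has_integral l) {0..1}"
    by (rule has_integral_spike[OF N _ len]) (simp add: g0_def)
  have T_int: "((\<lambda>t. T (g0 t)) has_integral T (\<gamma> b - \<gamma> a)) {a..b}"
    using has_integral_linear[OF int0, of T] T by (simp add: o_def linear_conv_bounded_linear)
  have sub: "{a..b} \<subseteq> {0..1}" using ab by auto
  have norm_int: "(\<lambda>t. norm (g0 t)) integrable_on {a..b}"
    using len0 sub by (meson has_integral_integrable integrable_on_subinterval)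
  have le: "norm (T (g0 t)) \<le> K * norm (g0 t)" if "t \<in> {a..b}" for t
    using bound[of t] that ab by (auto simp: g0_def T0)
  have "norm (T (\<gamma> b - \<gamma> a)) = norm (integral {a..b} (\<lambda>t. T (g0 t)))"
    using T_int by (simp add: integral_unique)
  also have "\<dots> \<le> integral {a..b} (\<lambda>t. K * norm (g0 t))"
    using T_int norm_int le
    by (intro integral_norm_bound_integral integrable_on_mult_right) (auto intro: has_integral_integrable)
  also have "\<dots> = K * integral {a..b} (\<lambda>t. norm (g0 t))" by simp
  also have "\<dots> \<le> K * integral {0..1} (\<lambda>t. norm (g0 t))"
    using K len0 norm_int sub
    by (intro mult_left_mono integral_subset_le) (auto intro: has_integral_integrable)
  also have "\<dots> = K * l" using len0 by (simp add: integral_unique)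
  finally show ?thesis .
qed

lemma has_integral_affine_unit:
  fixes f :: "real \<Rightarrow> real"
  assumes f: "(f has_integral l) {0..1}" and m: "m \<noteq> 0"
    and im: "(\<lambda>t. m * t + c) ` S = {0..1}"
  shows "((\<lambda>t. \<bar>m\<bar> * f (m * t + c)) has_integral l) S"
proof -
  have inv: "(1 / m) *\<^sub>R (m * t + c) + - ((1 / m) *\<^sub>R c) = t" for t
    using m by (simp add: field_simps)
  have "(\<lambda>x. (1 / m) *\<^sub>R x + - ((1 / m) *\<^sub>R c)) ` cbox 0 1 = S"
    unfolding cbox_interval im[symmetric] image_image inv by (rule image_ident)
  then have "((\<lambda>x. f (m *\<^sub>R x + c)) has_integral (1 / \<bar>m\<bar>) *\<^sub>R l) S"
    using has_integral_affinity[of f l 0 1 m c] f m by (simp only: cbox_interval DIM_real power_one_right simp_thms)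
  from has_integral_mult_right[OF this, of "\<bar>m\<bar>"] show ?thesis using m by simp
qed

lemma horizontal_reverse:
  assumes hor: "horizontal V \<gamma>" and fin: "curve_length \<gamma> < \<infinity>" and sub: "\<And>p. subspace (V p)"
  shows "horizontal V (\<lambda>t. \<gamma> (1 - t)) \<and> curve_length (\<lambda>t. \<gamma> (1 - t)) = curve_length \<gamma>"
proof -
  obtain N g l where vel: "has_velocity V \<gamma> N g l"
    using horizontal_has_velocity[OF hor fin] by blast
  note N = has_velocityD(1-3)[OF vel] and g = has_velocityD(4,5)[OF vel] and l = has_velocityD(6)[OF vel]
    and int = has_velocityD(7)[OF vel]
  define N' where "N' = {t. -1 * t + 1 \<in> N}"
  have N': "negligible N'" unfolding N'_def using N(1) by (intro negligible_affine_vimage) auto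
  have im: "(\<lambda>t. -1 * t + 1) ` {0..1} = {0..1::real}"
    by (auto simp: image_iff intro!: bexI[of _ "1 - _"])
  have der: "- g (1 - t) \<in> V (\<gamma> (1 - t)) \<and>
      ((\<lambda>t. \<gamma> (1 - t)) has_vector_derivative - g (1 - t)) (at t within {0..1})"
    if t: "t \<in> {0..1} - N'" for t
  proof
    have t': "1 - t \<in> {0..1} - N" using t by (auto simp: N'_def)
    show "- g (1 - t) \<in> V (\<gamma> (1 - t))" using g[OF t'] sub by (blast intro: subspace_neg)
    show "((\<lambda>t. \<gamma> (1 - t)) has_vector_derivative - g (1 - t)) (at t within {0..1})"
      using has_vector_derivative_affine[of \<gamma> "g (1 - t)" "-1" t 1 "{0..1}"] g[OF t'] im by simp
  qed
  have "horizontal V (\<lambda>t. \<gamma> (1 - t))"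
    unfolding horizontal_iff_negligible
    using abs_continuous_on01_reverse hor der N' unfolding horizontal_def by blast
  moreover have "curve_length (\<lambda>t. \<gamma> (1 - t)) = ennreal l"
  proof (rule curve_length_eqI[OF _ _ N'])
    show "((\<lambda>t. norm (g (1 - t))) has_integral l) {0..1}"
      using has_integral_affine_unit[OF l _ im] by simp
    fix t assume t: "t \<in> {0..1} - N'"
    have "vector_derivative (\<lambda>t. \<gamma> (1 - t)) (at t within {0..1}) = - g (1 - t)"
      using der[OF t] t by (intro vector_derivative_within_closed_interval) auto
    then show "norm (vector_derivative (\<lambda>t. \<gamma> (1 - t)) (at t within {0..1})) = norm (g (1 - t))" by simp
  qed simp
  ultimately show ?thesis using N by simp
qed

lemma cc_dist_lessE:
  assumes "cc_dist V x y < c"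
  obtains \<gamma> where "horizontal V \<gamma>" "\<gamma> 0 = x" "\<gamma> 1 = y" "curve_length \<gamma> < c"
  using assms unfolding cc_dist_def INF_less_iff by blast

lemma cc_dist_le:
  "horizontal V \<gamma> \<Longrightarrow> \<gamma> 0 = x \<Longrightarrow> \<gamma> 1 = y \<Longrightarrow> cc_dist V x y \<le> curve_length \<gamma>"
  unfolding cc_dist_def by (intro INF_lower) auto

lemma cc_dist_sym_le:
  assumes "\<And>p. subspace (V p)"
  shows "cc_dist V y x \<le> cc_dist V x y"
proof (rule ccontr)
  assume "\<not> cc_dist V y x \<le> cc_dist V x y"
  then have "cc_dist V x y < cc_dist V y x" by simp
  then obtain \<gamma> where \<gamma>: "horizontal V \<gamma>" "\<gamma> 0 = x" "\<gamma> 1 = y" "curve_length \<gamma> < cc_dist V y x"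
    by (rule cc_dist_lessE)
  then have fin: "curve_length \<gamma> < \<infinity>" by (metis infinity_ennreal_def less_le_trans top_greatest)
  have "cc_dist V y x \<le> curve_length \<gamma>"
    using cc_dist_le[of V "\<lambda>t. \<gamma> (1 - t)" y x] horizontal_reverse[OF \<gamma>(1) fin assms] \<gamma> by simp
  then show False using \<gamma>(4) by simp
qed

lemma cc_dist_sym: "(\<And>p. subspace (V p)) \<Longrightarrow> cc_dist V x y = cc_dist V y x"
  by (intro antisym cc_dist_sym_le)

text \<open>The formula for \<open>\<gamma>\<close> is a sum of two monotone reparametrizations, so that absolute continuity
  follows from the closure properties and no interval has to be split at \<open>1/2\<close>.\<close>

lemma horizontal_concat:
  fixes \<gamma>\<^sub>1 \<gamma>\<^sub>2 :: "real \<Rightarrow> 'a::euclidean_space"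
  assumes hor1: "horizontal V \<gamma>\<^sub>1" and fin1: "curve_length \<gamma>\<^sub>1 < \<infinity>"
    and hor2: "horizontal V \<gamma>\<^sub>2" and fin2: "curve_length \<gamma>\<^sub>2 < \<infinity>"
    and join: "\<gamma>\<^sub>1 1 = \<gamma>\<^sub>2 0" and sub: "\<And>p. subspace (V p)"
  shows "\<exists>\<gamma>. horizontal V \<gamma> \<and> \<gamma> 0 = \<gamma>\<^sub>1 0 \<and> \<gamma> 1 = \<gamma>\<^sub>2 1 \<and> curve_length \<gamma> = curve_length \<gamma>\<^sub>1 + curve_length \<gamma>\<^sub>2"
proof -
  obtain N\<^sub>1 g\<^sub>1 l\<^sub>1 where vel\<^sub>1: "has_velocity V \<gamma>\<^sub>1 N\<^sub>1 g\<^sub>1 l\<^sub>1"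
    using horizontal_has_velocity[OF hor1 fin1] by blast
  note 1 = has_velocityD(1-3)[OF vel\<^sub>1] and g1 = has_velocityD(4,5)[OF vel\<^sub>1] and l1 = has_velocityD(6)[OF vel\<^sub>1]
  obtain N\<^sub>2 g\<^sub>2 l\<^sub>2 where vel\<^sub>2: "has_velocity V \<gamma>\<^sub>2 N\<^sub>2 g\<^sub>2 l\<^sub>2"
    using horizontal_has_velocity[OF hor2 fin2] by blast
  note 2 = has_velocityD(1-3)[OF vel\<^sub>2] and g2 = has_velocityD(4,5)[OF vel\<^sub>2] and l2 = has_velocityD(6)[OF vel\<^sub>2]
  define \<gamma> where "\<gamma> t = (\<gamma>\<^sub>1 (min 1 (2 * t)) + \<gamma>\<^sub>2 (max 0 (2 * t - 1))) + - \<gamma>\<^sub>2 0" for t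
  have left: "\<gamma> t = \<gamma>\<^sub>1 (2 * t + 0)" if "t \<le> 1 / 2" for t using that by (simp add: \<gamma>_def)
  have right: "\<gamma> t = \<gamma>\<^sub>2 (2 * t + -1)" if "1 / 2 \<le> t" for t using that join by (simp add: \<gamma>_def)
  have ac: "abs_continuous_on01 \<gamma>"
  proof -
    have "abs_continuous_on01 \<gamma>\<^sub>1" "abs_continuous_on01 \<gamma>\<^sub>2"
      using hor1 hor2 by (simp_all add: horizontal_def)
    moreover have "2-lipschitz_on {0..1} (\<lambda>t. min 1 (2 * t :: real))" "2-lipschitz_on {0..1} (\<lambda>t. max 0 (2 * t - 1 :: real))"
      by (rule lipschitz_onI; auto simp: dist_real_def min_def max_def abs_if)+
    moreover have "mono_on {0..1} (\<lambda>t. min 1 (2 * t :: real))" "mono_on {0..1} (\<lambda>t. max 0 (2 * t - 1 :: real))"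
      by (auto simp: mono_on_def)
    moreover have "(\<lambda>t. min 1 (2 * t :: real)) ` {0..1} \<subseteq> {0..1}" "(\<lambda>t. max 0 (2 * t - 1 :: real)) ` {0..1} \<subseteq> {0..1}"
      by auto
    ultimately have "abs_continuous_on01 (\<lambda>t. \<gamma>\<^sub>1 (min 1 (2 * t)))" "abs_continuous_on01 (\<lambda>t. \<gamma>\<^sub>2 (max 0 (2 * t - 1)))"
      using abs_continuous_on01_compose_mono[of \<gamma>\<^sub>1 2 "\<lambda>t. min 1 (2 * t)"]
        abs_continuous_on01_compose_mono[of \<gamma>\<^sub>2 2 "\<lambda>t. max 0 (2 * t - 1)"] by simp_all
    from abs_continuous_on01_add[OF this]
    show ?thesis unfolding \<gamma>_def
      by (rule abs_continuous_on01_add[OF _ abs_continuous_on01_lipschitz[OF lipschitz_on_constant]])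
  qed
  define N where "N = {t. 2 * t + 0 \<in> N\<^sub>1} \<union> {t. 2 * t + -1 \<in> N\<^sub>2} \<union> {1/2}"
  have N: "negligible N"
    unfolding N_def using 1(1) 2(1) by (intro negligible_Un negligible_affine_vimage) auto
  define g where "g t = (if t < 1 / 2 then 2 *\<^sub>R g\<^sub>1 (2 * t + 0) else 2 *\<^sub>R g\<^sub>2 (2 * t + -1))" for t :: real
  have im1: "(\<lambda>t. 2 * t + 0) ` {0..1/2} = {0..1::real}"
  proof (intro equalityI subsetI)
    fix s :: real assume "s \<in> {0..1}"
    then show "s \<in> (\<lambda>t. 2 * t + 0) ` {0..1/2}" by (intro image_eqI[of _ _ "s / 2"]) auto
  qed auto
  have im2: "(\<lambda>t. 2 * t + -1) ` {1/2..1} = {0..1::real}"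
  proof (intro equalityI subsetI)
    fix s :: real assume "s \<in> {0..1}"
    then show "s \<in> (\<lambda>t. 2 * t + -1) ` {1/2..1}" by (intro image_eqI[of _ _ "(s + 1) / 2"]) (auto simp: field_simps)
  qed auto
  have der: "g t \<in> V (\<gamma> t) \<and> (\<gamma> has_vector_derivative g t) (at t within {0..1})"
    if t: "t \<in> {0..1} - N" for t
  proof -
    have "t \<noteq> 1 / 2" using t by (auto simp: N_def)
    then consider "t < 1 / 2" | "t > 1 / 2" by linarith
    then show ?thesis
    proof cases
      case 1
      have t': "2 * t + 0 \<in> {0..1} - N\<^sub>1" using t 1 by (auto simp: N_def)
      have "((\<lambda>t. \<gamma>\<^sub>1 (2 * t + 0)) has_vector_derivative 2 *\<^sub>R g\<^sub>1 (2 * t + 0)) (at t within {0..1/2})"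
        using g1[OF t'] by (intro has_vector_derivative_affine) (simp only: im1)
      then have "(\<gamma> has_vector_derivative 2 *\<^sub>R g\<^sub>1 (2 * t + 0)) (at t within {0..1/2})"
        by (rule has_vector_derivative_transform[rotated 2]) (use t 1 in \<open>auto simp: left\<close>)
      then have "(\<gamma> has_vector_derivative g t) (at t within {0..1/2})" using 1 by (simp add: g_def)
      moreover have "at t within {0..1/2} = at t within {0..1}"
        by (rule at_within_nhd[of _ "{..<1/2}"]) (use 1 in auto)
      moreover have "g t \<in> V (\<gamma> t)"
        using g1[OF t'] 1 sub by (auto simp: g_def left intro: subspace_scale)
      ultimately show ?thesis by simp
    next
      case 2
      have t': "2 * t + -1 \<in> {0..1} - N\<^sub>2" using t 2 by (auto simp: N_def)
      have "((\<lambda>t. \<gamma>\<^sub>2 (2 * t + -1)) has_vector_derivative 2 *\<^sub>R g\<^sub>2 (2 * t + -1)) (at t within {1/2..1})"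
        using g2[OF t'] by (intro has_vector_derivative_affine) (simp only: im2)
      then have "(\<gamma> has_vector_derivative 2 *\<^sub>R g\<^sub>2 (2 * t + -1)) (at t within {1/2..1})"
        by (rule has_vector_derivative_transform[rotated 2]) (use t 2 in \<open>auto simp: right\<close>)
      then have "(\<gamma> has_vector_derivative g t) (at t within {1/2..1})" using 2 by (simp add: g_def)
      moreover have "at t within {1/2..1} = at t within {0..1}"
        by (rule at_within_nhd[of _ "{1/2<..}"]) (use 2 in auto)
      moreover have "g t \<in> V (\<gamma> t)"
        using g2[OF t'] 2 sub by (auto simp: g_def right intro: subspace_scale)
      ultimately show ?thesis by simp
    qed
  qed
  have "horizontal V \<gamma>"
    unfolding horizontal_iff_negligible using ac N der by blast
  moreover have "curve_length \<gamma> = ennreal (l\<^sub>1 + l\<^sub>2)"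
  proof (rule curve_length_eqI[OF _ _ N])
    have "((\<lambda>t. \<bar>2\<bar> * norm (g\<^sub>1 (2 * t + 0))) has_integral l\<^sub>1) {0..1/2}"
      by (rule has_integral_affine_unit[OF l1 _ im1]) simp
    then have "((\<lambda>t. norm (g t)) has_integral l\<^sub>1) {0..1/2}"
      by (rule has_integral_spike[of "{1/2}", rotated 2]) (auto simp: g_def)
    moreover have "((\<lambda>t. \<bar>2\<bar> * norm (g\<^sub>2 (2 * t + -1))) has_integral l\<^sub>2) {1/2..1}"
      by (rule has_integral_affine_unit[OF l2 _ im2]) simp
    then have "((\<lambda>t. norm (g t)) has_integral l\<^sub>2) {1/2..1}"
      by (rule has_integral_spike[of "{1/2}", rotated 2]) (auto simp: g_def)
    ultimately show "((\<lambda>t. norm (g t)) has_integral l\<^sub>1 + l\<^sub>2) {0..1}"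
      by (intro has_integral_combine[of 0 "1/2" 1]) auto
    show "norm (vector_derivative \<gamma> (at t within {0..1})) = norm (g t)" if "t \<in> {0..1} - N" for t
      using der[OF that] that vector_derivative_within_closed_interval[of 0 1 t \<gamma> "g t"] by auto
  qed simp
  moreover have "\<gamma> 0 = \<gamma>\<^sub>1 0" "\<gamma> 1 = \<gamma>\<^sub>2 1" using left[of 0] right[of 1] by simp_all
  ultimately show ?thesis using 1 2 by (metis ennreal_plus)
qed

lemma cc_dist_triangle:
  assumes sub: "\<And>p. subspace (V p)"
  shows "cc_dist V x z \<le> cc_dist V x y + cc_dist V y z"
proof (rule ennreal_le_epsilon)
  fix e :: real
  assume fin: "cc_dist V x y + cc_dist V y z < top" and e: "0 < e"
  have lt: "d < d + ennreal (e / 2)" if "d < top" for d :: ennreal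
    using that e by (cases d) (auto simp: ennreal_less_iff simp flip: ennreal_plus)
  have fin': "cc_dist V x y < top" "cc_dist V y z < top" using fin by auto
  obtain \<gamma>\<^sub>1 where 1: "horizontal V \<gamma>\<^sub>1" "\<gamma>\<^sub>1 0 = x" "\<gamma>\<^sub>1 1 = y" "curve_length \<gamma>\<^sub>1 < cc_dist V x y + ennreal (e / 2)"
    using lt[OF fin'(1)] by (rule cc_dist_lessE)
  obtain \<gamma>\<^sub>2 where 2: "horizontal V \<gamma>\<^sub>2" "\<gamma>\<^sub>2 0 = y" "\<gamma>\<^sub>2 1 = z" "curve_length \<gamma>\<^sub>2 < cc_dist V y z + ennreal (e / 2)"
    using lt[OF fin'(2)] by (rule cc_dist_lessE)
  have "curve_length \<gamma>\<^sub>1 < \<infinity>" "curve_length \<gamma>\<^sub>2 < \<infinity>"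
    using order.strict_trans2[OF 1(4) top_greatest] order.strict_trans2[OF 2(4) top_greatest]
    by (simp_all add: infinity_ennreal_def)
  then obtain \<gamma> where \<gamma>: "horizontal V \<gamma>" "\<gamma> 0 = x" "\<gamma> 1 = z" "curve_length \<gamma> = curve_length \<gamma>\<^sub>1 + curve_length \<gamma>\<^sub>2"
    using horizontal_concat[of V \<gamma>\<^sub>1 \<gamma>\<^sub>2] 1 2 sub by auto
  have "cc_dist V x z \<le> curve_length \<gamma>\<^sub>1 + curve_length \<gamma>\<^sub>2" using cc_dist_le[OF \<gamma>(1-3)] \<gamma>(4) by simp
  also have "\<dots> \<le> (cc_dist V x y + ennreal (e / 2)) + (cc_dist V y z + ennreal (e / 2))"
    using 1(4) 2(4) by (intro add_mono less_imp_le)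
  also have "\<dots> = cc_dist V x y + cc_dist V y z + (ennreal (e / 2) + ennreal (e / 2))"
    by (simp add: ac_simps)
  also have "ennreal (e / 2) + ennreal (e / 2) = ennreal e" using e by (simp flip: ennreal_plus)
  finally show "cc_dist V x z \<le> cc_dist V x y + cc_dist V y z + ennreal e" .
qed

lemma cc_dist_refl:
  assumes sub: "\<And>p. subspace (V p)" shows "cc_dist V x x = 0"
proof -
  have "reach V x x L" for L using reach_refl sub subspace_0 by blast
  then have "cc_dist V x x \<le> 0 + ennreal e" if "0 < e" for e
    using cc_dist_le_reach[OF _ that sub] by simp
  then have "cc_dist V x x \<le> 0" by (rule ennreal_le_epsilon)
  then show ?thesis by simp
qed

lemma dist_le_cc_dist: "ennreal (dist x y) \<le> cc_dist V x y"
proof (rule ccontr)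
  assume "\<not> ennreal (dist x y) \<le> cc_dist V x y"
  then have "cc_dist V x y < ennreal (dist x y)" by simp
  then obtain \<gamma> where \<gamma>: "horizontal V \<gamma>" "\<gamma> 0 = x" "\<gamma> 1 = y" "curve_length \<gamma> < ennreal (dist x y)"
    by (rule cc_dist_lessE)
  then have fin: "curve_length \<gamma> < \<infinity>"
    using order.strict_trans2[OF \<gamma>(4) top_greatest] by (simp add: infinity_ennreal_def)
  obtain N g l where vel: "has_velocity V \<gamma> N g l"
    using horizontal_has_velocity[OF \<gamma>(1) fin] by blast
  note N = has_velocityD(1-3)[OF vel] and g = has_velocityD(4,5)[OF vel] and l = has_velocityD(6)[OF vel]
    and int = has_velocityD(7)[OF vel]
  have "norm (\<gamma> 1 - \<gamma> 0) \<le> 1 * l"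
    using horizontal_linear_bound[of "\<lambda>v. v" 1 N g l \<gamma> 1 0] N l int[of 0 1] linear_id by (simp add: id_def)
  then have "ennreal (dist x y) \<le> curve_length \<gamma>"
    using \<gamma> N by (simp add: dist_norm norm_minus_commute)
  then show False using \<gamma>(4) by simp
qed

lemma is_metric_cc_dist:
  assumes sub: "\<And>p. subspace (V p)" and fin: "\<And>x y. cc_dist V x y < \<infinity>"
  shows "is_metric (cc_dist V)"
  unfolding is_metric_def
proof
  show "\<forall>x y. cc_dist V x y < \<infinity>" using fin by blast
  show "Metric_space UNIV (\<lambda>x y. enn2real (cc_dist V x y))"
  proof
    fix x y z
    have ennr: "ennreal (enn2real (cc_dist V x y)) = cc_dist V x y" for x y
      using fin[of x y] by (simp add: infinity_ennreal_def)
    show "0 \<le> enn2real (cc_dist V x y)" by simp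
    show "enn2real (cc_dist V x y) = enn2real (cc_dist V y x)" by (simp only: cc_dist_sym[of V x y, OF sub])
    show "enn2real (cc_dist V x y) = 0 \<longleftrightarrow> x = y"
    proof
      assume "enn2real (cc_dist V x y) = 0"
      then have "cc_dist V x y = 0" using ennr[of x y] by simp
      then show "x = y" using dist_le_cc_dist[of x y V] by simp
    qed (simp add: cc_dist_refl[OF sub])
    have "ennreal (enn2real (cc_dist V x z)) \<le> ennreal (enn2real (cc_dist V x y) + enn2real (cc_dist V y z))"
      using cc_dist_triangle[of V x z y, OF sub] by (simp add: ennr)
    then show "enn2real (cc_dist V x z) \<le> enn2real (cc_dist V x y) + enn2real (cc_dist V y z)"
      by (rule ennreal_le_iff[THEN iffD1, rotated]) simp
  qed
qed

section \<open>The ball-box estimate\<close>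

lemma tame_mono:
  assumes "tame M S f f'" "M \<le> M'" shows "tame M' S f f'"
  unfolding tame_def
proof (intro conjI ballI allI)
  note t = tameD[OF assms(1)]
  show "M'-lipschitz_on S f" using t(1) assms(2) lipschitz_on_mono by blast
  fix p assume p: "p \<in> S"
  show "norm (f p) \<le> M'" using t(2)[OF p] assms(2) by simp
  show "linear (f' p)" using t(3)[OF p] .
  show "norm (f' p v) \<le> M' * norm v" for v
    using t(4)[OF p, of v] mult_right_mono[OF assms(2), of "norm v"] by simp
  fix q assume q: "q \<in> S"
  show "norm (f q - f p - f' p (q - p)) \<le> M' * (norm (q - p))\<^sup>2"
    using t(6)[OF p q] mult_right_mono[OF assms(2), of "(norm (q - p))\<^sup>2"] by simp
  show "norm (f' q v - f' p v) \<le> M' * norm (q - p) * norm v" for v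
    using t(5)[OF p q, of v] mult_right_mono[OF assms(2), of "norm (q - p) * norm v"]
    by (simp add: mult.assoc)
qed

lemma tame_subset:
  assumes "tame M S f f'" "T \<subseteq> S" shows "tame M T f f'"
  using assms lipschitz_on_subset[of M S f T] unfolding tame_def by (simp add: subset_iff)

lemma tame_normalize:
  assumes "tame M S f f'" "0 < M"
  shows "tame 1 S (\<lambda>p. f p /\<^sub>R M) (\<lambda>p v. f' p v /\<^sub>R M)"
  unfolding tame_def
proof (intro conjI ballI allI)
  note t = tameD[OF assms(1)] and M = assms(2)
  have le: "norm (w /\<^sub>R M) \<le> c" if "norm w \<le> M * c" for w :: 'a and c
    using that M by (simp add: field_simps)
  show "1-lipschitz_on S (\<lambda>p. f p /\<^sub>R M)"
  proof (rule lipschitz_onI)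
    fix p q assume pq: "p \<in> S" "q \<in> S"
    have "norm ((f p - f q) /\<^sub>R M) \<le> norm (p - q)"
      using le lipschitz_on_normD[OF t(1) pq] by blast
    then show "dist (f p /\<^sub>R M) (f q /\<^sub>R M) \<le> 1 * dist p q"
      by (simp add: dist_norm scaleR_diff_right)
  qed simp
  fix p assume p: "p \<in> S"
  show "norm (f p /\<^sub>R M) \<le> 1" using le[of "f p" 1] t(2)[OF p] by simp
  show "linear (\<lambda>v. f' p v /\<^sub>R M)"
    by (rule linear_compose_scale_right[OF t(3)[OF p]])
  show "norm (f' p v /\<^sub>R M) \<le> 1 * norm v" for v using le[of "f' p v" "norm v"] t(4)[OF p] by simp
  fix q assume q: "q \<in> S"
  show "norm (f q /\<^sub>R M - f p /\<^sub>R M - f' p (q - p) /\<^sub>R M) \<le> 1 * (norm (q - p))\<^sup>2"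
    using le[OF t(6)[OF p q]] by (simp add: scaleR_diff_right)
  show "norm (f' q v /\<^sub>R M - f' p v /\<^sub>R M) \<le> 1 * norm (q - p) * norm v" for v
    using le[of "f' q v - f' p v" "norm (q - p) * norm v"] t(5)[OF p q, of v]
    by (simp add: scaleR_diff_right mult.assoc)
qed

text \<open>The hypotheses of the theorem. The fields that are brackets are locally Lipschitz, so this is in
  particular a Lipschitz frame.\<close>

locale step2_frame =
  fixes X :: "nat \<Rightarrow> 'a::euclidean_space \<Rightarrow> 'a" and k :: nat
  assumes k_le_DIM: "k \<le> DIM('a)"
    and smooth: "i \<in> {1..k} \<Longrightarrow> smooth (X i)"
    and bracket: "j \<in> {k+1..DIM('a)} \<Longrightarrow> \<exists>a\<in>{1..k}. \<exists>b\<in>{1..k}. X j = lie_bracket (X a) (X b)"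
    and frame: "inj_on (\<lambda>i. X i x) {1..DIM('a)} \<and> independent ((\<lambda>i. X i x) ` {1..DIM('a)})"
begin

lemma common_tame:
  obtains M where "1 \<le> M" "\<And>i. i \<in> {1..k} \<Longrightarrow> tame M (cball 0 R) (X i) (\<lambda>p. frechet_derivative (X i) (at p))"
proof -
  have "\<forall>i\<in>{1..k}. \<exists>M\<ge>1. tame M (cball 0 R) (X i) (\<lambda>p. frechet_derivative (X i) (at p))"
    using smooth_tame_on_ball[OF smooth] by blast
  from bchoice[OF this] obtain M where "\<forall>i\<in>{1..k}. 1 \<le> M i \<and>
      tame (M i) (cball 0 R) (X i) (\<lambda>p. frechet_derivative (X i) (at p))" by blast
  then have M: "\<And>i. i \<in> {1..k} \<Longrightarrow> 1 \<le> M i"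
    "\<And>i. i \<in> {1..k} \<Longrightarrow> tame (M i) (cball 0 R) (X i) (\<lambda>p. frechet_derivative (X i) (at p))"
    by blast+
  have nonneg: "0 \<le> M i" if "i \<in> {1..k}" for i using M(1)[OF that] by simp
  have le: "M i \<le> 1 + sum M {1..k}" if "i \<in> {1..k}" for i
    using member_le_sum[OF that, of M] nonneg by simp
  show thesis
  proof (rule that)
    show "1 \<le> 1 + sum M {1..k}" using sum_nonneg[of "{1..k}" M, OF nonneg] by simp
    show "tame (1 + sum M {1..k}) (cball 0 R) (X i) (\<lambda>p. frechet_derivative (X i) (at p))"
      if "i \<in> {1..k}" for i using tame_mono[OF M(2)[OF that] le[OF that]] .
  qed
qed

sublocale lipschitz_frame X k
proof
  show "k \<le> DIM('a)" by (fact k_le_DIM)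
  show "inj_on (\<lambda>i. X i x) {1..DIM('a)}" "independent ((\<lambda>i. X i x) ` {1..DIM('a)})" for x
    using frame by auto
  fix i R assume i: "i \<in> {1..DIM('a)}"
  show "\<exists>L. L-lipschitz_on (cball 0 R) (X i)"
  proof (cases "i \<le> k")
    case True
    then have "i \<in> {1..k}" using i by simp
    then obtain M where "tame M (cball 0 R) (X i) (\<lambda>p. frechet_derivative (X i) (at p))"
      using smooth_tame_on_ball[OF smooth] by blast
    then show ?thesis using tameD(1) by blast
  next
    case False
    then have "i \<in> {k+1..DIM('a)}" using i by simp
    then obtain a b where "a \<in> {1..k}" "b \<in> {1..k}" "X i = lie_bracket (X a) (X b)"
      using bracket by blast
    then show ?thesis using lie_bracket_lipschitz_on_ball[OF smooth smooth] by simp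
  qed
qed

lemma X_in_V: "i \<in> {1..k} \<Longrightarrow> X i p \<in> V p"
  unfolding span_field_def by (intro span_base) auto

lemma zero_in_V: "0 \<in> V p" using subspace_V subspace_0 by blast

text \<open>A vector in \<open>V x\<close> is realized to second order by the flow of the combination of \<open>X 1, ..., X k\<close> with
  the constant coefficients of that vector at \<open>x\<close>.\<close>

lemma move_along_V:
  obtains C r where "1 \<le> C" "0 < r"
    "\<And>x v. x \<in> cball 0 R \<Longrightarrow> v \<in> V x \<Longrightarrow> norm v \<le> r \<Longrightarrow>
      \<exists>p. reach V x p (C * norm v) \<and> norm (p - x - v) \<le> C * (norm v)\<^sup>2"
proof -
  obtain M where M: "1 \<le> M"
    "\<And>i. i \<in> {1..k} \<Longrightarrow> tame M (cball 0 (R + 1)) (X i) (\<lambda>p. frechet_derivative (X i) (at p))"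
    using common_tame[of "R + 1"] by blast
  obtain D where "frame_bound R D" using frame_bound_exists by blast
  note D = frame_boundD(1,5)[OF this]
  define C0 where "C0 = D * M * real k + 1"
  have DMk: "0 \<le> D * M * real k" using D M by simp
  have C0: "1 \<le> C0" using DMk by (simp add: C0_def)
  show thesis
  proof (rule that[of "C0\<^sup>2" "1 / (2 * C0)"])
    show "1 \<le> C0\<^sup>2" using C0 by (simp add: one_le_power)
    show "0 < 1 / (2 * C0)" using C0 by simp
    fix x v assume x: "x \<in> cball 0 R" and v: "v \<in> V x" and small: "norm v \<le> 1 / (2 * C0)"
    show "\<exists>p. reach V x p (C0\<^sup>2 * norm v) \<and> norm (p - x - v) \<le> C0\<^sup>2 * (norm v)\<^sup>2"
    proof (cases "v = 0")
      case True
      have "reach V x x (C0\<^sup>2 * norm v)" using reach_refl zero_in_V by blast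
      then show ?thesis using True by (intro exI[of _ x]) simp
    next
      case False
      \<comment> \<open>Time is stretched so that the field becomes bounded by \<open>1\<close> and \<open>1\<close>-Lipschitz.\<close>
      define T where "T = C0 * norm v"
      have T: "0 < T" "T \<le> 1 / 2" using False C0 small by (auto simp: T_def field_simps)
      define a where "a i = coeff x v i / T" for i
      define f where "f p = (\<Sum>i\<in>{1..k}. a i *\<^sub>R X i p)" for p
      have sub: "cball x 1 \<subseteq> cball 0 (R + 1)" using x by (simp add: cball_subset_cball_iff)
      have a: "\<bar>a i\<bar> \<le> D / C0" if "i \<in> {1..k}" for i
        using D(2)[OF x, of i v] that k_le_DIM T False C0
        by (simp add: a_def T_def abs_mult field_simps)
      have total: "(\<Sum>i\<in>{1..k}. D / C0 * M) \<le> 1"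
        using C0 DMk by (simp add: C0_def field_simps)
      have bound: "norm (f p) \<le> 1" if p: "p \<in> cball x 1" for p
      proof -
        have "norm (f p) \<le> (\<Sum>i\<in>{1..k}. D / C0 * M)" unfolding f_def
        proof (rule sum_norm_le)
          fix i assume i: "i \<in> {1..k}"
          have "norm (X i p) \<le> M" using tameD(2)[OF M(2)[OF i]] sub p by blast
          then show "norm (a i *\<^sub>R X i p) \<le> D / C0 * M"
            using a[OF i] D C0 unfolding norm_scaleR by (intro mult_mono) auto
        qed
        then show ?thesis using total by simp
      qed
      have lip: "1-lipschitz_on (cball x 1) f"
      proof (rule lipschitz_onI)
        fix p q assume pq: "p \<in> cball x 1" "q \<in> cball x 1"
        have "f p - f q = (\<Sum>i\<in>{1..k}. a i *\<^sub>R (X i p - X i q))"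
          by (simp add: f_def sum_subtractf scaleR_diff_right)
        also have "norm \<dots> \<le> (\<Sum>i\<in>{1..k}. D / C0 * (M * norm (p - q)))"
        proof (rule sum_norm_le)
          fix i assume i: "i \<in> {1..k}"
          have "norm (X i p - X i q) \<le> M * norm (p - q)"
            using lipschitz_on_normD[OF tameD(1)[OF M(2)[OF i]]] sub pq by blast
          then show "norm (a i *\<^sub>R (X i p - X i q)) \<le> D / C0 * (M * norm (p - q))"
            using a[OF i] D C0 unfolding norm_scaleR by (intro mult_mono) auto
        qed
        also have "\<dots> = (\<Sum>i\<in>{1..k}. D / C0 * M) * norm (p - q)"
          unfolding sum_distrib_right by (simp add: mult.assoc)
        also have "\<dots> \<le> 1 * norm (p - q)" using total by (intro mult_right_mono) auto
        finally show "dist (f p) (f q) \<le> 1 * dist p q" by (simp add: dist_norm)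
      qed simp
      have fV: "f p \<in> V p" for p
        unfolding f_def using X_in_V subspace_V by (intro subspace_sum subspace_scale) auto
      have Tf: "T *\<^sub>R f x = v"
        unfolding f_def scaleR_right.sum using T V_coeff_sum[OF v] by (simp add: a_def)
      obtain p where p: "reach V x p T" "norm (p - x - T *\<^sub>R f x) \<le> T\<^sup>2"
        by (rule flow_reach[of x f T V "\<lambda>_. 0"])
          (use bound lip T fV zero_in_V in \<open>auto intro: linear_zero\<close>)
      have "T \<le> C0\<^sup>2 * norm v"
        using mult_left_mono[OF C0, of T] T by (simp add: T_def power2_eq_square mult_ac)
      then have "reach V x p (C0\<^sup>2 * norm v)" using reach_mono[OF p(1)] by blast
      moreover have "norm (p - x - v) \<le> C0\<^sup>2 * (norm v)\<^sup>2"
        using p(2) unfolding Tf by (simp add: T_def power_mult_distrib)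
      ultimately show ?thesis by blast
    qed
  qed
qed

text \<open>A displacement \<open>\<beta>\<close> along a bracket costs length proportional to the square root of \<open>\<bar>\<beta>\<bar>\<close>: run the
  commutator loop for time \<open>M \<surd>\<bar>\<beta>\<bar>\<close>, in the reverse order if \<open>\<beta>\<close> is negative. The bound \<open>s\<close> with
  \<open>\<bar>\<beta>\<bar> \<le> s\<^sup>2\<close> makes the errors of different coefficients comparable.\<close>

lemma move_along_bracket:
  obtains C r where "1 \<le> C" "0 < r"
    "\<And>x j \<beta> s. x \<in> cball 0 R \<Longrightarrow> j \<in> {k+1..DIM('a)} \<Longrightarrow> \<bar>\<beta>\<bar> \<le> s\<^sup>2 \<Longrightarrow> 0 \<le> s \<Longrightarrow> s \<le> r \<Longrightarrow>
      \<exists>p. reach V x p (C * s) \<and> norm (p - x - \<beta> *\<^sub>R X j x) \<le> C * s ^ 3"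
proof -
  obtain M where M: "1 \<le> M"
    "\<And>i. i \<in> {1..k} \<Longrightarrow> tame M (cball 0 (R + 2)) (X i) (\<lambda>p. frechet_derivative (X i) (at p))"
    using common_tame[of "R + 2"] by blast
  define n where "n i p = X i p /\<^sub>R M" for i p
  define n' where "n' i p v = frechet_derivative (X i) (at p) v /\<^sub>R M" for i p v
  have loop: "\<exists>p. reach V x p (4 * T) \<and>
      norm (p - x - (T / M)\<^sup>2 *\<^sub>R lie_bracket (X a) (X b) x) \<le> 78 * T ^ 3"
    if x: "x \<in> cball 0 R" and ab: "a \<in> {1..k}" "b \<in> {1..k}" and T: "0 \<le> T" "T \<le> 1 / 8" for x a b T
  proof -
    have sub: "cball x 2 \<subseteq> cball 0 (R + 2)" using x by (simp add: cball_subset_cball_iff)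
    have tame: "tame 1 (cball x 2) (n i) (n' i)" if "i \<in> {1..k}" for i
      unfolding n_def n'_def using M(1) by (intro tame_normalize tame_subset[OF M(2)[OF that] sub]) simp
    have inV: "n i p \<in> V p" if "i \<in> {1..k}" for i p
      unfolding n_def by (intro subspace_scale subspace_V X_in_V that)
    have lin: "linear (frechet_derivative (X i) (at x))" if "i \<in> {1..k}" for i
      using tameD(3)[OF M(2)[OF that], of x] subsetD[OF sub, of x] by simp
    obtain p where p: "reach V x p (4 * T)"
      "norm (p - x - T\<^sup>2 *\<^sub>R (n' b x (n a x) - n' a x (n b x))) \<le> 78 * T ^ 3"
      by (rule commutator_reach[OF tame[OF ab(1)] inV[OF ab(1)] tame[OF ab(2)] inV[OF ab(2)] subspace_V T])
    have "n' b x (n a x) - n' a x (n b x) = (1 / M)\<^sup>2 *\<^sub>R lie_bracket (X a) (X b) x"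
      by (simp add: n_def n'_def lie_bracket_def linear_scale[OF lin[OF ab(1)]] linear_scale[OF lin[OF ab(2)]] scaleR_diff_right
          power2_eq_square inverse_eq_divide)
    then have "T\<^sup>2 *\<^sub>R (n' b x (n a x) - n' a x (n b x)) = (T / M)\<^sup>2 *\<^sub>R lie_bracket (X a) (X b) x"
      by (simp add: power_divide)
    then show ?thesis using p by auto
  qed
  show thesis
  proof (rule that[of "78 * M ^ 3" "1 / (8 * M)"])
    have M3: "M \<le> M ^ 3" "1 \<le> M ^ 3" using M(1) self_le_power[of M 3] by auto
    then show "1 \<le> 78 * M ^ 3" by simp
    show "0 < 1 / (8 * M)" using M by simp
    fix x :: 'a and j \<beta> s assume x: "x \<in> cball 0 R" and j: "j \<in> {k+1..DIM('a)}"
      and \<beta>: "\<bar>\<beta>\<bar> \<le> s\<^sup>2" and s: "0 \<le> s" "s \<le> 1 / (8 * M)"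
    obtain a b where ab: "a \<in> {1..k}" "b \<in> {1..k}" "X j = lie_bracket (X a) (X b)"
      using bracket[OF j] by blast
    have swap: "lie_bracket (X b) (X a) x = - X j x" by (simp add: ab(3) lie_bracket_def)
    define T where "T = M * sqrt \<bar>\<beta>\<bar>"
    have "sqrt \<bar>\<beta>\<bar> \<le> s" using real_sqrt_le_mono[OF \<beta>] s by simp
    then have Ts: "T \<le> M * s" using M by (simp add: T_def)
    also have "\<dots> \<le> 1 / 8" using s(2) M by (simp add: field_simps)
    finally have T: "0 \<le> T" "T \<le> 1 / 8" using M by (auto simp: T_def)
    have TM: "(T / M)\<^sup>2 = \<bar>\<beta>\<bar>" using M by (simp add: T_def)
    have "\<exists>p. reach V x p (4 * T) \<and> norm (p - x - \<beta> *\<^sub>R X j x) \<le> 78 * T ^ 3"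
    proof (cases "0 \<le> \<beta>")
      case True
      then show ?thesis using loop[OF x ab(1,2) T] unfolding TM ab(3) by simp
    next
      case False
      then show ?thesis using loop[OF x ab(2,1) T] unfolding TM swap by simp
    qed
    then obtain p where p: "reach V x p (4 * T)" "norm (p - x - \<beta> *\<^sub>R X j x) \<le> 78 * T ^ 3" by blast
    have "4 * T \<le> 4 * (M * s)" using Ts by simp
    also have "\<dots> \<le> 78 * (M ^ 3 * s)"
      using mult_right_mono[OF M3(1) s(1)] mult_nonneg_nonneg[of M s] s(1) M(1) by linarith
    also have "\<dots> = 78 * M ^ 3 * s" by simp
    finally have "reach V x p (78 * M ^ 3 * s)" using reach_mono[OF p(1)] by blast
    moreover have "78 * T ^ 3 \<le> 78 * M ^ 3 * s ^ 3"
      using power_mono[OF Ts T(1), of 3] by (simp add: power_mult_distrib)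
    ultimately show "\<exists>p. reach V x p (78 * M ^ 3 * s) \<and> norm (p - x - \<beta> *\<^sub>R X j x) \<le> 78 * M ^ 3 * s ^ 3"
      using p(2) by (intro exI[of _ p]) auto
  qed
qed

text \<open>One bracket after the other. Each loop moves the base point by \<open>O(s)\<close>, which changes the next
  bracket field, weighted with \<open>s\<^sup>2\<close>, by \<open>O(s\<^sup>3)\<close>. The radius \<open>R\<close> is quantified inside, since the induction
  needs a slightly larger ball for the second of two moves.\<close>

lemma move_along_brackets:
  assumes "finite J" "J \<subseteq> {k+1..DIM('a)}"
  shows "\<forall>R. \<exists>C\<ge>1. \<exists>r>0. \<forall>x\<in>cball 0 R. \<forall>\<beta> s. (\<forall>j\<in>J. \<bar>\<beta> j\<bar> \<le> s\<^sup>2) \<longrightarrow> 0 \<le> s \<longrightarrow> s \<le> r \<longrightarrow>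
      (\<exists>p. reach V x p (C * s) \<and> norm (p - x - (\<Sum>j\<in>J. \<beta> j *\<^sub>R X j x)) \<le> C * s ^ 3)"
  using assms
proof (induction J rule: finite_induct)
  case empty
  have "\<exists>p. reach V x p (1 * s) \<and> norm (p - x - 0) \<le> 1 * s ^ 3" if "0 \<le> s" for x s
    using reach_refl[of V x] zero_in_V that by (intro exI[of _ x]) auto
  then show ?case by (intro allI exI[of _ 1] conjI) auto
next
  case (insert j J)
  show ?case
  proof
    fix R :: real
    have j: "j \<in> {k+1..DIM('a)}" "j \<in> {1..DIM('a)}" using insert.prems by auto
    have "\<exists>C\<ge>1. \<exists>r>0. \<forall>x\<in>cball 0 R. \<forall>\<beta> s. (\<forall>j\<in>J. \<bar>\<beta> j\<bar> \<le> s\<^sup>2) \<longrightarrow> 0 \<le> s \<longrightarrow> s \<le> r \<longrightarrow>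
      (\<exists>p. reach V x p (C * s) \<and> norm (p - x - (\<Sum>j\<in>J. \<beta> j *\<^sub>R X j x)) \<le> C * s ^ 3)"
      using insert.IH insert.prems by simp
    then obtain C\<^sub>1 r\<^sub>1 where 1: "1 \<le> C\<^sub>1" "0 < r\<^sub>1" and
      IH: "\<forall>x\<in>cball 0 R. \<forall>\<beta> s. (\<forall>j\<in>J. \<bar>\<beta> j\<bar> \<le> s\<^sup>2) \<longrightarrow> 0 \<le> s \<longrightarrow> s \<le> r\<^sub>1 \<longrightarrow>
      (\<exists>p. reach V x p (C\<^sub>1 * s) \<and> norm (p - x - (\<Sum>j\<in>J. \<beta> j *\<^sub>R X j x)) \<le> C\<^sub>1 * s ^ 3)"
      by (elim exE conjE) (rule that)
    obtain C\<^sub>2 r\<^sub>2 where 2: "1 \<le> C\<^sub>2" "0 < r\<^sub>2" and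
      single: "\<And>x j \<beta> s. x \<in> cball 0 (R + 1) \<Longrightarrow> j \<in> {k+1..DIM('a)} \<Longrightarrow> \<bar>\<beta>\<bar> \<le> s\<^sup>2 \<Longrightarrow> 0 \<le> s \<Longrightarrow> s \<le> r\<^sub>2 \<Longrightarrow>
      \<exists>p. reach V x p (C\<^sub>2 * s) \<and> norm (p - x - \<beta> *\<^sub>R X j x) \<le> C\<^sub>2 * s ^ 3"
      by (rule move_along_bracket[of "R + 1"]) (rule that, assumption, assumption, blast)
    obtain L where L: "L-lipschitz_on (cball 0 (R + 1)) (X j)"
      using lipschitz_frame[OF j(2)] by blast
    have L0: "0 \<le> L" using L lipschitz_on_nonneg by blast
    define C where "C = C\<^sub>1 + C\<^sub>2 + L * C\<^sub>1"
    define r where "r = min (min r\<^sub>1 r\<^sub>2) (1 / C\<^sub>1)"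
    have LC: "0 \<le> L * C\<^sub>1" using L0 1 by simp
    have "1 \<le> C" using 1 2 LC by (simp add: C_def)
    moreover have "0 < r" using 1 2 by (simp add: r_def)
    moreover have "\<exists>p. reach V x p (C * s) \<and> norm (p - x - (\<Sum>j\<in>insert j J. \<beta> j *\<^sub>R X j x)) \<le> C * s ^ 3"
      if x: "x \<in> cball 0 R" and \<beta>: "\<forall>i\<in>insert j J. \<bar>\<beta> i\<bar> \<le> s\<^sup>2" and s: "0 \<le> s" "s \<le> r" for x \<beta> s
    proof -
      have sr: "s \<le> r\<^sub>1" "s \<le> r\<^sub>2" "C\<^sub>1 * s \<le> 1" using s 1 by (auto simp: r_def field_simps)
      have "\<forall>i\<in>J. \<bar>\<beta> i\<bar> \<le> s\<^sup>2" using \<beta> by simp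
      then obtain p where p: "reach V x p (C\<^sub>1 * s)"
        "norm (p - x - (\<Sum>j\<in>J. \<beta> j *\<^sub>R X j x)) \<le> C\<^sub>1 * s ^ 3"
        using IH x s(1) sr(1) by blast
      have px: "norm (p - x) \<le> C\<^sub>1 * s"
        using reach_dist[OF p(1)] 1 s by (simp add: dist_norm norm_minus_commute)
      have in1: "p \<in> cball 0 (R + 1)" "x \<in> cball 0 (R + 1)"
        using px sr(3) x norm_triangle_sub[of p x] by auto
      obtain q where q: "reach V p q (C\<^sub>2 * s)" "norm (q - p - \<beta> j *\<^sub>R X j p) \<le> C\<^sub>2 * s ^ 3"
        using single[OF in1(1) j(1) _ s(1) sr(2)] \<beta> by auto
      have "norm (\<beta> j *\<^sub>R (X j p - X j x)) \<le> s\<^sup>2 * (L * (C\<^sub>1 * s))"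
        unfolding norm_scaleR
      proof (rule mult_mono)
        show "norm (X j p - X j x) \<le> L * (C\<^sub>1 * s)"
          using lipschitz_on_normD[OF L in1] mult_left_mono[OF px L0] by linarith
      qed (use \<beta> in auto)
      then have shift: "norm (\<beta> j *\<^sub>R (X j p - X j x)) \<le> L * C\<^sub>1 * s ^ 3"
        by (simp add: power3_eq_cube power2_eq_square mult_ac)
      have "q - x - (\<Sum>j\<in>insert j J. \<beta> j *\<^sub>R X j x) =
          (p - x - (\<Sum>j\<in>J. \<beta> j *\<^sub>R X j x)) + (q - p - \<beta> j *\<^sub>R X j p) + \<beta> j *\<^sub>R (X j p - X j x)"
        using insert.hyps by (simp add: scaleR_diff_right algebra_simps)
      also have "norm \<dots> \<le> C\<^sub>1 * s ^ 3 + C\<^sub>2 * s ^ 3 + L * C\<^sub>1 * s ^ 3"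
        using p(2) q(2) shift by (intro norm_triangle_le add_mono)
      also have "\<dots> = C * s ^ 3" by (simp add: C_def algebra_simps)
      finally have "norm (q - x - (\<Sum>j\<in>insert j J. \<beta> j *\<^sub>R X j x)) \<le> C * s ^ 3" .
      moreover have "reach V x q (C * s)"
      proof (rule reach_mono[OF reach_trans[OF p(1) q(1)]])
        have "(C\<^sub>1 + C\<^sub>2) * s \<le> C * s" using LC s by (intro mult_right_mono) (simp_all add: C_def)
        then show "C\<^sub>1 * s + C\<^sub>2 * s \<le> C * s" by (simp only: distrib_right)
      qed (use 1 2 s in auto)
      ultimately show ?thesis by blast
    qed
    ultimately show "\<exists>C\<ge>1. \<exists>r>0. \<forall>x\<in>cball 0 R. \<forall>\<beta> s. (\<forall>j\<in>insert j J. \<bar>\<beta> j\<bar> \<le> s\<^sup>2) \<longrightarrow> 0 \<le> s \<longrightarrow> s \<le> r \<longrightarrow>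
      (\<exists>p. reach V x p (C * s) \<and> norm (p - x - (\<Sum>j\<in>insert j J. \<beta> j *\<^sub>R X j x)) \<le> C * s ^ 3)"
      by (intro exI[of _ C] conjI exI[of _ r] ballI allI impI)
  qed
qed

lemma move_along_W:
  obtains C r where "1 \<le> C" "0 < r"
    "\<And>x w s. x \<in> cball 0 R \<Longrightarrow> w \<in> W x \<Longrightarrow> norm w \<le> s\<^sup>2 \<Longrightarrow> 0 \<le> s \<Longrightarrow> s \<le> r \<Longrightarrow>
      \<exists>p. reach V x p (C * s) \<and> norm (p - x - w) \<le> C * s ^ 3"
proof -
  have "\<exists>C\<ge>1. \<exists>r>0. \<forall>x\<in>cball 0 R. \<forall>\<beta> s. (\<forall>j\<in>{k+1..DIM('a)}. \<bar>\<beta> j\<bar> \<le> s\<^sup>2) \<longrightarrow> 0 \<le> s \<longrightarrow> s \<le> r \<longrightarrow>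
      (\<exists>p. reach V x p (C * s) \<and> norm (p - x - (\<Sum>j\<in>{k+1..DIM('a)}. \<beta> j *\<^sub>R X j x)) \<le> C * s ^ 3)"
    using move_along_brackets[of "{k+1..DIM('a)}"] by simp
  then obtain C r where C: "1 \<le> C" "0 < r" and
    move: "\<forall>x\<in>cball 0 R. \<forall>\<beta> s. (\<forall>j\<in>{k+1..DIM('a)}. \<bar>\<beta> j\<bar> \<le> s\<^sup>2) \<longrightarrow> 0 \<le> s \<longrightarrow> s \<le> r \<longrightarrow>
      (\<exists>p. reach V x p (C * s) \<and> norm (p - x - (\<Sum>j\<in>{k+1..DIM('a)}. \<beta> j *\<^sub>R X j x)) \<le> C * s ^ 3)"
    by (elim exE conjE) (rule that)
  obtain D where "frame_bound R D" using frame_bound_exists by blast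
  note D = frame_boundD(1,5)[OF this]
  show thesis
  proof (rule that[of "C * D ^ 3" "r / D"])
    have D3: "D \<le> D ^ 3" "1 \<le> D ^ 3" using D(1) self_le_power[of D 3] by auto
    show "1 \<le> C * D ^ 3" using C D3 mult_mono[of 1 C 1 "D ^ 3"] by simp
    show "0 < r / D" using C D by simp
    fix x w s assume x: "x \<in> cball 0 R" and w: "w \<in> W x" "norm w \<le> s\<^sup>2" and s: "0 \<le> s" "s \<le> r / D"
    have "\<bar>coeff x w j\<bar> \<le> (D * s)\<^sup>2" if "j \<in> {k+1..DIM('a)}" for j
    proof -
      have "\<bar>coeff x w j\<bar> \<le> D * norm w" using D(2)[OF x, of j w] that by simp
      also have "\<dots> \<le> D * s\<^sup>2" using w D by simp
      also have "\<dots> \<le> D\<^sup>2 * s\<^sup>2" using D by (intro mult_right_mono) (auto simp: power2_eq_square)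
      finally show ?thesis by (simp add: power_mult_distrib)
    qed
    moreover have "0 \<le> D * s" "D * s \<le> r" using s D by (auto simp: field_simps)
    ultimately obtain p where p: "reach V x p (C * (D * s))"
      "norm (p - x - (\<Sum>j\<in>{k+1..DIM('a)}. coeff x w j *\<^sub>R X j x)) \<le> C * (D * s) ^ 3"
      using move[rule_format, OF x, of "coeff x w" "D * s"] by blast
    have "C * (D * s) \<le> C * D ^ 3 * s" using C D3 s by (simp add: mult_left_mono mult_right_mono)
    then have "reach V x p (C * D ^ 3 * s)" using reach_mono[OF p(1)] by blast
    moreover have "norm (p - x - w) \<le> C * D ^ 3 * s ^ 3"
      using p(2) unfolding W_coeff_sum[OF w(1), symmetric] by (simp add: power_mult_distrib)
    ultimately show "\<exists>p. reach V x p (C * D ^ 3 * s) \<and> norm (p - x - w) \<le> C * D ^ 3 * s ^ 3" by blast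
  qed
qed

text \<open>The approximate step. Moving along \<open>V\<close> removes the \<open>V\<close>-component of \<open>y - x\<close> and leaves a discrepancy
  \<open>e\<close> of size \<open>O(g\<^sup>2)\<close>; moving along \<open>W\<close> removes the \<open>W\<close>-component of \<open>e\<close> up to \<open>O(g\<^sup>3)\<close> at cost \<open>O(g)\<close>.
  Seen from the new point \<open>z\<close>, the discrepancy \<open>y - z\<close> is still \<open>O(g\<^sup>2)\<close>, and its \<open>W\<close>-component is
  \<open>O(g\<^sup>3)\<close>, because the base point has moved by \<open>O(g\<^sup>2)\<close> only in the second step. For small \<open>g\<close> these
  are at most \<open>g / 2\<close> and \<open>(g / 2)\<^sup>2\<close>.\<close>

lemma halve_gauge:
  obtains C r where "1 \<le> C" "0 < r" "r \<le> 1"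
    "\<And>x y g. x \<in> cball 0 R \<Longrightarrow> g \<le> r \<Longrightarrow> in_box x y g \<Longrightarrow> \<exists>z. reach V x z (C * g) \<and> in_box z y (g / 2)"
proof -
  obtain C\<^sub>1 r\<^sub>1 where 1: "1 \<le> C\<^sub>1" "0 < r\<^sub>1" and move_V:
    "\<And>x v. x \<in> cball 0 R \<Longrightarrow> v \<in> V x \<Longrightarrow> norm v \<le> r\<^sub>1 \<Longrightarrow>
      \<exists>p. reach V x p (C\<^sub>1 * norm v) \<and> norm (p - x - v) \<le> C\<^sub>1 * (norm v)\<^sup>2"
    by (rule move_along_V[of R]) (rule that, assumption, assumption, blast)
  obtain C\<^sub>2 r\<^sub>2 where 2: "1 \<le> C\<^sub>2" "0 < r\<^sub>2" and move_W:
    "\<And>x w s. x \<in> cball 0 (R + 1) \<Longrightarrow> w \<in> W x \<Longrightarrow> norm w \<le> s\<^sup>2 \<Longrightarrow> 0 \<le> s \<Longrightarrow> s \<le> r\<^sub>2 \<Longrightarrow>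
      \<exists>p. reach V x p (C\<^sub>2 * s) \<and> norm (p - x - w) \<le> C\<^sub>2 * s ^ 3"
    by (rule move_along_W[of "R + 1"]) (rule that, assumption, assumption, blast)
  obtain P where "frame_bound (R + 2) P" using frame_bound_exists by blast
  note P = frame_boundD(1-4)[OF this]
  \<comment> \<open>The \<open>W\<close>-component of the discrepancy after the first step is at most \<open>(S g)\<^sup>2\<close>.\<close>
  define S where "S = sqrt (2 * P * C\<^sub>1)"
  have PC: "1 \<le> P * C\<^sub>1" using mult_mono[OF P(1) 1(1)] P(1) by simp
  then have S2: "S\<^sup>2 = 2 * P * C\<^sub>1" unfolding S_def by (intro real_sqrt_pow2) linarith
  have S: "1 \<le> S" unfolding S_def using PC by simp
  \<comment> \<open>After the second step the discrepancy is at most \<open>A g\<^sup>2\<close>, and its \<open>W\<close>-component at most \<open>B g\<^sup>3\<close>.\<close>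
  define A where "A = 2 * C\<^sub>1 + S\<^sup>2 + C\<^sub>2 * S ^ 3"
  have CS: "0 \<le> C\<^sub>2 * S ^ 3" using 2 S by simp
  have A: "1 \<le> A" "S\<^sup>2 + C\<^sub>2 * S ^ 3 \<le> A" "C\<^sub>2 * S ^ 3 \<le> A" "2 * C\<^sub>1 \<le> A"
    using 1(1) CS zero_le_power2[of S] unfolding A_def by linarith+
  define B where "B = P * A\<^sup>2 + P * A"
  have PA: "1 \<le> P * A" using mult_mono[OF P(1) A(1)] P(1) by simp
  have B: "P * A \<le> B" "1 \<le> B"
    using PA P(1) mult_nonneg_nonneg[of P "A\<^sup>2"] zero_le_power2[of A] unfolding B_def by linarith+
  define r where "r = Min {1, r\<^sub>1, r\<^sub>2 / S, 1 / C\<^sub>1, 1 / (C\<^sub>2 * S), 1 / (4 * B)}"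
  have r: "0 < r" unfolding r_def using 1 2 S B by simp
  have rle: "r \<le> 1" "r \<le> r\<^sub>1" "r \<le> r\<^sub>2 / S" "r \<le> 1 / C\<^sub>1" "r \<le> 1 / (C\<^sub>2 * S)" "r \<le> 1 / (4 * B)"
    by (auto simp: r_def)
  show thesis
  proof (rule that[of "C\<^sub>1 + C\<^sub>2 * S" r])
    show "1 \<le> C\<^sub>1 + C\<^sub>2 * S" using 1 2 S by (simp add: add_increasing2)
    show "0 < r" "r \<le> 1" using r rle by auto
    fix x y g
    assume x: "x \<in> cball 0 R" and "g \<le> r" and box: "in_box x y g"
    then have g: "0 \<le> g" "g \<le> r" and gV: "norm (proj x (y - x)) \<le> g"
      and gW: "norm (y - x - proj x (y - x)) \<le> g\<^sup>2" using in_boxD[OF box] by auto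
    have gr: "g \<le> 1" "g \<le> r\<^sub>1" "S * g \<le> r\<^sub>2" "C\<^sub>1 * g \<le> 1" "C\<^sub>2 * (S * g) \<le> 1" "4 * B * g \<le> 1"
      using order_trans[OF g(2) rle(1)] order_trans[OF g(2) rle(2)] order_trans[OF g(2) rle(3)]
        order_trans[OF g(2) rle(4)] order_trans[OF g(2) rle(5)] order_trans[OF g(2) rle(6)] 1 2 S B
      by (simp_all add: field_simps)
    define v where "v = proj x (y - x)"
    have v: "v \<in> V x" "norm v \<le> r\<^sub>1" "norm v \<le> g" using proj_in_V gV gr by (auto simp: v_def)
    obtain p where p: "reach V x p (C\<^sub>1 * norm v)" "norm (p - x - v) \<le> C\<^sub>1 * (norm v)\<^sup>2"
      using move_V[OF x v(1,2)] by blast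
    have p1: "reach V x p (C\<^sub>1 * g)" using reach_mono[OF p(1)] v(3) 1 by simp
    have P0: "0 \<le> P" using P(1) by simp
    have "C\<^sub>1 * (norm v)\<^sup>2 \<le> C\<^sub>1 * g\<^sup>2"
      using power_mono[OF v(3) norm_ge_zero] 1(1) by (intro mult_left_mono) auto
    then have p2: "norm (p - x - v) \<le> C\<^sub>1 * g\<^sup>2" using p(2) by linarith
    have px: "norm (p - x) \<le> 1"
      using reach_dist[OF p1] 1 g gr by (simp add: dist_norm norm_minus_commute)
    have pR: "p \<in> cball 0 (R + 1)" "p \<in> cball 0 (R + 2)"
      using px x norm_triangle_sub[of p x] by auto
    define e where "e = y - p"
    have e_eq: "e = (y - x - v) - (p - x - v)" by (simp add: e_def)
    have "norm e \<le> g\<^sup>2 + C\<^sub>1 * g\<^sup>2"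
      unfolding e_eq using norm_triangle_ineq4[of "y - x - v" "p - x - v"] gW[folded v_def] p2 by linarith
    also have "\<dots> \<le> 2 * C\<^sub>1 * g\<^sup>2" using mult_right_mono[OF 1(1) zero_le_power2[of g]] by linarith
    finally have e: "norm e \<le> 2 * C\<^sub>1 * g\<^sup>2" .
    define w where "w = e - proj p e"
    have "norm w \<le> P * norm e" unfolding w_def using P(3)[OF pR(2)] .
    also have "\<dots> \<le> P * (2 * C\<^sub>1 * g\<^sup>2)" using e P0 by (rule mult_left_mono)
    also have "\<dots> = (S * g)\<^sup>2" by (simp add: power_mult_distrib S2)
    finally have w: "norm w \<le> (S * g)\<^sup>2" .
    have Sg: "0 \<le> S * g" using S g by simp
    have wW: "w \<in> W p" unfolding w_def by (rule diff_proj_in_W)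
    obtain z where z: "reach V p z (C\<^sub>2 * (S * g))" "norm (z - p - w) \<le> C\<^sub>2 * (S * g) ^ 3"
      using move_W[OF pR(1) wW w Sg gr(3)] by blast
    define \<epsilon> where "\<epsilon> = z - p - w"
    have \<epsilon>: "norm \<epsilon> \<le> C\<^sub>2 * S ^ 3 * g ^ 3" using z(2) by (simp add: \<epsilon>_def power_mult_distrib)
    have zp1: "norm (z - p) \<le> 1"
      using reach_dist[OF z(1)] 2 Sg gr by (simp add: dist_norm norm_minus_commute)
    have zR: "z \<in> cball 0 (R + 2)" using zp1 pR norm_triangle_sub[of z p] by auto
    have g3: "g ^ 3 \<le> g\<^sup>2" using power_decreasing[of 2 3 g] g gr by simp
    have "norm (z - p) \<le> norm w + norm \<epsilon>" unfolding \<epsilon>_def using norm_triangle_sub[of "z - p" w] by simp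
    also have "\<dots> \<le> S\<^sup>2 * g\<^sup>2 + C\<^sub>2 * S ^ 3 * g\<^sup>2"
      using w[unfolded power_mult_distrib] \<epsilon> mult_left_mono[OF g3 CS] by linarith
    also have "\<dots> = (S\<^sup>2 + C\<^sub>2 * S ^ 3) * g\<^sup>2" by (simp add: algebra_simps)
    finally have zp: "norm (z - p) \<le> (S\<^sup>2 + C\<^sub>2 * S ^ 3) * g\<^sup>2" .
    have zpA: "norm (z - p) \<le> A * g\<^sup>2"
      by (rule order_trans[OF zp mult_right_mono[OF A(2) zero_le_power2]])
    define e' where "e' = y - z"
    have e'_split: "e' = e - (z - p)" by (simp add: e'_def e_def)
    have "norm e' \<le> 2 * C\<^sub>1 * g\<^sup>2 + (S\<^sup>2 + C\<^sub>2 * S ^ 3) * g\<^sup>2"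
      unfolding e'_split using norm_triangle_ineq4[of e "z - p"] e zp by linarith
    then have e': "norm e' \<le> A * g\<^sup>2" by (simp add: A_def algebra_simps)
    have "4 * B * g * g \<le> 1 * g" by (rule mult_right_mono[OF gr(6) g(1)])
    then have Bg: "4 * (B * g\<^sup>2) \<le> g" by (simp only: power2_eq_square mult.assoc mult_1_left)
    have "4 * B * g * g\<^sup>2 \<le> 1 * g\<^sup>2" by (rule mult_right_mono[OF gr(6) zero_le_power2])
    then have Bg2: "4 * (B * g ^ 3) \<le> g\<^sup>2"
      by (simp only: power3_eq_cube power2_eq_square mult.assoc mult_1_left)
    have "norm (proj z e') \<le> P * (A * g\<^sup>2)"
      using P(2)[OF zR, of e'] mult_left_mono[OF e' P0] by linarith
    also have "\<dots> = P * A * g\<^sup>2" by simp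
    also have "\<dots> \<le> B * g\<^sup>2" by (rule mult_right_mono[OF B(1) zero_le_power2])
    also have "\<dots> \<le> g / 2" using Bg g(1) by linarith
    finally have 3: "norm (proj z e') \<le> g / 2" .
    have e'_eq: "e' = proj p e - \<epsilon>" by (simp add: e'_def e_def \<epsilon>_def w_def)
    have "e' - proj p e' = - (\<epsilon> - proj p \<epsilon>)"
      unfolding e'_eq linear_diff[OF linear_proj] proj_of_V[OF proj_in_V] by simp
    then have "norm (e' - proj p e') = norm (\<epsilon> - proj p \<epsilon>)" by (simp only: norm_minus_cancel)
    also have "\<dots> \<le> P * norm \<epsilon>" using P(3)[OF pR(2)] .
    also have "\<dots> \<le> P * (A * g ^ 3)"
      by (rule mult_left_mono[OF order_trans[OF \<epsilon> mult_right_mono[OF A(3) zero_le_power[OF g(1)]]] P0])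
    finally have 4: "norm (e' - proj p e') \<le> P * A * g ^ 3" by simp
    have "norm (proj z e' - proj p e') \<le> P * norm (z - p) * norm e'" using P(4)[OF zR pR(2)] .
    also have "\<dots> \<le> P * (A * g\<^sup>2) * (A * g\<^sup>2)"
      using zpA e' P0 A(1) by (intro mult_mono) auto
    also have "\<dots> = P * A\<^sup>2 * g ^ 4" by (simp add: power2_eq_square power4_eq_xxxx mult_ac)
    also have "\<dots> \<le> P * A\<^sup>2 * g ^ 3"
      using power_decreasing[of 3 4 g] g(1) gr(1) P0 by (intro mult_left_mono) auto
    finally have 5: "norm (proj z e' - proj p e') \<le> P * A\<^sup>2 * g ^ 3" .
    have "norm (e' - proj z e') \<le> norm (e' - proj p e') + norm (proj z e' - proj p e')"
      using norm_triangle_ineq4[of "e' - proj p e'" "proj z e' - proj p e'"] by simp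
    also have "\<dots> \<le> B * g ^ 3" using 4 5 by (simp add: B_def algebra_simps)
    also have "\<dots> \<le> (g / 2)\<^sup>2"
      using Bg2 by (simp add: power_divide)
    finally have 6: "norm (e' - proj z e') \<le> (g / 2)\<^sup>2" .
    have "reach V x z (C\<^sub>1 * g + C\<^sub>2 * (S * g))"
      using reach_trans[OF p1 z(1)] 1 2 g Sg by simp
    then have "reach V x z ((C\<^sub>1 + C\<^sub>2 * S) * g)" by (simp add: algebra_simps)
    then show "\<exists>z. reach V x z ((C\<^sub>1 + C\<^sub>2 * S) * g) \<and> in_box z y (g / 2)"
      using 3 6 unfolding e'_def in_box_def by blast
  qed
qed

text \<open>Iterating the approximate step produces points that converge to \<open>y\<close>, joined by curves whose
  lengths form a geometric series. Concatenating all of them reaches \<open>y\<close> exactly, so neither an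
  inverse function theorem nor continuous dependence of flows on parameters is used.\<close>

lemma ball_box:
  obtains C r where "1 \<le> C" "0 < r"
    "\<And>x y g. x \<in> cball 0 R \<Longrightarrow> g \<le> r \<Longrightarrow> in_box x y g \<Longrightarrow> reach V x y (C * g)"
proof -
  obtain C r where C: "1 \<le> C" "0 < r" "r \<le> 1" and halve:
    "\<And>x y g. x \<in> cball 0 (R + 1) \<Longrightarrow> g \<le> r \<Longrightarrow> in_box x y g \<Longrightarrow> \<exists>z. reach V x z (C * g) \<and> in_box z y (g / 2)"
    by (rule halve_gauge[of "R + 1"]) (rule that, assumption, assumption, assumption, blast)
  show thesis
  proof (rule that[of "2 * C" "min r (1 / (2 * C))"])
    show "1 \<le> 2 * C" "0 < min r (1 / (2 * C))" using C by auto
    fix x y g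
    assume x: "x \<in> cball 0 R" and g: "g \<le> min r (1 / (2 * C))" and box: "in_box x y g"
    have g0: "0 \<le> g" by (rule in_boxD(3)[OF box])
    have gr: "g \<le> r" "2 * C * g \<le> 1" using g C by (auto simp: field_simps)
    define h where "h i = g / 2 ^ i" for i :: nat
    have h: "0 \<le> h i" "h i \<le> g" "h i \<le> r" for i
      using g0 gr divide_left_mono[of 1 "2 ^ i" g] by (auto simp: h_def)
    \<comment> \<open>The first condition keeps the points in a fixed ball; \<open>2 * C * (g - h i)\<close> is the total length of the first \<open>i\<close> curves.\<close>
    define P where "P i z \<longleftrightarrow> norm (z - x) \<le> 2 * C * (g - h i) \<and> in_box z y (h i) \<and> (i = 0 \<longrightarrow> z = x)" for i z
    have "\<exists>z. \<forall>i. P i (z i) \<and> reach V (z i) (z (Suc i)) (C * h i)"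
    proof (rule dependent_nat_choice)
      show "\<exists>z. P 0 z" unfolding P_def h_def using box by auto
      fix z i assume "P i z"
      then have z: "norm (z - x) \<le> 2 * C * (g - h i)" "in_box z y (h i)" by (auto simp: P_def)
      have "2 * C * (g - h i) \<le> 2 * C * g" using C h(1)[of i] by simp
      then have "norm (z - x) \<le> 1" using z(1) gr by linarith
      then have zR: "z \<in> cball 0 (R + 1)" using x norm_triangle_sub[of z x] by auto
      obtain z' where z': "reach V z z' (C * h i)" "in_box z' y (h i / 2)"
        using halve[OF zR h(3) z(2)] by blast
      have half: "h (Suc i) = h i / 2" by (simp add: h_def)
      have "norm (z' - z) \<le> C * h i"
        using reach_dist[OF z'(1)] C h(1)[of i] by (simp add: dist_norm norm_minus_commute)
      then have "norm (z' - x) \<le> C * h i + 2 * C * (g - h i)"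
        using norm_triangle_ineq[of "z' - z" "z - x"] z(1) by simp
      also have "\<dots> = 2 * C * (g - h (Suc i))" by (simp add: half algebra_simps)
      finally have "P (Suc i) z'" using z'(2) by (simp add: P_def half)
      then show "\<exists>z'. P (Suc i) z' \<and> reach V z z' (C * h i)" using z'(1) by blast
    qed
    then obtain z where z: "\<And>i. in_box (z i) y (h i)" "\<And>i. reach V (z i) (z (Suc i)) (C * h i)" "z 0 = x"
      unfolding P_def by blast
    have geo: "(\<lambda>i. g * (1/2) ^ i) sums (g * 2)"
      using sums_mult[OF geometric_sums[of "1/2::real"], of g] by simp
    have h_eq: "h i = g * (1/2) ^ i" for i by (simp add: h_def power_one_over)
    have h_sums: "(\<lambda>i. C * h i) sums (2 * C * g)"
      using sums_mult[OF geo, of C] by (simp add: h_eq mult_ac)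
    have h_lim: "h \<longlonglongrightarrow> 0"
      using summable_LIMSEQ_zero[OF sums_summable[OF geo]] by (simp add: h_eq[abs_def])
    have "norm (z i - y) \<le> 2 * h i" for i
    proof -
      have "norm (y - z i) \<le> h i + (h i)\<^sup>2" by (rule in_boxD(4)[OF z(1)])
      also have "(h i)\<^sup>2 \<le> h i"
        using h[of i] C mult_left_mono[of "h i" 1 "h i"] by (simp add: power2_eq_square)
      finally show ?thesis by (simp add: norm_minus_commute)
    qed
    then have bound: "\<forall>\<^sub>F i in sequentially. norm (z i - y) \<le> 2 * h i" by (intro always_eventually allI)
    have "(\<lambda>i. 2 * h i) \<longlonglongrightarrow> 0" using tendsto_mult_left[OF h_lim, of 2] by simp
    then have "z \<longlonglongrightarrow> y" by (rule LIM_zero_cancel[OF Lim_null_comparison[OF bound]])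
    then show "reach V x y (2 * C * g)"
      using reach_infinite[of V z "\<lambda>i. C * h i" "2 * C * g" y] z h_sums zero_in_V C h(1) by simp
  qed
qed

end

section \<open>Derived sets\<close>

lemma le_of_le_right_limit:
  fixes h :: "real \<Rightarrow> real"
  assumes "d < u" and le: "\<And>l. d < l \<Longrightarrow> l < u \<Longrightarrow> a \<le> h l" and cont: "isCont h d"
  shows "a \<le> h d"
proof (rule tendsto_lowerbound)
  show "(h \<longlongrightarrow> h d) (at_right d)" using cont by (simp add: isCont_def filterlim_at_split)
  show "\<forall>\<^sub>F l in at_right d. a \<le> h l"
    unfolding eventually_at_right[OF \<open>d < u\<close>] using \<open>d < u\<close> le by blast
qed simp

lemma derived_set_affine:
  assumes "v \<in> derived_set (\<lambda>t. y + t *\<^sub>R w) t"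
  shows "v = w"
proof -
  let ?S = "{((y + a *\<^sub>R w) - (y + b *\<^sub>R w)) /\<^sub>R (a - b) | a b.
      a < b \<and> a \<in> {0..1} \<and> b \<in> {0..1} \<and> \<bar>a - t\<bar> + \<bar>b - t\<bar> \<le> 1}"
  have "?S \<subseteq> {w}" by (auto simp flip: scaleR_diff_left)
  then have "closure ?S \<subseteq> {w}" by (rule closure_minimal) simp
  moreover have "v \<in> closure ?S" using assms unfolding derived_set_def by (elim INT_E[of _ _ _ 1]) auto
  ultimately show ?thesis by blast
qed

text \<open>The mean value inequality for derived sets. Near every \<open>t\<close> all difference quotients have almost
  the bound of the derived set: otherwise there would be quotients on shrinking intervals that
  violate it, and by compactness (they are bounded by the Lipschitz constant) a limit of them in the
  derived set that violates it as well. The local bounds are then added up with Bolzano's principle.\<close>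

lemma derived_set_linear_bound:
  fixes \<gamma> :: "real \<Rightarrow> 'a::euclidean_space" and T :: "'a \<Rightarrow> 'a"
  assumes lip: "L-lipschitz_on {0..1} \<gamma>" and T: "linear T"
    and bound: "\<And>t v. t \<in> {0..1} \<Longrightarrow> v \<in> derived_set \<gamma> t \<Longrightarrow> norm (T v) \<le> M"
    and ab: "0 \<le> a" "a \<le> b" "b \<le> 1"
  shows "norm (T (\<gamma> b - \<gamma> a)) \<le> M * (b - a)"
proof -
  have contT: "isCont T v" for v using T linear_continuous_at linear_conv_bounded_linear by blast
  define S where "S t r = {(\<gamma> a - \<gamma> b) /\<^sub>R (a - b) | a b.
      a < b \<and> a \<in> {0..1} \<and> b \<in> {0..1} \<and> \<bar>a - t\<bar> + \<bar>b - t\<bar> \<le> r}" for t r :: real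
  have S_mono: "S t r \<subseteq> S t r'" if "r \<le> r'" for t r r' unfolding S_def using that by force
  have S_bounded: "norm s \<le> L" if s: "s \<in> S t r" for s t r
  proof -
    obtain a b where ab: "s = (\<gamma> a - \<gamma> b) /\<^sub>R (a - b)" "a < b" "a \<in> {0..1}" "b \<in> {0..1}"
      using s unfolding S_def by auto
    have "norm (\<gamma> a - \<gamma> b) \<le> L * norm (a - b)" by (rule lipschitz_on_normD[OF lip ab(3,4)])
    moreover have "norm s = norm (\<gamma> a - \<gamma> b) / (b - a)"
      unfolding ab(1) norm_scaleR using ab(2) by (simp add: divide_inverse mult.commute)
    ultimately show ?thesis using ab(2) by (simp add: divide_le_eq)
  qed
  have local: "\<exists>r>0. \<forall>s\<in>S t r. norm (T s) < M + e" if t: "t \<in> {0..1}" and e: "0 < e" for t e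
  proof (rule ccontr)
    assume neg: "\<not> (\<exists>r>0. \<forall>s\<in>S t r. norm (T s) < M + e)"
    have "\<exists>s. s \<in> S t (1 / real (Suc n)) \<and> M + e \<le> norm (T s)" for n
    proof (rule ccontr)
      assume "\<nexists>s. s \<in> S t (1 / real (Suc n)) \<and> M + e \<le> norm (T s)"
      then have "\<forall>s\<in>S t (1 / real (Suc n)). norm (T s) < M + e" by force
      then show False using neg by (metis of_nat_0_less_iff zero_less_Suc zero_less_divide_1_iff)
    qed
    then obtain s where s: "\<And>n. s n \<in> S t (1 / real (Suc n))" "\<And>n. M + e \<le> norm (T (s n))"
      by metis
    have "bounded (range s)" using S_bounded[OF s(1)] by (auto simp: bounded_iff)
    then obtain v \<phi> where v: "strict_mono \<phi>" "(s \<circ> \<phi>) \<longlonglongrightarrow> v"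
      using bounded_imp_convergent_subsequence by blast
    have "v \<in> closure (S t r)" if r: "0 < r" for r
    proof (rule Lim_in_closed_set[OF closed_closure _ _ v(2)])
      obtain N where N: "1 / real (Suc N) < r" using nat_approx_posE[OF r] by blast
      have "(s \<circ> \<phi>) n \<in> closure (S t r)" if n: "N \<le> n" for n
      proof -
        have "N \<le> \<phi> n" using seq_suble[OF v(1), of n] n by simp
        then have "1 / real (Suc (\<phi> n)) \<le> 1 / real (Suc N)" by (intro divide_left_mono) auto
        then have "S t (1 / real (Suc (\<phi> n))) \<subseteq> S t r" using N by (intro S_mono) simp
        then show ?thesis using s(1)[of "\<phi> n"] closure_subset[of "S t r"] by auto
      qed
      then show "\<forall>\<^sub>F n in sequentially. (s \<circ> \<phi>) n \<in> closure (S t r)"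
        by (rule eventually_sequentiallyI)
    qed simp
    then have "v \<in> derived_set \<gamma> t" unfolding derived_set_def S_def by (intro INT_I) simp
    then have "norm (T v) \<le> M" by (rule bound[OF t])
    moreover have "M + e \<le> norm (T v)"
    proof (rule LIMSEQ_le_const)
      show "(\<lambda>n. norm (T (s (\<phi> n)))) \<longlonglongrightarrow> norm (T v)"
        using isCont_tendsto_compose[OF contT v(2)] by (intro tendsto_norm) (simp add: o_def)
      show "\<exists>N. \<forall>n\<ge>N. M + e \<le> norm (T (s (\<phi> n)))" using s(2) by blast
    qed
    ultimately show False using e by simp
  qed
  have "norm (T (\<gamma> b - \<gamma> a)) \<le> (M + e) * (b - a)" if e: "0 < e" for e
  proof -
    define P where "P u v \<longleftrightarrow> (0 \<le> u \<longrightarrow> u \<le> v \<longrightarrow> v \<le> 1 \<longrightarrow> norm (T (\<gamma> v - \<gamma> u)) \<le> (M + e) * (v - u))" for u v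
    have "P a b"
    proof (rule Bolzano[OF ab(2)])
      fix u v w assume uv: "P u v" "P v w" "u \<le> v" "v \<le> w"
      show "P u w" unfolding P_def
      proof (intro impI)
        assume "0 \<le> u" "u \<le> w" "w \<le> 1"
        then have "norm (T (\<gamma> v - \<gamma> u)) \<le> (M + e) * (v - u)" "norm (T (\<gamma> w - \<gamma> v)) \<le> (M + e) * (w - v)"
          using uv by (auto simp: P_def)
        moreover have "T (\<gamma> w - \<gamma> u) = T (\<gamma> v - \<gamma> u) + T (\<gamma> w - \<gamma> v)"
          using linear_add[OF T, of "\<gamma> v - \<gamma> u" "\<gamma> w - \<gamma> v"] by simp
        ultimately show "norm (T (\<gamma> w - \<gamma> u)) \<le> (M + e) * (w - u)"
          using norm_triangle_ineq[of "T (\<gamma> v - \<gamma> u)" "T (\<gamma> w - \<gamma> v)"] by (simp add: algebra_simps)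
      qed
    next
      fix t assume t: "a \<le> t" "t \<le> b"
      then have t01: "t \<in> {0..1}" using ab by simp
      obtain r where r: "0 < r" "\<forall>s\<in>S t r. norm (T s) < M + e" using local[OF t01 e] by blast
      show "\<exists>d>0. \<forall>u v. u \<le> t \<and> t \<le> v \<and> v - u < d \<longrightarrow> P u v"
      proof (intro exI[of _ r] conjI allI impI)
        fix u v assume uv: "u \<le> t \<and> t \<le> v \<and> v - u < r"
        show "P u v" unfolding P_def
        proof (intro impI)
          assume b: "0 \<le> u" "u \<le> v" "v \<le> 1"
          show "norm (T (\<gamma> v - \<gamma> u)) \<le> (M + e) * (v - u)"
          proof (cases "u = v")
            case True
            then show ?thesis using linear_0[OF T] by simp
          next
            case False
            then have lt: "u < v" using b by simp
            have "(\<gamma> u - \<gamma> v) /\<^sub>R (u - v) \<in> S t r"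
              unfolding S_def using uv b lt by (intro CollectI exI[of _ u] exI[of _ v]) auto
            then have "norm (T ((\<gamma> u - \<gamma> v) /\<^sub>R (u - v))) \<le> M + e" using r(2) less_imp_le by blast
            moreover have "(\<gamma> u - \<gamma> v) /\<^sub>R (u - v) = (\<gamma> v - \<gamma> u) /\<^sub>R (v - u)"
              by (metis (no_types, opaque_lifting) inverse_minus_eq minus_diff_eq scaleR_minus_left scaleR_minus_right minus_minus)
            ultimately have "norm (T (\<gamma> v - \<gamma> u)) / (v - u) \<le> M + e"
              using lt by (simp add: linear_scale[OF T] divide_inverse mult.commute)
            then show ?thesis using lt by (simp add: field_simps)
          qed
        qed
      qed (use r in simp)
    qed
    then show ?thesis using ab by (simp add: P_def)
  qed
  then show ?thesis
    by (intro le_of_le_right_limit[of 0 1 _ "\<lambda>e. (M + e) * (b - a)", simplified]) (auto intro!: continuous_intros)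
qed

section \<open>Comparison of the distances\<close>

context step2_frame
begin

lemma gauge_eq: "gauge_VW 2 V W x v = norm (proj x v) + sqrt (norm (v - proj x v))"
  by (simp add: gauge_VW_def powr_half_sqrt)

lemma in_box_gauge: "in_box x y (gauge_VW 2 V W x (y - x))"
proof -
  have "norm (v - proj x v) \<le> (gauge_VW 2 V W x v)\<^sup>2" for v
  proof -
    have "norm (v - proj x v) = (sqrt (norm (v - proj x v)))\<^sup>2" by simp
    also have "\<dots> \<le> (gauge_VW 2 V W x v)\<^sup>2" unfolding gauge_eq by (rule power_mono) auto
    finally show ?thesis .
  qed
  moreover have "norm (proj x v) \<le> gauge_VW 2 V W x v" for v unfolding gauge_eq by simp
  ultimately show ?thesis unfolding in_box_def by blast
qed

lemma gauge_le:
  assumes "norm (proj x v) \<le> g" "norm (v - proj x v) \<le> g\<^sup>2" "0 \<le> g"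
  shows "gauge_VW 2 V W x v \<le> 2 * g"
proof -
  have "sqrt (norm (v - proj x v)) \<le> g" using real_sqrt_le_mono[OF assms(2)] assms(3) by simp
  then show ?thesis using assms(1) unfolding gauge_eq by simp
qed

text \<open>A horizontal curve of length \<open>l\<close> from \<open>x\<close> stays within \<open>l\<close> of \<open>x\<close>. Its velocity lies in \<open>V\<close> at the
  moving point, so its \<open>W\<close>-component with respect to \<open>x\<close> is the difference of two projections and hence
  \<open>O(l)\<close> times the speed. Integration gives \<open>O(l\<^sup>2)\<close> for the \<open>W\<close>-component of the increment.\<close>

lemma cc_dist_less_imp_in_box:
  "\<exists>C\<ge>1. \<forall>x\<in>cball 0 R. \<forall>y l. cc_dist V x y < ennreal l \<longrightarrow> l \<le> 1 \<longrightarrow> in_box x y (C * l)"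
proof -
  obtain C where fb: "frame_bound (R + 1) C" using frame_bound_exists by blast
  note C = frame_boundD[OF fb]
  show ?thesis
  proof (intro exI[of _ C] conjI ballI allI impI)
    show "1 \<le> C" by (fact C(1))
    fix x y l assume x: "x \<in> cball 0 R" and less: "cc_dist V x y < ennreal l" and l: "l \<le> 1"
    obtain \<gamma> where \<gamma>: "horizontal V \<gamma>" "\<gamma> 0 = x" "\<gamma> 1 = y" "curve_length \<gamma> < ennreal l"
      using less by (rule cc_dist_lessE)
    have "curve_length \<gamma> < \<infinity>" using order.strict_trans2[OF \<gamma>(4) top_greatest] by simp
    then obtain N g l\<^sub>0 where vel: "has_velocity V \<gamma> N g l\<^sub>0"
      using horizontal_has_velocity[OF \<gamma>(1)] by blast
    note v = has_velocityD[OF vel]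
    have l0: "0 \<le> l\<^sub>0" "l\<^sub>0 < l" using v(2,3) \<gamma>(4) by (auto simp: ennreal_less_iff)
    have near: "norm (\<gamma> t - x) \<le> l\<^sub>0" if t: "t \<in> {0..1}" for t
      using horizontal_linear_bound[of "\<lambda>v. v" 1 N g l\<^sub>0 \<gamma> t 0] v(1,6) v(7)[of 0 t] t \<gamma>(2)
      by (simp add: linear_id[unfolded id_def])
    have xR: "x \<in> cball 0 (R + 1)" using x by simp
    have \<gamma>R: "\<gamma> t \<in> cball 0 (R + 1)" if t: "t \<in> {0..1}" for t
      using near[OF t] l0 l x norm_triangle_sub[of "\<gamma> t" x] by auto
    have int: "(g has_integral \<gamma> 1 - \<gamma> 0) {0..1}" by (rule v(7)) auto
    have "norm (proj x (\<gamma> 1 - \<gamma> 0)) \<le> C * l\<^sub>0"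
      by (rule horizontal_linear_bound[OF linear_proj _ v(1) _ v(6) int])
         (use C(1) C(2)[OF xR] in auto)
    also have "\<dots> \<le> C * l" using l0 C(1) by simp
    finally have V_part: "norm (proj x (y - x)) \<le> C * l" using \<gamma> by simp
    have lin: "linear (\<lambda>v. v - proj x v)"
      by (intro linear_compose_sub linear_proj linear_id[unfolded id_def])
    have "norm (\<gamma> 1 - \<gamma> 0 - proj x (\<gamma> 1 - \<gamma> 0)) \<le> (C * l\<^sub>0) * l\<^sub>0"
    proof (rule horizontal_linear_bound[OF lin _ v(1) _ v(6) int])
      fix t assume t: "t \<in> {0..1} - N"
      have t01: "t \<in> {0..1}" using t by simp
      have "g t = proj (\<gamma> t) (g t)" using proj_of_V[OF v(4)[OF t]] by simp
      then have "norm (g t - proj x (g t)) = norm (proj (\<gamma> t) (g t) - proj x (g t))" by simp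
      also have "\<dots> \<le> C * norm (\<gamma> t - x) * norm (g t)" by (rule C(4)[OF \<gamma>R[OF t01] xR])
      also have "\<dots> \<le> C * l\<^sub>0 * norm (g t)"
        using near[OF t01] C(1) by (intro mult_right_mono mult_left_mono) auto
      finally show "norm (g t - proj x (g t)) \<le> C * l\<^sub>0 * norm (g t)" .
    qed (use C(1) l0 in auto)
    also have "\<dots> \<le> (C * l) * (C * l)"
    proof (rule mult_mono)
      show "C * l\<^sub>0 \<le> C * l" using C(1) l0 by simp
      show "l\<^sub>0 \<le> C * l" using mult_mono[of 1 C l\<^sub>0 l] C(1) l0 by simp
    qed (use C(1) l0 in auto)
    finally have "norm (y - x - proj x (y - x)) \<le> (C * l)\<^sup>2" using \<gamma> by (simp add: power2_eq_square)
    then show "in_box x y (C * l)" using V_part unfolding in_box_def by blast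
  qed
qed

text \<open>The same bound with the distance itself, as the limit over all \<open>l\<close> greater than the distance.\<close>

lemma in_box_cc_dist:
  "\<exists>C\<ge>1. \<forall>x\<in>cball 0 R. \<forall>y d. cc_dist V x y = ennreal d \<longrightarrow> 0 \<le> d \<longrightarrow> d < 1 \<longrightarrow> in_box x y (C * d)"
proof -
  obtain C where C: "1 \<le> C" and
    box: "\<forall>x\<in>cball 0 R. \<forall>y l. cc_dist V x y < ennreal l \<longrightarrow> l \<le> 1 \<longrightarrow> in_box x y (C * l)"
    using cc_dist_less_imp_in_box[of R] by (elim exE conjE) (rule that)
  show ?thesis
  proof (intro exI[of _ C] conjI ballI allI impI)
    show "1 \<le> C" by (fact C)
    fix x y d assume x: "x \<in> cball 0 R" and d: "cc_dist V x y = ennreal d" "0 \<le> d" "d < 1"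
    have *: "in_box x y (C * l)" if "d < l" "l < 1" for l
      using box[rule_format, OF x, of y l] that d by (simp add: ennreal_less_iff)
    have "norm (proj x (y - x)) \<le> C * d"
      by (rule le_of_le_right_limit[OF d(3) in_boxD(1)[OF *]]) (auto intro!: continuous_intros)
    moreover have "norm (y - x - proj x (y - x)) \<le> (C * d)\<^sup>2"
      by (rule le_of_le_right_limit[OF d(3) in_boxD(2)[OF *]]) (auto intro!: continuous_intros)
    ultimately show "in_box x y (C * d)" unfolding in_box_def by blast
  qed
qed

lemma cc_dist_le_of_in_box:
  "\<exists>C\<ge>1. \<exists>r>0. \<forall>x\<in>cball 0 R. \<forall>y g. in_box x y g \<longrightarrow> g \<le> r \<longrightarrow> cc_dist V x y \<le> ennreal (C * g)"
proof -
  obtain C r where C: "1 \<le> C" "0 < r" and join: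
    "\<And>x y g. x \<in> cball 0 R \<Longrightarrow> g \<le> r \<Longrightarrow> in_box x y g \<Longrightarrow> reach V x y (C * g)"
    by (rule ball_box[of R]) (rule that, assumption, assumption, blast)
  show ?thesis
  proof (rule exI[of _ C], rule conjI[OF C(1)], rule exI[of _ r], rule conjI[OF C(2)], intro ballI allI impI)
    fix x y g assume x: "x \<in> cball 0 R" and g: "in_box x y g" "g \<le> r"
    show "cc_dist V x y \<le> ennreal (C * g)"
    proof (cases "g = 0")
      case True
      then have "y = x" using in_boxD(4)[OF g(1)] by simp
      then show ?thesis using cc_dist_refl[of V x, OF subspace_V] by simp
    next
      case False
      then show ?thesis
        using cc_dist_le_reach[OF join[OF x g(2,1)] _ subspace_V] in_boxD(3)[OF g(1)] C by simp
    qed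
  qed
qed

text \<open>A Euclidean ball of radius of order \<open>q\<^sup>2\<close> lies in the box of size \<open>q\<close>.\<close>

lemma cc_dist_locally_small:
  assumes "0 < e"
  shows "\<exists>\<delta>>0. \<forall>x\<in>cball 0 R. \<forall>y. norm (y - x) \<le> \<delta> \<longrightarrow> cc_dist V x y \<le> ennreal e"
proof -
  obtain C r where C: "1 \<le> C" "0 < r" and
    up: "\<forall>x\<in>cball 0 R. \<forall>y g. in_box x y g \<longrightarrow> g \<le> r \<longrightarrow> cc_dist V x y \<le> ennreal (C * g)"
    using cc_dist_le_of_in_box[of R] by (elim exE conjE) (rule that)
  obtain P where "frame_bound R P" using frame_bound_exists by blast
  note P = frame_boundD(1-3)[OF this]
  define q where "q = min (min r (e / C)) 1"
  have q: "0 < q" "q \<le> r" "q \<le> e / C" "q \<le> 1" using C assms by (auto simp: q_def)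
  show ?thesis
  proof (intro exI[of _ "q\<^sup>2 / P"] conjI ballI allI impI)
    show "0 < q\<^sup>2 / P" using q P(1) by simp
    fix x y :: 'a assume x: "x \<in> cball 0 R" and y: "norm (y - x) \<le> q\<^sup>2 / P"
    have Pv: "P * norm (y - x) \<le> q\<^sup>2" using y P(1) by (simp add: field_simps)
    have q2: "q\<^sup>2 \<le> q" using q by (simp add: power2_eq_square mult_left_le)
    have "in_box x y q"
      unfolding in_box_def using P(2)[OF x, of "y - x"] P(3)[OF x, of "y - x"] Pv q2 by linarith
    then have "cc_dist V x y \<le> ennreal (C * q)" using up x q(2) by blast
    also have "\<dots> \<le> ennreal e" using q(3) C(1) by (intro ennreal_leI) (simp add: field_simps)
    finally show "cc_dist V x y \<le> ennreal e" .
  qed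
qed

text \<open>Points near each other have finite distance by the ball-box estimate, and having finite distance
  is an equivalence relation; the space is connected.\<close>

lemma cc_dist_finite: "cc_dist V x y < \<infinity>"
proof (rule connected_equivalence_relation[of UNIV x y "\<lambda>x y. cc_dist V x y < \<infinity>"])
  show "cc_dist V q p < \<infinity>" if "cc_dist V p q < \<infinity>" for p q
    using that cc_dist_sym[of V p q, OF subspace_V] by simp
  show "cc_dist V p s < \<infinity>" if "cc_dist V p q < \<infinity>" "cc_dist V q s < \<infinity>" for p q s
    using cc_dist_triangle[of V p s q, OF subspace_V] that by (simp add: order.strict_trans1)
  fix p :: 'a
  obtain \<delta> where \<delta>: "0 < \<delta>" "\<forall>x\<in>cball 0 (norm p). \<forall>y. norm (y - x) \<le> \<delta> \<longrightarrow> cc_dist V x y \<le> ennreal 1"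
    using cc_dist_locally_small[OF zero_less_one, of "norm p"] by blast
  have "cc_dist V p q < \<infinity>" if "q \<in> ball p \<delta>" for q
  proof -
    have "cc_dist V p q \<le> ennreal 1"
      using \<delta>(2) that by (simp add: dist_norm norm_minus_commute)
    also have "\<dots> < \<infinity>" by simp
    finally show ?thesis .
  qed
  then show "\<exists>T. openin (top_of_set UNIV) T \<and> p \<in> T \<and> (\<forall>q\<in>T. cc_dist V p q < \<infinity>)"
    using \<delta>(1) by (intro exI[of _ "ball p \<delta>"]) (auto simp: openin_open)
qed auto

text \<open>Both inequalities are available, but they ask for smallness of different quantities: the lower one
  for a small distance, the upper one for a small gauge. The lower one shows that a small distance
  forces a small gauge.\<close>

theorem squeezed_cc_dist: "squeezed 2 V W (cc_dist V)"
  unfolding squeezed_def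
proof (intro conjI allI impI)
  show "is_metric (cc_dist V)" by (rule is_metric_cc_dist[OF subspace_V cc_dist_finite])
  fix K :: "'a set" assume "compact K"
  then obtain R where R: "\<forall>x\<in>K. norm x \<le> R" using compact_imp_bounded bounded_iff by metis
  obtain C\<^sub>1 where C1: "1 \<le> C\<^sub>1" and
    low: "\<forall>x\<in>cball 0 R. \<forall>y d. cc_dist V x y = ennreal d \<longrightarrow> 0 \<le> d \<longrightarrow> d < 1 \<longrightarrow> in_box x y (C\<^sub>1 * d)"
    using in_box_cc_dist[of R] by (elim exE conjE) (rule that)
  obtain C\<^sub>2 r where C2: "1 \<le> C\<^sub>2" "0 < r" and
    up: "\<forall>x\<in>cball 0 R. \<forall>y g. in_box x y g \<longrightarrow> g \<le> r \<longrightarrow> cc_dist V x y \<le> ennreal (C\<^sub>2 * g)"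
    using cc_dist_le_of_in_box[of R] by (elim exE conjE) (rule that)
  define C where "C = 2 * C\<^sub>1 + C\<^sub>2"
  define s where "s = min (1 / 2) (r / (2 * C\<^sub>1))"
  have C: "1 < C" using C1 C2 by (simp add: C_def)
  have s: "0 < s" using C1 C2 by (simp add: s_def)
  have main: "gauge_VW 2 V W x (y - x) / C \<le> d \<and> d \<le> C * gauge_VW 2 V W x (y - x)"
    if x: "x \<in> K" and d: "d = enn2real (cc_dist V x y)" "d \<le> s" for x y d
  proof -
    let ?g = "gauge_VW 2 V W x (y - x)"
    have xR: "x \<in> cball 0 R" using x R by simp
    have cc: "cc_dist V x y = ennreal d" using d(1) cc_dist_finite[of x y] by simp
    have d01: "0 \<le> d" "d < 1" "2 * C\<^sub>1 * d \<le> r" using d C1 by (auto simp: s_def field_simps)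
    have box: "in_box x y (C\<^sub>1 * d)" using low[rule_format, OF xR cc d01(1,2)] .
    have g: "?g \<le> 2 * C\<^sub>1 * d" using gauge_le[OF in_boxD(1-3)[OF box]] by simp
    then have gr: "?g \<le> r" using d01 by simp
    have g0: "0 \<le> ?g" by (rule in_boxD(3)[OF in_box_gauge])
    have "ennreal d \<le> ennreal (C\<^sub>2 * ?g)"
      using up[rule_format, OF xR in_box_gauge gr] cc by simp
    then have "d \<le> C\<^sub>2 * ?g" using g0 C2 by (simp add: ennreal_le_iff)
    also have "\<dots> \<le> C * ?g" using C1 g0 by (intro mult_right_mono) (auto simp: C_def)
    finally have 1: "d \<le> C * ?g" .
    have "2 * C\<^sub>1 * d \<le> C * d" using C2 d01 by (intro mult_right_mono) (auto simp: C_def)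
    then have "?g / C \<le> d" using g C by (simp add: field_simps)
    then show ?thesis using 1 by blast
  qed
  show "\<exists>C>1. \<exists>r>0. \<forall>x\<in>K. \<forall>y. enn2real (cc_dist V x y) \<le> r \<longrightarrow>
        gauge_VW 2 V W x (y - x) / C \<le> enn2real (cc_dist V x y) \<and>
        enn2real (cc_dist V x y) \<le> C * gauge_VW 2 V W x (y - x)"
    using C s main by (intro exI[of _ C] exI[of _ s] conjI) auto
qed

lemma segment_in_ball:
  fixes x y z :: 'a
  assumes "y \<in> ball x \<rho>" "z \<in> ball x \<rho>" "t \<in> {0..1}"
  shows "y + t *\<^sub>R (z - y) \<in> ball x \<rho>"
  using convexD_alt[OF convex_ball assms(1,2), of t] assms(3) by (simp add: algebra_simps)

text \<open>The segment from \<open>y\<close> to \<open>z\<close> is a competitor for \<open>dist_V_eta\<close> whose derived sets consist of the single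
  vector \<open>z - y\<close>.\<close>

lemma dist_V_eta_le_segment:
  assumes "\<And>t. t \<in> {0..1} \<Longrightarrow> gauge_VW 2 V W (y + t *\<^sub>R (z - y)) (z - y) \<le> c"
  shows "dist_V_eta 2 V W y z \<le> ennreal c"
proof -
  let ?\<gamma> = "\<lambda>t. y + t *\<^sub>R (z - y)"
  have "(norm (z - y))-lipschitz_on {0..1} ?\<gamma>"
    by (rule lipschitz_onI) (auto simp: dist_norm simp flip: scaleR_diff_left)
  then have "dist_V_eta 2 V W y z \<le> ell 2 V W ?\<gamma>"
    unfolding dist_V_eta_def by (intro INF_lower) auto
  also have "\<dots> \<le> ennreal c"
    unfolding ell_def
  proof (intro SUP_least)
    fix t v assume "t \<in> {0..1}" "v \<in> derived_set ?\<gamma> t"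
    then show "ennreal (gauge_VW 2 V W (?\<gamma> t) v) \<le> ennreal c"
      using assms derived_set_affine by (metis ennreal_leI)
  qed
  finally show ?thesis .
qed

text \<open>The analogue of the length estimate for curves that are merely almost horizontal: a derived vector
  \<open>v\<close> at time \<open>t\<close> has \<open>V\<close>-component at most \<open>e\<close> and \<open>W\<close>-component at most \<open>e\<^sup>2\<close>, both with respect to the
  moving point \<open>\<gamma> t\<close>. As \<open>norm v \<le> 2 e\<close>, the curve stays within \<open>2 e\<close> of \<open>y\<close>, and projecting at \<open>y\<close> instead
  changes the components by \<open>O(e\<^sup>2)\<close>.\<close>

lemma ell_imp_in_box:
  assumes fb: "frame_bound (R + 2) P" and y: "y \<in> cball 0 R"
    and lip: "L-lipschitz_on {0..1} \<gamma>" and ends: "\<gamma> 0 = y" "\<gamma> 1 = z"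
    and ell: "ell 2 V W \<gamma> \<le> ennreal e" and e: "0 \<le> e" "e \<le> 1"
  shows "in_box y z (5 * P * e)"
proof -
  note P = frame_boundD[OF fb]
  have gauge: "gauge_VW 2 V W (\<gamma> t) v \<le> e" if "t \<in> {0..1}" "v \<in> derived_set \<gamma> t" for t v
  proof -
    have "ennreal (gauge_VW 2 V W (\<gamma> t) v) \<le> ell 2 V W \<gamma>"
      unfolding ell_def using that by (intro SUP_upper2[of t] SUP_upper) auto
    also have "\<dots> \<le> ennreal e" by (fact ell)
    finally show ?thesis using e by (simp add: ennreal_le_iff)
  qed
  have comp: "norm (proj (\<gamma> t) v) \<le> e" "norm (v - proj (\<gamma> t) v) \<le> e\<^sup>2" "norm v \<le> 2 * e"
    if t: "t \<in> {0..1}" "v \<in> derived_set \<gamma> t" for t v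
  proof -
    have box: "in_box (\<gamma> t) (\<gamma> t + v) (gauge_VW 2 V W (\<gamma> t) v)"
      using in_box_gauge[of "\<gamma> t" "\<gamma> t + v"] by simp
    show 1: "norm (proj (\<gamma> t) v) \<le> e" using in_boxD(1)[OF box] gauge[OF t] by simp
    show 2: "norm (v - proj (\<gamma> t) v) \<le> e\<^sup>2"
      using in_boxD(2)[OF box] power_mono[OF gauge[OF t] in_boxD(3)[OF box], of 2] by simp
    have "e\<^sup>2 \<le> e" using e by (simp add: power2_eq_square mult_left_le)
    then show "norm v \<le> 2 * e"
      using 1 2 norm_triangle_ineq[of "proj (\<gamma> t) v" "v - proj (\<gamma> t) v"] by simp
  qed
  have near: "norm (\<gamma> t - y) \<le> 2 * e" if t: "t \<in> {0..1}" for t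
  proof -
    have "norm (\<gamma> t - \<gamma> 0) \<le> 2 * e * (t - 0)"
      by (rule derived_set_linear_bound[OF lip, of "\<lambda>v. v"])
         (use comp(3) t in \<open>auto simp: linear_id[unfolded id_def]\<close>)
    also have "\<dots> \<le> 2 * e" using t e by (simp add: mult_left_le)
    finally show ?thesis using ends by simp
  qed
  have yR: "y \<in> cball 0 (R + 2)" using y by simp
  have \<gamma>R: "\<gamma> t \<in> cball 0 (R + 2)" if t: "t \<in> {0..1}" for t
    using near[OF t] e y norm_triangle_sub[of "\<gamma> t" y] by auto
  have change: "norm (proj (\<gamma> t) v - proj y v) \<le> 4 * P * e\<^sup>2"
    if t: "t \<in> {0..1}" "v \<in> derived_set \<gamma> t" for t v
  proof -
    have "norm (proj (\<gamma> t) v - proj y v) \<le> P * norm (\<gamma> t - y) * norm v"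
      by (rule P(4)[OF \<gamma>R[OF t(1)] yR])
    also have "\<dots> \<le> P * (2 * e) * (2 * e)"
      using near[OF t(1)] comp(3)[OF t] P(1) e by (intro mult_mono) auto
    finally show ?thesis by (simp add: power2_eq_square)
  qed
  have "norm (proj y (\<gamma> 1 - \<gamma> 0)) \<le> 5 * P * e * (1 - 0)"
  proof (rule derived_set_linear_bound[OF lip linear_proj])
    fix t v assume t: "t \<in> {0..1}" "v \<in> derived_set \<gamma> t"
    have "norm (proj y v) \<le> e + 4 * P * e\<^sup>2"
      using norm_triangle_ineq4[of "proj (\<gamma> t) v" "proj (\<gamma> t) v - proj y v"] comp(1)[OF t] change[OF t] by simp
    also have "\<dots> \<le> P * e + 4 * P * e"
    proof (rule add_mono)
      show "e \<le> P * e" using mult_right_mono[OF P(1) e(1)] by simp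
      show "4 * P * e\<^sup>2 \<le> 4 * P * e"
        using e P(1) by (intro mult_left_mono) (auto simp: power2_eq_square mult_left_le)
    qed
    finally show "norm (proj y v) \<le> 5 * P * e" by simp
  qed auto
  moreover have "norm (\<gamma> 1 - \<gamma> 0 - proj y (\<gamma> 1 - \<gamma> 0)) \<le> 5 * P * e\<^sup>2 * (1 - 0)"
  proof (rule derived_set_linear_bound[OF lip, of "\<lambda>v. v - proj y v"])
    show "linear (\<lambda>v. v - proj y v)"
      by (intro linear_compose_sub linear_proj linear_id[unfolded id_def])
    fix t v assume t: "t \<in> {0..1}" "v \<in> derived_set \<gamma> t"
    have "norm (v - proj y v) \<le> e\<^sup>2 + 4 * P * e\<^sup>2"
      using norm_triangle_ineq[of "v - proj (\<gamma> t) v" "proj (\<gamma> t) v - proj y v"] comp(2)[OF t] change[OF t] by simp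
    also have "\<dots> \<le> 5 * P * e\<^sup>2"
      using mult_right_mono[OF P(1), of "e\<^sup>2"] by simp
    finally show "norm (v - proj y v) \<le> 5 * P * e\<^sup>2" .
  qed auto
  moreover have "5 * P * e\<^sup>2 \<le> (5 * P * e)\<^sup>2"
    using mult_right_mono[of 1 "5 * P" "5 * P * e\<^sup>2"] P(1) by (simp add: power2_eq_square mult_ac)
  ultimately show ?thesis using ends unfolding in_box_def by simp
qed

text \<open>Shrink the neighbourhood until \<open>cc_dist\<close> is below \<open>1\<close> on it. The segment gives one inequality,
  because the gauge of \<open>z - y\<close> changes little along it. For the other, a curve with \<open>ell \<ge> 1\<close> needs no
  argument, and for \<open>ell < 1\<close> the point \<open>z\<close> lies in a box around \<open>y\<close> of size comparable with \<open>ell\<close>, so that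
  the ball-box estimate applies.\<close>

theorem cc_dist_locally_equivalent:
  "\<exists>U C. open U \<and> x \<in> U \<and> (C::real) > 1 \<and> (\<forall>y\<in>U. \<forall>z\<in>U.
     ennreal (1 / C) * cc_dist V y z \<le> dist_V_eta 2 V W y z \<and>
     dist_V_eta 2 V W y z \<le> ennreal C * cc_dist V y z)"
proof -
  define R where "R = norm x + 1"
  obtain C\<^sub>1 where C1: "1 \<le> C\<^sub>1" and
    low: "\<forall>x\<in>cball 0 R. \<forall>y d. cc_dist V x y = ennreal d \<longrightarrow> 0 \<le> d \<longrightarrow> d < 1 \<longrightarrow> in_box x y (C\<^sub>1 * d)"
    using in_box_cc_dist[of R] by (elim exE conjE) (rule that)
  obtain C\<^sub>2 r where C2: "1 \<le> C\<^sub>2" "0 < r" and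
    up: "\<forall>x\<in>cball 0 R. \<forall>y g. in_box x y g \<longrightarrow> g \<le> r \<longrightarrow> cc_dist V x y \<le> ennreal (C\<^sub>2 * g)"
    using cc_dist_le_of_in_box[of R] by (elim exE conjE) (rule that)
  obtain P where fb: "frame_bound (R + 2) P" using frame_bound_exists by blast
  note P = frame_boundD[OF fb]
  obtain \<delta> where \<delta>: "0 < \<delta>" "\<forall>x\<in>cball 0 R. \<forall>y. norm (y - x) \<le> \<delta> \<longrightarrow> cc_dist V x y \<le> ennreal (1 / 2)"
    using cc_dist_locally_small[of "1 / 2" R] by auto
  define \<rho> where "\<rho> = min 1 (\<delta> / 2)"
  define K where "K = 5 * P * C\<^sub>2 + 5 * P / r"
  define C where "C = K + 2 * (C\<^sub>1 + P)"
  have K: "5 * P * C\<^sub>2 \<le> K" "5 * P / r \<le> K" "0 \<le> K" using P(1) C2 by (auto simp: K_def)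
  have C: "1 < C" "K \<le> C" "2 * (C\<^sub>1 + P) \<le> C" using K C1 P(1) by (auto simp: C_def)
  have inR: "y \<in> cball 0 R" if "y \<in> ball x \<rho>" for y
    using that norm_triangle_sub[of y x] by (auto simp: R_def \<rho>_def dist_norm norm_minus_commute)
  have both: "ennreal (1 / C) * cc_dist V y z \<le> dist_V_eta 2 V W y z \<and>
     dist_V_eta 2 V W y z \<le> ennreal C * cc_dist V y z" if y: "y \<in> ball x \<rho>" and z: "z \<in> ball x \<rho>" for y z
  proof
    define d where "d = enn2real (cc_dist V y z)"
    have cc: "cc_dist V y z = ennreal d" using cc_dist_finite[of y z] by (simp add: d_def)
    have d0: "0 \<le> d" by (simp add: d_def)
    have "norm (z - y) \<le> \<delta>"
      using y z dist_triangle2[of z y x] by (simp add: \<rho>_def dist_norm norm_minus_commute)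
    then have "cc_dist V y z \<le> ennreal (1 / 2)" using \<delta>(2) inR[OF y] by blast
    then have "d \<le> 1 / 2" unfolding cc by (rule ennreal_le_iff[THEN iffD1, rotated]) simp
    then have d1: "d < 1" by simp
    have zy: "norm (z - y) \<le> d"
      using dist_le_cc_dist[of y z V] unfolding cc dist_norm norm_minus_commute[of y z]
      by (rule ennreal_le_iff[THEN iffD1, OF d0])
    have box: "in_box y z (C\<^sub>1 * d)" using low[rule_format, OF inR[OF y] cc d0 d1] .
    have yR: "y \<in> cball 0 (R + 2)" using inR[OF y] by simp
    show "dist_V_eta 2 V W y z \<le> ennreal C * cc_dist V y z"
    proof -
      have "gauge_VW 2 V W (y + t *\<^sub>R (z - y)) (z - y) \<le> 2 * ((C\<^sub>1 + P) * d)"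
        if t: "t \<in> {0..1}" for t
      proof (rule gauge_le)
        define p where "p = y + t *\<^sub>R (z - y)"
        have pR: "p \<in> cball 0 (R + 2)"
          using inR[OF segment_in_ball[OF y z t]] by (simp add: p_def)
        have py: "norm (y - p) \<le> d"
          using t zy mult_left_le_one_le[of "norm (z - y)" t] by (simp add: p_def)
        have "P * norm (z - y) \<le> (C\<^sub>1 + P) * d" using P(1) C1 zy by (intro mult_mono) auto
        then show "norm (proj (y + t *\<^sub>R (z - y)) (z - y)) \<le> (C\<^sub>1 + P) * d"
          using P(2)[OF pR, of "z - y"] unfolding p_def by linarith
        have "norm (proj y (z - y) - proj p (z - y)) \<le> P * norm (y - p) * norm (z - y)"
          by (rule P(4)[OF yR pR])
        also have "\<dots> \<le> P * d * d" using py zy P(1) d0 by (intro mult_mono) auto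
        finally have "norm (z - y - proj p (z - y)) \<le> (C\<^sub>1 * d)\<^sup>2 + P * d * d"
          using in_boxD(2)[OF box]
            norm_triangle_ineq[of "z - y - proj y (z - y)" "proj y (z - y) - proj p (z - y)"] by simp
        also have "\<dots> = (C\<^sub>1\<^sup>2 + P) * d\<^sup>2" by (simp add: power2_eq_square algebra_simps)
        also have "\<dots> \<le> (C\<^sub>1 + P)\<^sup>2 * d\<^sup>2"
        proof (rule mult_right_mono)
          have "P \<le> P\<^sup>2" "0 \<le> 2 * C\<^sub>1 * P" using C1 P(1) by (simp_all add: self_le_power)
          then show "C\<^sub>1\<^sup>2 + P \<le> (C\<^sub>1 + P)\<^sup>2" unfolding power2_sum by linarith
        qed simp
        finally show "norm (z - y - proj (y + t *\<^sub>R (z - y)) (z - y)) \<le> ((C\<^sub>1 + P) * d)\<^sup>2"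
          by (simp add: p_def power_mult_distrib)
        show "0 \<le> (C\<^sub>1 + P) * d" using C1 P(1) d0 by simp
      qed
      then have "dist_V_eta 2 V W y z \<le> ennreal (2 * ((C\<^sub>1 + P) * d))" by (rule dist_V_eta_le_segment)
      also have "\<dots> \<le> ennreal (C * d)"
        using mult_right_mono[OF C(3) d0] by (intro ennreal_leI) (simp only: mult.assoc)
      also have "\<dots> = ennreal C * cc_dist V y z" unfolding cc using C d0 by (simp add: ennreal_mult)
      finally show ?thesis .
    qed
    show "ennreal (1 / C) * cc_dist V y z \<le> dist_V_eta 2 V W y z"
      unfolding dist_V_eta_def
    proof (rule INF_greatest)
      fix \<gamma> :: "real \<Rightarrow> 'a" assume "\<gamma> \<in> {\<gamma>. (\<exists>L. L-lipschitz_on {0..1} \<gamma>) \<and> \<gamma> 0 = y \<and> \<gamma> 1 = z}"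
      then obtain L where \<gamma>: "L-lipschitz_on {0..1} \<gamma>" "\<gamma> 0 = y" "\<gamma> 1 = z" by blast
      have lhs: "ennreal (1 / C) * cc_dist V y z = ennreal (d / C)"
        unfolding cc using C d0 by (simp flip: ennreal_mult)
      show "ennreal (1 / C) * cc_dist V y z \<le> ell 2 V W \<gamma>"
      proof (cases "ell 2 V W \<gamma> < 1")
        case False
        have "d / C \<le> 1" using d1 C by (simp add: field_simps)
        then have "ennreal (d / C) \<le> 1" using ennreal_leI[of "d / C" 1] by simp
        then show ?thesis using False unfolding lhs not_less by (rule order_trans)
      next
        case True
        define e where "e = enn2real (ell 2 V W \<gamma>)"
        have ell: "ell 2 V W \<gamma> = ennreal e"
          unfolding e_def using order.strict_trans[OF True ennreal_one_less_top] by (rule ennreal_enn2real[symmetric])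
        have e0: "0 \<le> e" by (simp add: e_def)
        have "ennreal e < ennreal 1" using True unfolding ell by simp
        then have e: "0 \<le> e" "e < 1" using e0 by (simp_all only: ennreal_less_iff)
        have "d \<le> K * e"
        proof (rule le_of_le_right_limit[OF e(2)])
          fix l assume l: "e < l" "l < 1"
          have "ell 2 V W \<gamma> \<le> ennreal l" unfolding ell using l by (intro ennreal_leI) simp
          then have box_l: "in_box y z (5 * P * l)"
            using ell_imp_in_box[OF fb inR[OF y] \<gamma>] l e by simp
          show "d \<le> K * l"
          \<comment> \<open>The ball-box estimate holds for boxes of size up to \<open>r\<close>; beyond that, \<open>d < 1\<close> suffices.\<close>
          proof (cases "5 * P * l \<le> r")
            case True
            have "ennreal d \<le> ennreal (C\<^sub>2 * (5 * P * l))"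
              using up[rule_format, OF inR[OF y] box_l True] cc by simp
            then have "d \<le> C\<^sub>2 * (5 * P * l)" using C2 P(1) l e by (simp add: ennreal_le_iff)
            also have "\<dots> = 5 * P * C\<^sub>2 * l" by simp
            also have "\<dots> \<le> K * l" using l e by (intro mult_right_mono K) simp
            finally show ?thesis .
          next
            case False
            then have "1 \<le> 5 * P / r * l" using C2 by (simp add: field_simps)
            also have "\<dots> \<le> K * l" using l e by (intro mult_right_mono K) simp
            finally show ?thesis using d1 by simp
          qed
        qed (auto intro!: continuous_intros)
        also have "\<dots> \<le> C * e" using C e by (intro mult_right_mono) auto
        finally have "d / C \<le> e" using C by (simp add: field_simps)
        then show ?thesis unfolding lhs ell by (rule ennreal_leI)
      qed
    qed
  qed
  have "x \<in> ball x \<rho>" using \<delta>(1) by (simp add: \<rho>_def)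
  then show ?thesis using both C(1) by (intro exI[of _ "ball x \<rho>"] exI[of _ C]) auto
qed

end

theorem proposition5p2p8:
  fixes X :: "nat \<Rightarrow> real ^ 'n \<Rightarrow> real ^ 'n"
    and k :: nat
    and V W :: "real ^ 'n \<Rightarrow> (real ^ 'n) set"
  assumes "k \<le> CARD('n)"
    and "\<And>i. i \<in> {1..k} \<Longrightarrow> smooth (X i)"
    and "\<And>j. j \<in> {k+1..CARD('n)} \<Longrightarrow> \<exists>a\<in>{1..k}. \<exists>b\<in>{1..k}. X j = lie_bracket (X a) (X b)"
    and "\<And>x. inj_on (\<lambda>i. X i x) {1..CARD('n)} \<and> independent ((\<lambda>i. X i x) ` {1..CARD('n)})"
    and "V = span_field X {1..k}"
    and "W = span_field X {k+1..CARD('n)}"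
  shows "squeezed 2 V W (cc_dist V) \<and>
         (\<forall>x. \<exists>U C. open U \<and> x \<in> U \<and> (C::real) > 1 \<and>
           (\<forall>y\<in>U. \<forall>z\<in>U.
              ennreal (1 / C) * cc_dist V y z \<le> dist_V_eta 2 V W y z \<and>
              dist_V_eta 2 V W y z \<le> ennreal C * cc_dist V y z))"
proof -
  have dim: "DIM(real ^ 'n) = CARD('n)" by simp
  interpret step2_frame X k
  proof
    show "k \<le> DIM(real ^ 'n)" using assms(1) unfolding dim .
    show "smooth (X i)" if "i \<in> {1..k}" for i using assms(2)[OF that] .
    show "\<exists>a\<in>{1..k}. \<exists>b\<in>{1..k}. X j = lie_bracket (X a) (X b)" if "j \<in> {k+1..DIM(real ^ 'n)}" for j
      using assms(3)[of j] that unfolding dim .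
    show "inj_on (\<lambda>i. X i x) {1..DIM(real ^ 'n)} \<and> independent ((\<lambda>i. X i x) ` {1..DIM(real ^ 'n)})" for x
      using assms(4)[of x] unfolding dim .
  qed
  show ?thesis
    using squeezed_cc_dist cc_dist_locally_equivalent unfolding assms(5,6) dim by blast
qed

end
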